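(* Let $\Delta\subset\mathbb{R}^n_q$ be a convex body. For $u\in S^n_\Delta$ and $\bar q\in H_u$, $$\zeta^{\tau_0}(\Delta)\le c_{\rm EHZ,\tau_0}(Z^{2n}_\Delta)=2\,{\rm width}(\Delta).$$
   Context: $\mathbb{R}^{2n}=\mathbb{R}^n_q\times\mathbb{R}^n_p$, $\omega_0=dq\wedge dp$, $\tau_0(q,p)=(q,-p)$. Symmetric capacity: for $\tau_0$-invariant open $U$ meeting ${\rm Fix}(\tau_0)$, $c_{\rm HZ,\tau_0}(U)=\sup\{\max H\}$ over $\tau_0$-invariant smooth $H:U\to[0,\infty)$ vanishing on a nonempty open set meeting ${\rm Fix}(\tau_0)$, equal to $\max H$ outside a compact subset of $U$, whose Hamiltonian flow ($\omega_0(X_H,\cdot)=-dH$) has no nonconstant $T$-periodic orbit $x$ with $x(T-t)=x(-t)=\tau_0(x(t))$, $T\in(0,1]$; for a $\tau_0$-invariant convex set $C$ with interior points, $c_{\rm EHZ,\tau_0}(C)=c_{\rm HZ,\tau_0}({\rm Int}C,\omega_0)$, and $\zeta^{\tau_0}(\Delta)=c_{\rm EHZ,\tau_0}(\Delta\times B^n(1))$ with $B^n(1)$ the closed unit ball of $\mathbb{R}^n_p$. With $h_\Delta(w)=\sup_{x\in\Delta}\langle x,w\rangle$ and $S^n=\{u\in\mathbb{R}^n\,|\,\|u\|=1\}$: ${\rm width}(\Delta)=\min\{h_\Delta(u)+h_\Delta(-u)\,|\,u\in S^n\}$, $S^n_\Delta=\{u\in S^n\,|\,{\rm width}(\Delta)=h_\Delta(u)+h_\Delta(-u)\}$,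 $H_u=\{x\in\mathbb{R}^n\,|\,\langle x,u\rangle=(h_\Delta(u)-h_\Delta(-u))/2\}$, and $Z^{2n}_\Delta=([-{\rm width}(\Delta)/2,{\rm width}(\Delta)/2]\times\mathbb{R}^{n-1})\times([-1,1]\times\mathbb{R}^{n-1})\subset\mathbb{R}^n_q\times\mathbb{R}^n_p$. *)

theory Defs
  imports "HOL-Analysis.Analysis"
begin

text \<open>Phase space R^{2n} = R^n_q x R^n_p, points written (q,p).\<close>
type_synonym 'n ps = "(real^'n) \<times> (real^'n)"

definition omega0 :: "'n::finite ps \<Rightarrow> 'n ps \<Rightarrow> real" where
  "omega0 z w = fst z \<bullet> snd w - snd z \<bullet> fst w"

definition tau0 :: "'n::finite ps \<Rightarrow> 'n ps" where
  "tau0 z = (fst z, - snd z)"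

definition Fix_tau0 :: "'n::finite ps set" where
  "Fix_tau0 = {z. tau0 z = z}"

coinductive smooth_on :: "'a::real_normed_vector set \<Rightarrow> ('a \<Rightarrow> real) \<Rightarrow> bool"
  for U where
  "f differentiable_on U \<Longrightarrow> (\<And>v. smooth_on U (\<lambda>z. frechet_derivative f (at z) v))
     \<Longrightarrow> smooth_on U f"

definition ham_orbit :: "('n::finite ps \<Rightarrow> real) \<Rightarrow> (real \<Rightarrow> 'n ps) \<Rightarrow> bool" where
  "ham_orbit H x \<longleftrightarrow> (\<forall>t. x differentiable (at t) \<and>
     (\<forall>v. omega0 (vector_derivative x (at t)) v = - frechet_derivative H (at (x t)) v))"

definition sym_periodic_orbit ::
  "'n::finite ps set \<Rightarrow> ('n ps \<Rightarrow> real) \<Rightarrow> real \<Rightarrow> (real \<Rightarrow> 'n ps) \<Rightarrow> bool" where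
  "sym_periodic_orbit U H T x \<longleftrightarrow> ham_orbit H x \<and> (\<forall>t. x t \<in> U) \<and>
     (\<forall>t. x (t + T) = x t) \<and> (\<exists>s t. x s \<noteq> x t) \<and>
     (\<forall>t. x (T - t) = x (- t) \<and> x (- t) = tau0 (x t))"

definition HZ_admissible :: "'n::finite ps set \<Rightarrow> ('n ps \<Rightarrow> real) \<Rightarrow> real \<Rightarrow> bool" where
  "HZ_admissible U H m \<longleftrightarrow>
     smooth_on U H \<and>
     (\<forall>z\<in>U. tau0 z \<in> U \<longrightarrow> H (tau0 z) = H z) \<and>
     (\<forall>z\<in>U. 0 \<le> H z \<and> H z \<le> m) \<and>
     (\<exists>V. open V \<and> V \<noteq> {} \<and> V \<subseteq> U \<and> V \<inter> Fix_tau0 \<noteq> {} \<and> (\<forall>z\<in>V. H z = 0)) \<and>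
     (\<exists>K. compact K \<and> K \<subseteq> U \<and> (\<forall>z\<in>U - K. H z = m)) \<and>
     \<not> (\<exists>T x. 0 < T \<and> T \<le> 1 \<and> sym_periodic_orbit U H T x)"

definition c_HZ_tau0 :: "'n::finite ps set \<Rightarrow> ereal" where
  "c_HZ_tau0 U = Sup {ereal m | m. \<exists>H. HZ_admissible U H m}"

definition c_EHZ_tau0 :: "'n::finite ps set \<Rightarrow> ereal" where
  "c_EHZ_tau0 C = c_HZ_tau0 (interior C)"

definition zeta_tau0 :: "(real^'n::finite) set \<Rightarrow> ereal" where
  "zeta_tau0 \<Delta> = c_EHZ_tau0 (\<Delta> \<times> cball 0 1)"

definition support_fn :: "(real^'n::finite) set \<Rightarrow> real^'n \<Rightarrow> real" where
  "support_fn \<Delta> w = Sup ((\<lambda>x. x \<bullet> w) ` \<Delta>)"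

definition width :: "(real^'n::finite) set \<Rightarrow> real" where
  "width \<Delta> = Inf ((\<lambda>u. support_fn \<Delta> u + support_fn \<Delta> (- u)) ` {u. norm u = 1})"

definition width_dirs :: "(real^'n::finite) set \<Rightarrow> (real^'n) set" where
  "width_dirs \<Delta> = {u. norm u = 1 \<and> width \<Delta> = support_fn \<Delta> u + support_fn \<Delta> (- u)}"

definition mid_hyperplane :: "(real^'n::finite) set \<Rightarrow> real^'n \<Rightarrow> (real^'n) set" where
  "mid_hyperplane \<Delta> u = {x. x \<bullet> u = (support_fn \<Delta> u - support_fn \<Delta> (- u)) / 2}"

definition first_idx :: "'n::{finite,wellorder}" where
  "first_idx = (LEAST i. True)"

definition Z_cyl :: "(real^'n::{finite,wellorder}) set \<Rightarrow> 'n ps set" where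
  "Z_cyl \<Delta> = {(q, p). \<bar>q $ first_idx\<bar> \<le> width \<Delta> / 2 \<and> \<bar>p $ first_idx\<bar> \<le> 1}"

definition convex_body :: "(real^'n::finite) set \<Rightarrow> bool" where
  "convex_body \<Delta> \<longleftrightarrow> compact \<Delta> \<and> convex \<Delta> \<and> interior \<Delta> \<noteq> {}"

end

theory Submission
  imports Defs "HOL-Complex_Analysis.Great_Picard"
begin

text \<open>
  The upper bound follows the Hofer--Zehnder minimax argument in finite dimensions. Symmetric loops are
  discretised by cosine modes in \<open>q\<close> and sine modes in \<open>p\<close> on staggered grids, so that critical points
  of the discrete action functional are periodic orbits of a symplectic Euler scheme. A linking argument
  based on the Poincare--Miranda theorem yields almost critical points whose level is bounded below
  independently of the grid, thanks to a discrete \<open>L\<^sup>4\<close> estimate, and a limit along finer grids is a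
  nonconstant symmetric orbit of period one. This treats Hamiltonians supported in a cylinder over a
  disc; a strip, the product of a rectangle with the remaining coordinates, is reduced to it by the
  cotangent lift of \<open>g\<close> with \<open>g' = sqrt (R\<^sup>2 - s\<^sup>2)\<close>, which commutes with the antisymplectic involution.

  For the lower bound, take \<open>H\<close> to be a slowly growing function of a smoothing of the squared gauge
  \<open>((q / a)\<^sup>2\<^sup>k + p\<^sup>2\<^sup>k)\<^sup>1\<^sup>/\<^sup>k\<close> of the rectangle. A symmetric orbit traverses half of a level curve
  between two zeros of \<open>p\<close>, which takes longer than half a period.
\<close>

subsection \<open>A critical point theorem\<close>

text \<open>The number 2 width is an area: a strip of half-width a projects to a rectangle of area
  4a, and pi R^2 = 4a is the threshold beyond which a symmetric orbit of period one is forced.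
  Indeed the Hamiltonian c |z|^2 turns with angular speed 2c, so c = pi is resonant with period one;
  an oscillation m > pi R^2 leaves room for a slope c0 > pi, which carries the first mode across
  zero and creates the linking. The first obstacle is that \<open>H\<close> is constant off a
  compact set, so the minimax must run on an extension of quadratic growth and might find orbits of
  the extension only; the extension is tuned so that their action is nonpositive. The second is that
  loops in the natural energy space, of Sobolev order one half, need not be continuous or bounded.
  On a finite grid this is harmless, but then every constant has to be independent of the number of
  grid points. The lower bound approaches the same area from below: high powers make the level
  curves nearly rectangular.\<close>

lemma tendsto_fun_coordinatewise:
  fixes X :: "nat \<Rightarrow> 'i \<Rightarrow> 'b::topological_space"
  assumes "\<And>i. (\<lambda>n. X n i) \<longlonglongrightarrow> x i"
  shows "X \<longlonglongrightarrow> x"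
proof -
  have "limitin (product_topology (\<lambda>i. euclidean) UNIV) X x sequentially"
    using assms by (simp add: limitin_componentwise)
  then show ?thesis
    by (simp add: euclidean_product_topology)
qed

lemma continuous_fun_tendsto:
  fixes F :: "('i \<Rightarrow> 'b::topological_space) \<Rightarrow> 'c::topological_space"
  assumes "continuous_on UNIV F" "\<And>i. (\<lambda>n. X n i) \<longlonglongrightarrow> x i"
  shows "(\<lambda>n. F (X n)) \<longlonglongrightarrow> F x"
  using continuous_on_tendsto_compose[OF assms(1) tendsto_fun_coordinatewise[of X x, OF assms(2)]] by simp

lemma bounded_coordinates_subsequence:
  fixes X :: "nat \<Rightarrow> 'i \<Rightarrow> real"
  assumes "finite I" "\<And>n i. i \<in> I \<Longrightarrow> \<bar>X n i\<bar> \<le> M" "\<And>n i. i \<notin> I \<Longrightarrow> X n i = 0"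
  obtains k x where "strict_mono (k::nat\<Rightarrow>nat)" "\<And>i. (\<lambda>n. X (k n) i) \<longlonglongrightarrow> x i"
proof -
  obtain k where k: "strict_mono (k::nat\<Rightarrow>nat)" "\<And>i. i \<in> I \<Longrightarrow> \<exists>l. (\<lambda>n. X (k n) i) \<longlonglongrightarrow> l"
    using function_convergent_subsequence[of I X M] assms by (auto simp: countable_finite)
  have "\<exists>l. (\<lambda>n. X (k n) i) \<longlonglongrightarrow> l" for i
    using k(2)[of i] assms(3)[of i] by (cases "i \<in> I") auto
  then obtain x where "\<And>i. (\<lambda>n. X (k n) i) \<longlonglongrightarrow> x i" by metis
  then show thesis using that k(1) by blast
qed

text \<open>Kuhn's combinatorial lemma on finer and finer grids gives cells on which every
  coordinate of \<open>F\<close> takes both signs; a convergent subsequence of such cells shrinks to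
  a zero. Points are functions vanishing off the finite set \<open>I\<close>, which suits the mode
  coefficients to which this is applied.\<close>

theorem poincare_miranda:
  fixes F :: "('i \<Rightarrow> real) \<Rightarrow> 'i \<Rightarrow> real"
  assumes I: "finite I" and lohi: "\<And>i. i \<in> I \<Longrightarrow> lo i < hi i"
    and cont: "\<And>i. i \<in> I \<Longrightarrow> continuous_on UNIV (\<lambda>x. F x i)"
    and low: "\<And>x i. (\<forall>i\<in>I. lo i \<le> x i \<and> x i \<le> hi i) \<Longrightarrow> \<forall>i. i \<notin> I \<longrightarrow> x i = 0 \<Longrightarrow> i \<in> I \<Longrightarrow> x i = lo i \<Longrightarrow> F x i \<le> 0"
    and high: "\<And>x i. (\<forall>i\<in>I. lo i \<le> x i \<and> x i \<le> hi i) \<Longrightarrow> \<forall>i. i \<notin> I \<longrightarrow> x i = 0 \<Longrightarrow> i \<in> I \<Longrightarrow> x i = hi i \<Longrightarrow> 0 \<le> F x i"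
  obtains x where "\<forall>i\<in>I. lo i \<le> x i \<and> x i \<le> hi i" "\<forall>i. i \<notin> I \<longrightarrow> x i = 0" "\<forall>i\<in>I. F x i = 0"
proof -
  define n where "n = card I"
  obtain e where e: "bij_betw e I {..<n}"
    using ex_bij_betw_finite_nat[OF I] by (auto simp: n_def atLeast0LessThan)
  have en: "e i < n" if "i \<in> I" for i using e that by (auto simp: bij_betw_def)
  define pt where "pt p y = (\<lambda>i. if i \<in> I then lo i + (hi i - lo i) * (real (y (e i)) / real p) else 0)"
    for p :: nat and y :: "nat \<Rightarrow> nat"
  have pt_out: "\<forall>i. i \<notin> I \<longrightarrow> pt p y i = 0" for p y by (simp add: pt_def)
  have pt_in: "\<forall>i\<in>I. lo i \<le> pt p y i \<and> pt p y i \<le> hi i" if "p > 0" "\<forall>j<n. y j \<le> p" for p y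
  proof
    fix i assume i: "i \<in> I"
    define r where "r = real (y (e i)) / real p"
    have r: "0 \<le> r" "r \<le> 1" using that en[OF i] by (auto simp: r_def divide_simps)
    have "(hi i - lo i) * r \<le> (hi i - lo i) * 1"
      using lohi[OF i] r by (intro mult_left_mono) auto
    moreover have "0 \<le> (hi i - lo i) * r" using lohi[OF i] r by simp
    ultimately show "lo i \<le> pt p y i \<and> pt p y i \<le> hi i"
      using i by (simp add: pt_def r_def[symmetric])
  qed
  define Q where "Q p x \<longleftrightarrow> (\<forall>i\<in>I. lo i \<le> x i \<and> x i \<le> hi i) \<and> (\<forall>i. i \<notin> I \<longrightarrow> x i = 0) \<and>
      (\<forall>i\<in>I. \<exists>y z. (\<forall>i\<in>I. \<bar>y i - x i\<bar> \<le> (hi i - lo i) / p \<and> \<bar>z i - x i\<bar> \<le> (hi i - lo i) / p)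
          \<and> (\<forall>i. i \<notin> I \<longrightarrow> y i = 0) \<and> (\<forall>i. i \<notin> I \<longrightarrow> z i = 0)
          \<and> F y i \<le> 0 \<and> 0 \<le> F z i)" for p :: nat and x
  have ex: "\<exists>x. Q p x" if p: "p > 0" for p :: nat
  proof -
    define g where "g = inv_into I e"
    have ge: "g (e i) = i" if "i \<in> I" for i using e that by (simp add: g_def bij_betw_inv_into_left)
    \<comment> \<open>The faces receive their prescribed labels by force, since \<open>F\<close> may
      vanish there; the boundary hypotheses keep these labels consistent with the sign of
      \<open>F\<close>.\<close>
    define label where "label y j = (if y j = 0 then 0 else if y j = p then 1
        else if F (pt p y) (g j) \<le> 0 then 0 else (1::nat))" for y j
    obtain q where q: "\<forall>i<n. q i < p" and
      rs: "\<forall>i<n. \<exists>r s. (\<forall>j<n. q j \<le> r j \<and> r j \<le> q j + 1) \<and> (\<forall>j<n. q j \<le> s j \<and> s j \<le> q j + 1) \<and> label r i \<noteq> label s i"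
      by (rule kuhn_lemma[of p n label]) (use p in \<open>auto simp: label_def\<close>)
    have lab0: "F (pt p y) i \<le> 0" if "i \<in> I" "\<forall>j<n. y j \<le> p" "label y (e i) = 0" for y i
      using that low[OF pt_in pt_out, of p y i] p by (auto simp: label_def ge pt_def split: if_splits)
    have lab1: "0 \<le> F (pt p y) i" if "i \<in> I" "\<forall>j<n. y j \<le> p" "label y (e i) \<noteq> 0" for y i
      using that high[OF pt_in pt_out, of p y i] p by (auto simp: label_def ge pt_def split: if_splits)
    have close: "\<bar>pt p r i - pt p q i\<bar> \<le> (hi i - lo i) / p" if "i \<in> I" "\<forall>j<n. q j \<le> r j \<and> r j \<le> q j + 1" for r i
    proof -
      have "\<bar>real (r (e i)) - real (q (e i))\<bar> \<le> 1" using that en[OF that(1)] by (auto simp: abs_le_iff)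
      moreover have "pt p r i - pt p q i = (hi i - lo i) * (real (r (e i)) - real (q (e i))) / p"
        using that by (simp add: pt_def diff_divide_distrib[symmetric] right_diff_distrib)
      moreover have "\<bar>(hi i - lo i) * (real (r (e i)) - real (q (e i)))\<bar> \<le> (hi i - lo i) * 1"
        using calculation(1) lohi[OF that(1)] unfolding abs_mult by (intro mult_mono) auto
      ultimately show ?thesis using p lohi[OF that(1)] by (simp add: abs_divide divide_right_mono)
    qed
    show ?thesis unfolding Q_def
    proof (rule exI[of _ "pt p q"], intro conjI ballI pt_out)
      fix i assume i: "i \<in> I"
      show "lo i \<le> pt p q i" "pt p q i \<le> hi i" using pt_in[of p q] p q i by (auto simp: less_imp_le)
      obtain r s where r: "\<forall>j<n. q j \<le> r j \<and> r j \<le> q j + 1" and s: "\<forall>j<n. q j \<le> s j \<and> s j \<le> q j + 1"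
        and l: "label r (e i) \<noteq> label s (e i)" using rs en[OF i] by blast
      have rp: "\<forall>j<n. r j \<le> p" "\<forall>j<n. s j \<le> p" using r s q by (auto intro: order_trans simp: Suc_le_eq)
      show "\<exists>y z. (\<forall>i\<in>I. \<bar>y i - pt p q i\<bar> \<le> (hi i - lo i) / p \<and> \<bar>z i - pt p q i\<bar> \<le> (hi i - lo i) / p)
          \<and> (\<forall>i. i \<notin> I \<longrightarrow> y i = 0) \<and> (\<forall>i. i \<notin> I \<longrightarrow> z i = 0) \<and> F y i \<le> 0 \<and> 0 \<le> F z i"
      proof (cases "label r (e i) = 0")
        case True
        then have "label s (e i) \<noteq> 0" using l by simp
        with True show ?thesis using lab0[OF i rp(1)] lab1[OF i rp(2)] close[OF _ r] close[OF _ s] pt_out by metis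
      next
        case False
        then have "label s (e i) = 0" using l by (auto simp: label_def split: if_splits)
        with False show ?thesis using lab0[OF i rp(2)] lab1[OF i rp(1)] close[OF _ r] close[OF _ s] pt_out by metis
      qed
    qed
  qed
  have "\<exists>X. \<forall>p. Q (Suc p) (X p)" by (intro choice allI ex) simp
  then obtain X where XQ: "\<And>p. Q (Suc p) (X p)" by blast
  have X: "\<And>p. (\<forall>i\<in>I. lo i \<le> X p i \<and> X p i \<le> hi i)" "\<And>p. (\<forall>i. i \<notin> I \<longrightarrow> X p i = 0)" and
    X2: "\<And>p. \<forall>i\<in>I. \<exists>y z. (\<forall>i\<in>I. \<bar>y i - X p i\<bar> \<le> (hi i - lo i) / Suc p \<and> \<bar>z i - X p i\<bar> \<le> (hi i - lo i) / Suc p)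
          \<and> (\<forall>i. i \<notin> I \<longrightarrow> y i = 0) \<and> (\<forall>i. i \<notin> I \<longrightarrow> z i = 0)
          \<and> F y i \<le> 0 \<and> 0 \<le> F z i"
    using XQ unfolding Q_def by blast+
  define M where "M = (\<Sum>i\<in>I. \<bar>lo i\<bar> + \<bar>hi i\<bar>)"
  have M: "\<bar>X p i\<bar> \<le> M" if "i \<in> I" for p i
  proof -
    have "\<bar>X p i\<bar> \<le> \<bar>lo i\<bar> + \<bar>hi i\<bar>" using X(1)[of p] that by force
    also have "\<dots> \<le> M" unfolding M_def using I that by (intro member_le_sum) auto
    finally show ?thesis .
  qed
  obtain k x where k: "strict_mono (k::nat\<Rightarrow>nat)" and lim: "\<And>i. (\<lambda>n. X (k n) i) \<longlonglongrightarrow> x i"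
    using bounded_coordinates_subsequence[of I X M] I M X(2) by blast
  have near: "(\<lambda>n. Y n i) \<longlonglongrightarrow> x i"
    if Y: "\<And>n. \<forall>i\<in>I. \<bar>Y n i - X (k n) i\<bar> \<le> (hi i - lo i) / Suc (k n)" "\<And>n. \<forall>i. i \<notin> I \<longrightarrow> Y n i = 0" for Y i
  proof (cases "i \<in> I")
    case True
    have "(\<lambda>n. inverse (real (Suc (k n)))) \<longlonglongrightarrow> 0"
      using LIMSEQ_subseq_LIMSEQ[OF LIMSEQ_inverse_real_of_nat k] by (simp add: o_def)
    then have "(\<lambda>n. (hi i - lo i) / Suc (k n)) \<longlonglongrightarrow> 0"
      using tendsto_mult_right_zero by (auto simp: divide_inverse)
    moreover have "\<forall>\<^sub>F n in sequentially. norm (Y n i - X (k n) i) \<le> (hi i - lo i) / Suc (k n)"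
      using Y(1) True by auto
    ultimately have "(\<lambda>n. Y n i - X (k n) i) \<longlonglongrightarrow> 0"
      by (rule Lim_null_comparison[rotated])
    from tendsto_add[OF this lim[of i]] show ?thesis by simp
  next
    case False
    have "x i = 0" using lim[of i] X(2) False LIMSEQ_unique[OF lim[of i], of 0] by simp
    then show ?thesis using Y(2) False by simp
  qed
  have "F x i = 0" if i: "i \<in> I" for i
  proof -
    have "\<forall>n. \<exists>y z. (\<forall>i\<in>I. \<bar>y i - X (k n) i\<bar> \<le> (hi i - lo i) / Suc (k n) \<and> \<bar>z i - X (k n) i\<bar> \<le> (hi i - lo i) / Suc (k n))
          \<and> (\<forall>i. i \<notin> I \<longrightarrow> y i = 0) \<and> (\<forall>i. i \<notin> I \<longrightarrow> z i = 0)
          \<and> F y i \<le> 0 \<and> 0 \<le> F z i" using X2 i by blast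
    then obtain Y Z where YZ: "\<And>n. (\<forall>i\<in>I. \<bar>Y n i - X (k n) i\<bar> \<le> (hi i - lo i) / Suc (k n) \<and> \<bar>Z n i - X (k n) i\<bar> \<le> (hi i - lo i) / Suc (k n))
          \<and> (\<forall>i. i \<notin> I \<longrightarrow> Y n i = 0) \<and> (\<forall>i. i \<notin> I \<longrightarrow> Z n i = 0)
          \<and> F (Y n) i \<le> 0 \<and> 0 \<le> F (Z n) i" by metis
    have "(\<lambda>n. F (Y n) i) \<longlonglongrightarrow> F x i" "(\<lambda>n. F (Z n) i) \<longlonglongrightarrow> F x i"
      using YZ by (intro continuous_fun_tendsto[OF cont[OF i]] near; blast)+
    then have "F x i \<le> 0" "0 \<le> F x i"
      using YZ by (auto intro: LIMSEQ_le_const LIMSEQ_le_const2)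
    then show ?thesis by simp
  qed
  moreover have "\<forall>i\<in>I. lo i \<le> x i \<and> x i \<le> hi i"
    using lim X(1) by (auto intro!: LIMSEQ_le_const[OF lim] LIMSEQ_le_const2[OF lim])
  moreover have "\<forall>i. i \<notin> I \<longrightarrow> x i = 0"
    using LIMSEQ_unique[OF lim, of _ 0] X(2) by simp
  ultimately show thesis using that by blast
qed

text \<open>The step length \<open>r / (1 + \<bar>g\<bar>)\<close> keeps each displacement below the scale on which the
  first order expansion of \<open>\<Phi>\<close> is uniformly accurate, so no bound on \<open>g\<close> is required; the cutoff
  \<open>cut\<close> freezes the boundary of the linking set.\<close>

theorem linking_almost_critical:
  fixes \<Phi> D :: "('i \<Rightarrow> real) \<Rightarrow> real" and g :: "('i \<Rightarrow> real) \<Rightarrow> 'i \<Rightarrow> real"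
    and e z0 :: "'i \<Rightarrow> real" and \<alpha> \<beta> \<rho> C c :: real
  assumes I: "finite I" and B: "B \<subseteq> I" and k0: "k0 \<in> I - B"
    and cont\<Phi>: "continuous_on UNIV \<Phi>" and contg: "\<And>i. i \<in> I \<Longrightarrow> continuous_on UNIV (\<lambda>x. g x i)"
    and contD: "continuous_on UNIV D"
    and descent: "\<And>\<epsilon>. \<epsilon> > 0 \<Longrightarrow> \<exists>r>0. \<forall>x v. (\<forall>i. i \<notin> I \<longrightarrow> x i = 0) \<and> (\<forall>i. i \<notin> I \<longrightarrow> v i = 0) \<and> sqrt (\<Sum>i\<in>I. (v i)\<^sup>2) \<le> r \<longrightarrow>
        \<Phi> (\<lambda>i. x i + v i) \<le> \<Phi> x + (\<Sum>i\<in>I. g x i * v i) + \<epsilon> * sqrt (\<Sum>i\<in>I. (v i)\<^sup>2)"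
    and e: "\<And>i. i \<in> B \<Longrightarrow> e i = 0" "\<And>i. i \<notin> I \<Longrightarrow> e i = 0"
    and De: "\<And>b s. \<forall>i. i \<notin> B \<longrightarrow> b i = 0 \<Longrightarrow> 0 \<le> s \<Longrightarrow> D (\<lambda>i. b i + s * e i) = s"
    and \<alpha>: "0 < \<alpha>" "\<alpha> < \<rho>" and z0: "\<And>i. i \<in> B \<Longrightarrow> \<bar>z0 i\<bar> < \<rho>" and \<beta>: "0 < \<beta>" and c: "0 < c"
    and upper: "\<And>b s. \<forall>i. i \<notin> B \<longrightarrow> b i = 0 \<Longrightarrow> \<forall>i. \<bar>b i\<bar> \<le> \<rho> \<Longrightarrow> 0 \<le> s \<Longrightarrow> s \<le> \<rho> \<Longrightarrow> \<Phi> (\<lambda>i. b i + s * e i) \<le> C"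
    and bdry: "\<And>b s. \<forall>i. i \<notin> B \<longrightarrow> b i = 0 \<Longrightarrow> \<forall>i. \<bar>b i\<bar> \<le> \<rho> \<Longrightarrow> 0 \<le> s \<Longrightarrow> s \<le> \<rho> \<Longrightarrow>
        s = 0 \<or> s = \<rho> \<or> (\<exists>i\<in>B. \<bar>b i\<bar> = \<rho>) \<Longrightarrow> \<Phi> (\<lambda>i. b i + s * e i) \<le> 0"
    and link: "\<And>x. \<forall>i. i \<notin> I \<longrightarrow> x i = 0 \<Longrightarrow> \<forall>i\<in>B. x i = z0 i \<Longrightarrow> D x = \<alpha> \<Longrightarrow> \<beta> \<le> \<Phi> x"
  shows "\<exists>x. (\<forall>i. i \<notin> I \<longrightarrow> x i = 0) \<and> \<beta> / 2 \<le> \<Phi> x \<and> sqrt (\<Sum>i\<in>I. (g x i)\<^sup>2) < c"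
proof (rule ccontr)
  assume "\<not> ?thesis"
  then have nc: "c \<le> sqrt (\<Sum>i\<in>I. (g x i)\<^sup>2)" if "\<forall>i. i \<notin> I \<longrightarrow> x i = 0" "\<beta> / 2 \<le> \<Phi> x" for x
    using that not_le by blast
  define ng where "ng x = sqrt (\<Sum>i\<in>I. (g x i)\<^sup>2)" for x
  have ng0: "0 \<le> ng x" for x by (simp add: ng_def sum_nonneg)
  obtain r where r: "r > 0" and desc: "\<And>x v. (\<forall>i. i \<notin> I \<longrightarrow> x i = 0) \<Longrightarrow> (\<forall>i. i \<notin> I \<longrightarrow> v i = 0) \<Longrightarrow> sqrt (\<Sum>i\<in>I. (v i)\<^sup>2) \<le> r \<Longrightarrow>
        \<Phi> (\<lambda>i. x i + v i) \<le> \<Phi> x + (\<Sum>i\<in>I. g x i * v i) + c / 2 * sqrt (\<Sum>i\<in>I. (v i)\<^sup>2)"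
    using descent[of "c/2"] c by auto
  define cut where "cut y = max 0 (min 1 (2 / \<beta> * y - 1))" for y
  have cut01: "0 \<le> cut y" "cut y \<le> 1" for y by (auto simp: cut_def)
  have cut0: "cut y = 0" if "y \<le> \<beta> / 2" for y using that \<beta> by (auto simp: cut_def field_simps max_def min_def)
  have cut1: "cut y = 1" if "\<beta> \<le> y" for y using that \<beta> by (auto simp: cut_def field_simps max_def min_def)
  define a where "a x = r * cut (\<Phi> x) / (1 + ng x)" for x
  define S where "S x = (\<lambda>i. x i + (if i \<in> I then - a x * g x i else 0))" for x
  \<comment> \<open>The error term, taken with tolerance c/2, eats at most half of the first-order
    gain. What is left is a multiple of t^2/(1+t) with t the gradient norm; this increases with t,
    so its value at the bound \<open>c\<close> is the guaranteed gain.\<close>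
  define \<kappa> where "\<kappa> = r * (c\<^sup>2 / (2 * (1 + c)))"
  have \<kappa>: "\<kappa> > 0" using r c by (simp add: \<kappa>_def)
  have a0: "0 \<le> a x" for x using cut01 ng0[of x] r by (simp add: a_def)
  have Sdec: "\<Phi> (S x) \<le> \<Phi> x - cut (\<Phi> x) * \<kappa>" if x: "\<forall>i. i \<notin> I \<longrightarrow> x i = 0" for x
  proof (cases "\<Phi> x \<le> \<beta> / 2")
    case True
    then have "S x = x" by (auto simp: S_def a_def cut0)
    then show ?thesis using True cut0 by simp
  next
    case False
    then have ngc: "c \<le> ng x" using nc[OF x] by (simp add: ng_def)
    define v where "v = (\<lambda>i. if i \<in> I then - a x * g x i else 0)"
    have "(\<Sum>i\<in>I. (v i)\<^sup>2) = (\<Sum>i\<in>I. (a x)\<^sup>2 * (g x i)\<^sup>2)" by (auto simp: v_def power_mult_distrib intro!: sum.cong)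
    also have "\<dots> = (a x)\<^sup>2 * (ng x)\<^sup>2" by (simp add: sum_distrib_left ng_def sum_nonneg)
    finally have nv: "sqrt (\<Sum>i\<in>I. (v i)\<^sup>2) = a x * ng x" using a0 ng0 by (simp add: real_sqrt_mult)
    have arith: "a x * ng x = r * cut (\<Phi> x) * (ng x / (1 + ng x))" by (simp add: a_def)
    have "ng x / (1 + ng x) \<le> 1" using ng0[of x] by simp
    then have "a x * ng x \<le> r * 1 * 1"
      unfolding arith using cut01 r ng0[of x] by (intro mult_mono) auto
    then have "\<Phi> (\<lambda>i. x i + v i) \<le> \<Phi> x + (\<Sum>i\<in>I. g x i * v i) + c / 2 * (a x * ng x)"
      using desc[OF x, of v] nv by (simp add: v_def)
    also have "(\<Sum>i\<in>I. g x i * v i) = - a x * (ng x)\<^sup>2"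
      by (simp add: v_def ng_def sum_nonneg sum_distrib_left power2_eq_square mult_ac sum_negf)
    also have "\<Phi> x + - a x * (ng x)\<^sup>2 + c / 2 * (a x * ng x) \<le> \<Phi> x + - a x * (ng x)\<^sup>2 + ng x / 2 * (a x * ng x)"
      using ngc a0 ng0 by (intro add_left_mono mult_right_mono) auto
    also have "\<dots> = \<Phi> x - cut (\<Phi> x) * (r * ((ng x)\<^sup>2 / (2 * (1 + ng x))))"
    proof -
      have "- a x * (ng x)\<^sup>2 + ng x / 2 * (a x * ng x) = - (a x * (ng x)\<^sup>2 / 2)"
        by (simp add: power2_eq_square)
      moreover have "a x * (ng x)\<^sup>2 / 2 = cut (\<Phi> x) * (r * ((ng x)\<^sup>2 / (2 * (1 + ng x))))"
        by (simp add: a_def mult_ac)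
      ultimately show ?thesis by linarith
    qed
    also have "\<dots> \<le> \<Phi> x - cut (\<Phi> x) * \<kappa>"
    proof -
      have "c\<^sup>2 * (1 + ng x) \<le> (ng x)\<^sup>2 * (1 + c)"
      proof -
        have "c\<^sup>2 \<le> (ng x)\<^sup>2" using ngc c by (intro power_mono) auto
        moreover have "c * ng x * c \<le> c * ng x * ng x" using ngc c ng0 by (intro mult_left_mono) auto
        ultimately show ?thesis by (simp add: algebra_simps power2_eq_square)
      qed
      then have "c\<^sup>2 / (2 * (1 + c)) \<le> (ng x)\<^sup>2 / (2 * (1 + ng x))"
        using c ng0[of x] by (simp add: divide_simps) (simp add: algebra_simps)
      then show ?thesis unfolding \<kappa>_def using cut01 r by (intro diff_left_mono mult_left_mono) auto
    qed
    finally show ?thesis by (simp add: S_def v_def)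
  qed
  have contng: "continuous_on UNIV ng" unfolding ng_def by (intro continuous_intros contg)
  have conta: "continuous_on UNIV a" unfolding a_def cut_def
    using ng0 by (intro continuous_intros cont\<Phi> contng) (smt (verit))
  have contS: "continuous_on UNIV S" unfolding S_def
  proof (rule continuous_on_coordinatewise_then_product)
    fix i show "continuous_on UNIV (\<lambda>x. x i + (if i \<in> I then - a x * g x i else 0))"
      by (cases "i \<in> I") (auto intro!: continuous_intros conta contg)
  qed
  have contSn: "continuous_on UNIV (S ^^ n)" for n
  proof (induction n)
    case (Suc n)
    then show ?case using continuous_on_compose[of UNIV "S ^^ n" S] continuous_on_subset[OF contS] by (auto simp: o_def)
  qed (simp add: id_def)
  have Ssupp: "\<forall>i. i \<notin> I \<longrightarrow> (S ^^ n) x i = 0" if "\<forall>i. i \<notin> I \<longrightarrow> x i = 0" for n x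
    using that by (induction n) (auto simp: S_def)
  have Sn: "\<Phi> ((S ^^ n) x) < \<beta> \<or> \<Phi> ((S ^^ n) x) \<le> \<Phi> x - real n * \<kappa>" if "\<forall>i. i \<notin> I \<longrightarrow> x i = 0" for n x
  proof (induction n)
    case (Suc n)
    have d: "\<Phi> (S ((S ^^ n) x)) \<le> \<Phi> ((S ^^ n) x) - cut (\<Phi> ((S ^^ n) x)) * \<kappa>" by (rule Sdec[OF Ssupp[OF that]])
    show ?case
    proof (cases "\<Phi> ((S ^^ n) x) < \<beta>")
      case True
      have "0 \<le> cut (\<Phi> ((S ^^ n) x)) * \<kappa>" using cut01 \<kappa> by simp
      with True d show ?thesis by simp
    next
      case False
      then show ?thesis using d Suc cut1[of "\<Phi> ((S ^^ n) x)"] by (auto simp: algebra_simps)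
    qed
  qed simp
  \<comment> \<open>Each step from a level of at least \<beta> gains \<kappa>, so after
    \<open>n\<close> steps the whole box, initially at level at most \<open>C\<close>, lies below
    \<beta>. A point of it on the linking set is then a contradiction.\<close>
  obtain n :: nat where n: "C < real n * \<kappa>" using reals_Archimedean3[OF \<kappa>] by blast
  \<comment> \<open>Coordinates of the box: those in \<open>B\<close>, and the multiple of
    \<open>e\<close>, stored at the spare index \<open>k0\<close>.\<close>
  define P where "P y = (\<lambda>i. (if i \<in> B then y i else 0) + y k0 * e i)" for y :: "'i \<Rightarrow> real"
  define J where "J = insert k0 B"
  \<comment> \<open>A zero of \<open>F\<close> is a point of the deformed box on the linking set.
    The deformation is the identity on the boundary, so the signs there are those of the undeformed
    coordinates.\<close>
  define F where "F y = (\<lambda>i. if i = k0 then D ((S ^^ n) (P y)) - \<alpha> else (S ^^ n) (P y) i - z0 i)" for y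
  have contP: "continuous_on UNIV P" unfolding P_def
  proof (rule continuous_on_coordinatewise_then_product)
    fix i show "continuous_on UNIV (\<lambda>y. (if i \<in> B then y i else 0) + y k0 * e i)"
      by (cases "i \<in> B") (auto intro!: continuous_intros)
  qed
  have contSP: "continuous_on UNIV (\<lambda>y. (S ^^ n) (P y))"
    using continuous_on_compose[OF contP, of "S ^^ n"] continuous_on_subset[OF contSn] by (auto simp: o_def)
  have Psupp: "\<forall>i. i \<notin> I \<longrightarrow> P y i = 0" for y using e B by (auto simp: P_def)
  have fix0: "(S ^^ n) x = x" if "\<Phi> x \<le> 0" for x
  proof -
    have "S x = x" using that \<beta> by (auto simp: S_def a_def cut0)
    then show ?thesis by (induction n) auto
  qed
  define hi lo where "hi = (\<lambda>i::'i. \<rho>)" and "lo = (\<lambda>i. if i = k0 then 0 else - \<rho>)"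
  have box: "\<forall>i. i \<notin> B \<longrightarrow> (if i \<in> B then y i else 0) = 0" "\<forall>i. \<bar>if i \<in> B then y i else 0\<bar> \<le> \<rho>" "0 \<le> y k0" "y k0 \<le> \<rho>"
    if "\<forall>i\<in>J. lo i \<le> y i \<and> y i \<le> hi i" for y
    using that k0 \<alpha> by (auto simp: lo_def hi_def J_def abs_le_iff split: if_splits)
  have PD: "D (P y) = y k0" if "0 \<le> y k0" for y
    unfolding P_def by (rule De) (use that in auto)
  have Pb: "P y i = y i" if "i \<in> B" for y i using that e by (simp add: P_def)
  obtain y where y: "\<forall>i\<in>J. lo i \<le> y i \<and> y i \<le> hi i" "\<forall>i\<in>J. F y i = 0"
  proof (rule poincare_miranda[of J lo hi F])
    show "finite J" using I B finite_subset by (auto simp: J_def)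
    show "lo i < hi i" for i using \<alpha> by (auto simp: lo_def hi_def)
    show "continuous_on UNIV (\<lambda>x. F x i)" for i
    proof (cases "i = k0")
      case True
      then show ?thesis unfolding F_def
        using continuous_on_compose[OF contSP, of D] continuous_on_subset[OF contD] by (auto simp: o_def intro!: continuous_intros)
    next
      case False
      then show ?thesis unfolding F_def
        using continuous_on_product_then_coordinatewise[OF contSP] by (auto intro!: continuous_intros)
    qed
  next
    fix y i assume y: "\<forall>i\<in>J. lo i \<le> y i \<and> y i \<le> hi i" and i: "i \<in> J" "y i = lo i"
    note b = box[OF y]
    have "\<Phi> (P y) \<le> 0" unfolding P_def
      by (rule bdry[OF b]) (use i \<alpha> in \<open>force simp: J_def lo_def split: if_splits\<close>)
    then show "F y i \<le> 0" using i PD[of y, OF b(3)] Pb[of i y] z0[of i] \<alpha>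
      by (auto simp: F_def fix0 J_def lo_def split: if_splits)
  next
    fix y i assume y: "\<forall>i\<in>J. lo i \<le> y i \<and> y i \<le> hi i" and i: "i \<in> J" "y i = hi i"
    note b = box[OF y]
    have "\<Phi> (P y) \<le> 0" unfolding P_def
      by (rule bdry[OF b]) (use i \<alpha> in \<open>force simp: J_def hi_def split: if_splits\<close>)
    then show "0 \<le> F y i" using i PD[of y, OF b(3)] Pb[of i y] z0[of i] \<alpha>
      by (auto simp: F_def fix0 J_def hi_def split: if_splits)
  qed auto
  define x where "x = (S ^^ n) (P y)"
  have "\<beta> \<le> \<Phi> x"
  proof (rule link)
    show "\<forall>i. i \<notin> I \<longrightarrow> x i = 0" unfolding x_def by (rule Ssupp[OF Psupp])
    show "\<forall>i\<in>B. x i = z0 i"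
    proof
      fix i assume i: "i \<in> B"
      then have "F y i = 0" "i \<noteq> k0" using y(2) k0 by (auto simp: J_def)
      then show "x i = z0 i" by (simp add: F_def x_def)
    qed
    show "D x = \<alpha>" using y(2) by (auto simp: F_def J_def x_def)
  qed
  moreover have "\<Phi> (P y) \<le> C" unfolding P_def by (rule upper[OF box[OF y(1)]])
  ultimately show False using Sn[OF Psupp, of n y] n \<beta> by (auto simp: x_def)
qed

text \<open>Gradient norms below 1/(n+1) at levels of at least \<beta>/2 form a Palais-Smale
  sequence; \<open>coercive\<close> bounds it, and with finitely many coordinates a subsequence
  converges to a critical point.\<close>

theorem linking_critical:
  fixes \<Phi> D :: "('i \<Rightarrow> real) \<Rightarrow> real" and g :: "('i \<Rightarrow> real) \<Rightarrow> 'i \<Rightarrow> real"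
    and e z0 :: "'i \<Rightarrow> real" and \<alpha> \<beta> \<rho> C M :: real
  assumes I: "finite I" and B: "B \<subseteq> I" and k0: "k0 \<in> I - B"
    and cont\<Phi>: "continuous_on UNIV \<Phi>" and contg: "\<And>i. i \<in> I \<Longrightarrow> continuous_on UNIV (\<lambda>x. g x i)"
    and contD: "continuous_on UNIV D"
    and descent: "\<And>\<epsilon>. \<epsilon> > 0 \<Longrightarrow> \<exists>r>0. \<forall>x v. (\<forall>i. i \<notin> I \<longrightarrow> x i = 0) \<and> (\<forall>i. i \<notin> I \<longrightarrow> v i = 0) \<and> sqrt (\<Sum>i\<in>I. (v i)\<^sup>2) \<le> r \<longrightarrow>
        \<Phi> (\<lambda>i. x i + v i) \<le> \<Phi> x + (\<Sum>i\<in>I. g x i * v i) + \<epsilon> * sqrt (\<Sum>i\<in>I. (v i)\<^sup>2)"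
    and e: "\<And>i. i \<in> B \<Longrightarrow> e i = 0" "\<And>i. i \<notin> I \<Longrightarrow> e i = 0"
    and De: "\<And>b s. \<forall>i. i \<notin> B \<longrightarrow> b i = 0 \<Longrightarrow> 0 \<le> s \<Longrightarrow> D (\<lambda>i. b i + s * e i) = s"
    and \<alpha>: "0 < \<alpha>" "\<alpha> < \<rho>" and z0: "\<And>i. i \<in> B \<Longrightarrow> \<bar>z0 i\<bar> < \<rho>" and \<beta>: "0 < \<beta>"
    and upper: "\<And>b s. \<forall>i. i \<notin> B \<longrightarrow> b i = 0 \<Longrightarrow> \<forall>i. \<bar>b i\<bar> \<le> \<rho> \<Longrightarrow> 0 \<le> s \<Longrightarrow> s \<le> \<rho> \<Longrightarrow> \<Phi> (\<lambda>i. b i + s * e i) \<le> C"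
    and bdry: "\<And>b s. \<forall>i. i \<notin> B \<longrightarrow> b i = 0 \<Longrightarrow> \<forall>i. \<bar>b i\<bar> \<le> \<rho> \<Longrightarrow> 0 \<le> s \<Longrightarrow> s \<le> \<rho> \<Longrightarrow>
        s = 0 \<or> s = \<rho> \<or> (\<exists>i\<in>B. \<bar>b i\<bar> = \<rho>) \<Longrightarrow> \<Phi> (\<lambda>i. b i + s * e i) \<le> 0"
    and link: "\<And>x. \<forall>i. i \<notin> I \<longrightarrow> x i = 0 \<Longrightarrow> \<forall>i\<in>B. x i = z0 i \<Longrightarrow> D x = \<alpha> \<Longrightarrow> \<beta> \<le> \<Phi> x"
    and coercive: "\<And>x i. \<forall>i. i \<notin> I \<longrightarrow> x i = 0 \<Longrightarrow> sqrt (\<Sum>i\<in>I. (g x i)\<^sup>2) \<le> 1 \<Longrightarrow> \<bar>x i\<bar> \<le> M"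
  obtains x where "\<forall>i. i \<notin> I \<longrightarrow> x i = 0" "\<beta> / 2 \<le> \<Phi> x" "\<forall>i\<in>I. g x i = 0"
proof -
  have "\<exists>x. (\<forall>i. i \<notin> I \<longrightarrow> x i = 0) \<and> \<beta> / 2 \<le> \<Phi> x \<and> sqrt (\<Sum>i\<in>I. (g x i)\<^sup>2) < inverse (real (Suc n))" for n
    by (rule linking_almost_critical[OF I B k0 cont\<Phi> contg contD descent e De \<alpha> z0 \<beta> _ upper bdry link]) auto
  then obtain X where X: "\<And>n. \<forall>i. i \<notin> I \<longrightarrow> X n i = 0" "\<And>n. \<beta> / 2 \<le> \<Phi> (X n)"
    "\<And>n. sqrt (\<Sum>i\<in>I. (g (X n) i)\<^sup>2) < inverse (real (Suc n))" by metis
  have g1: "sqrt (\<Sum>i\<in>I. (g (X n) i)\<^sup>2) \<le> 1" for n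
  proof -
    have "inverse (real (Suc n)) \<le> 1" by (simp add: field_simps)
    with X(3)[of n] show ?thesis by linarith
  qed
  obtain k x where k: "strict_mono (k::nat\<Rightarrow>nat)" and lim: "\<And>i. (\<lambda>n. X (k n) i) \<longlonglongrightarrow> x i"
    using bounded_coordinates_subsequence[of I X M] I X(1) coercive[OF X(1) g1] by blast
  have "\<forall>i. i \<notin> I \<longrightarrow> x i = 0" using LIMSEQ_unique[OF lim, of _ 0] X(1) by simp
  moreover have "\<beta> / 2 \<le> \<Phi> x"
    using continuous_fun_tendsto[OF cont\<Phi>, of "\<lambda>n. X (k n)" x, OF lim] X(2)
    by (intro LIMSEQ_le_const[of "\<lambda>n. \<Phi> (X (k n))"]) auto
  moreover have "g x i = 0" if i: "i \<in> I" for i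
  proof -
    have "\<bar>g (X n) i\<bar> \<le> inverse (real (Suc n))" for n
    proof -
      have "\<bar>g (X n) i\<bar> \<le> sqrt (\<Sum>i\<in>I. (g (X n) i)\<^sup>2)"
        using member_le_sum[of i I "\<lambda>i. (g (X n) i)\<^sup>2"] i I by (auto intro!: real_le_rsqrt)
      then show ?thesis using X(3)[of n] by linarith
    qed
    then have "(\<lambda>n. g (X n) i) \<longlonglongrightarrow> 0"
      by (intro Lim_null_comparison[OF _ LIMSEQ_inverse_real_of_nat]) auto
    from LIMSEQ_subseq_LIMSEQ[OF this k] have "(\<lambda>n. g (X (k n)) i) \<longlonglongrightarrow> 0" by (simp add: o_def)
    moreover have "(\<lambda>n. g (X (k n)) i) \<longlonglongrightarrow> g x i" by (rule continuous_fun_tendsto[OF contg[OF i], of "\<lambda>n. X (k n)" x, OF lim])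
    ultimately show ?thesis using LIMSEQ_unique by blast
  qed
  ultimately show thesis using that by blast
qed

subsection \<open>Trigonometric sums\<close>

lemma cos_add_int_2pi: "cos (x + real_of_int i * (2 * pi)) = cos x"
  and sin_add_int_2pi: "sin (x + real_of_int i * (2 * pi)) = sin x"
  using cos_int_2pin[of i] sin_int_2pin[of i] by (simp_all add: cos_add sin_add mult_ac)

lemma dvd_abs_less_iff: "\<bar>x\<bar> < n \<Longrightarrow> n dvd x \<longleftrightarrow> x = 0" for x n :: int
  using dvd_imp_le_int[of x n] by auto

text \<open>Multiplication by 2 sin(pi m / 2N) makes the sum telescope over a full period. The free
  phase \<theta> serves the integer and the half-integer grid at once.\<close>

lemma sum_cos_period:
  fixes N :: nat and m :: int and \<theta> :: real
  assumes N: "N > 0"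
  shows "(\<Sum>j<2*N. cos (pi * m * j / N + \<theta>)) = (if 2 * int N dvd m then 2 * real N * cos \<theta> else 0)"
proof (cases "2 * int N dvd m")
  case True
  then obtain c where c: "m = 2 * int N * c" by (auto simp: dvd_def)
  have "cos (pi * m * real j / N + \<theta>) = cos \<theta>" for j :: nat
  proof -
    have "pi * m * real j / N = real_of_int (c * int j) * (2 * pi)" using N by (simp add: c)
    then show ?thesis using cos_add_int_2pi[of \<theta> "c * int j"] by (simp add: add.commute)
  qed
  then show ?thesis using True by simp
next
  case False
  define f where "f j = sin (pi * m * (real j - 1/2) / N + \<theta>)" for j :: nat
  have ne: "sin (pi * m / (2 * N)) \<noteq> 0"
  proof
    assume "sin (pi * m / (2 * N)) = 0"
    then obtain i :: int where "pi * m / (2 * N) = i * pi" by (auto simp: sin_zero_iff_int2)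
    then have "real_of_int m = real_of_int (2 * int N * i)" using N by (simp add: field_simps)
    then have "m = 2 * int N * i" by (simp only: of_int_eq_iff)
    with False show False by simp
  qed
  have tele: "2 * sin (pi * m / (2 * N)) * cos (pi * m * j / N + \<theta>) = f (Suc j) - f j" for j :: nat
  proof -
    have "f (Suc j) - f j = sin ((pi * m * j / N + \<theta>) + pi * m / (2 * N)) - sin ((pi * m * j / N + \<theta>) - pi * m / (2 * N))"
      unfolding f_def using N by (intro arg_cong2[where f="(-)"] arg_cong[where f=sin]) (simp_all add: divide_simps, simp_all add: algebra_simps)
    then show ?thesis by (simp add: sin_add sin_diff)
  qed
  have "2 * sin (pi * m / (2 * N)) * (\<Sum>j<2*N. cos (pi * m * j / N + \<theta>)) = (\<Sum>j<2*N. f (Suc j) - f j)"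
    by (simp only: sum_distrib_left tele)
  also have "\<dots> = f (2 * N) - f 0" by (rule sum_lessThan_telescope)
  also have "f (2 * N) = f 0"
  proof -
    have "pi * m * (real (2 * N) - 1/2) / N + \<theta> = (pi * m * (real 0 - 1/2) / N + \<theta>) + real_of_int m * (2 * pi)"
      using N by (simp add: field_simps)
    then show ?thesis unfolding f_def by (simp only: sin_add_int_2pi)
  qed
  finally show ?thesis using ne False by simp
qed

text \<open>The reflection k -> 2N - k folds the full period: interior terms count twice, the
  endpoints 0 and N once.\<close>

lemma sum_cos_half_period:
  fixes N :: nat and m :: int
  assumes N: "N > 0"
  shows "2 * (\<Sum>k=1..<N. cos (pi * k * m / N)) = (if 2 * int N dvd m then 2 * real N else 0) - 1 - cos (pi * m)"
proof -
  define f where "f k = cos (pi * m * real k / N)" for k :: nat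
  have refl: "f (2 * N - k) = f k" if "k \<le> 2 * N" for k
  proof -
    have "pi * m * real (2 * N - k) / N = - (pi * m * real k / N) + real_of_int m * (2 * pi)"
      using that N by (simp add: of_nat_diff field_simps)
    then show ?thesis unfolding f_def by (simp only: cos_add_int_2pi cos_minus)
  qed
  have "(\<Sum>j<2*N. f j) = (if 2 * int N dvd m then 2 * real N else 0)"
    using sum_cos_period[OF N, of m 0] by (simp add: f_def)
  moreover have "(\<Sum>j<2*N. f j) = f 0 + f N + 2 * (\<Sum>k=1..<N. f k)"
  proof -
    have s: "{..<2*N} = {0} \<union> {1..<N} \<union> {N} \<union> {N<..<2*N}" using N by auto
    have "(\<Sum>j\<in>{N<..<2*N}. f j) = (\<Sum>k=1..<N. f k)"
      by (rule sum.reindex_bij_witness[of _ "\<lambda>k. 2 * N - k" "\<lambda>k. 2 * N - k"]) (auto simp: refl)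
    moreover have "(\<Sum>j\<in>{0} \<union> {1..<N} \<union> {N} \<union> {N<..<2*N}. f j)
        = ((f 0 + (\<Sum>k=1..<N. f k)) + f N) + (\<Sum>j\<in>{N<..<2*N}. f j)"
      using N by (subst sum.union_disjoint; (force)?)+
    ultimately show ?thesis unfolding s by simp
  qed
  moreover have "f 0 = 1" "f N = cos (pi * m)" using N by (auto simp: f_def)
  moreover have "f k = cos (pi * k * m / N)" for k by (simp add: f_def mult_ac)
  ultimately show ?thesis by (simp only: )
qed

section \<open>Cosine and sine modes on staggered grids\<close>

definition cs :: "nat \<Rightarrow> nat \<Rightarrow> int \<Rightarrow> real" where
  "cs N k j = cos (pi * k * (j + 1/2) / N)"

text \<open>Sines are sampled at integers and cosines at half-integers so that the one-step
  difference of either is an exact multiple of the other, with the same factor 2 sin(pi k /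
  2N).\<close>

definition sn :: "nat \<Rightarrow> nat \<Rightarrow> int \<Rightarrow> real" where
  "sn N k j = sin (pi * k * j / N)"

lemma sn_0 [simp]: "sn N 0 j = 0" and cs_0 [simp]: "cs N 0 j = 1"
  by (auto simp: sn_def cs_def)

lemma cs_mult: "cs N k i * cs N l j = (cos (pi * (k * (i + 1/2) - l * (j + 1/2)) / N) + cos (pi * (k * (i + 1/2) + l * (j + 1/2)) / N)) / 2"
  unfolding cs_def cos_times_cos by (simp add: diff_divide_distrib add_divide_distrib algebra_simps)

lemma sn_mult: "sn N k i * sn N l j = (cos (pi * (k * i - l * j) / N) - cos (pi * (k * i + l * j) / N)) / 2"
  unfolding sn_def sin_times_sin by (simp add: diff_divide_distrib add_divide_distrib algebra_simps)

lemma cs_orth: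
  assumes N: "N > 0" and kl: "k < N" "l < N"
  shows "(\<Sum>j<2*N. cs N k (int j) * cs N l (int j)) = (if k = l then if k = 0 then 2 * real N else real N else 0)"
proof -
  have "cs N k (int j) * cs N l (int j) =
     (cos (pi * (int k - int l) * j / N + pi * (int k - int l) / (2 * N))
      + cos (pi * (int k + int l) * j / N + pi * (int k + int l) / (2 * N))) / 2" for j
    unfolding cs_mult using N
    by (intro arg_cong2[where f="\<lambda>a b. (a+b)/2"] arg_cong[where f=cos]) (simp_all add: divide_simps algebra_simps)
  then have "(\<Sum>j<2*N. cs N k (int j) * cs N l (int j)) =
     ((\<Sum>j<2*N. cos (pi * (int k - int l) * j / N + pi * (int k - int l) / (2 * N)))
      + (\<Sum>j<2*N. cos (pi * (int k + int l) * j / N + pi * (int k + int l) / (2 * N)))) / 2"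
    by (simp only: sum.distrib sum_divide_distrib[symmetric])
  also have "\<dots> = ((if k = l then 2 * real N else 0) + (if k = 0 \<and> l = 0 then 2 * real N else 0)) / 2"
  proof -
    have 1: "2 * int N dvd int k - int l \<longleftrightarrow> k = l"
      using kl dvd_abs_less_iff[of "int k - int l" "2 * int N"] by auto
    have 2: "2 * int N dvd int k + int l \<longleftrightarrow> k = 0 \<and> l = 0"
      using kl dvd_abs_less_iff[of "int k + int l" "2 * int N"] by auto
    show ?thesis
      using sum_cos_period[OF N, of "int k - int l" "pi * (int k - int l) / (2 * N)"]
        sum_cos_period[OF N, of "int k + int l" "pi * (int k + int l) / (2 * N)"]
      unfolding 1 2 by auto
  qed
  finally show ?thesis by (auto split: if_splits)
qed

lemma sn_orth:
  assumes N: "N > 0" and kl: "k < N" "l < N"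
  shows "(\<Sum>j<2*N. sn N k (int j) * sn N l (int j)) = (if k = l \<and> k \<noteq> 0 then real N else 0)"
proof -
  have "sn N k (int j) * sn N l (int j) =
     (cos (pi * (int k - int l) * j / N + 0) - cos (pi * (int k + int l) * j / N + 0)) / 2" for j
    unfolding sn_mult using N
    by (intro arg_cong2[where f="\<lambda>a b. (a-b)/2"] arg_cong[where f=cos]) (simp_all add: divide_simps algebra_simps)
  then have "(\<Sum>j<2*N. sn N k (int j) * sn N l (int j)) =
     ((\<Sum>j<2*N. cos (pi * (int k - int l) * j / N + 0))
      - (\<Sum>j<2*N. cos (pi * (int k + int l) * j / N + 0))) / 2"
    by (simp only: sum_subtractf sum_divide_distrib[symmetric])
  also have "\<dots> = ((if k = l then 2 * real N else 0) - (if k = 0 \<and> l = 0 then 2 * real N else 0)) / 2"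
  proof -
    have 1: "2 * int N dvd int k - int l \<longleftrightarrow> k = l"
      using kl dvd_abs_less_iff[of "int k - int l" "2 * int N"] by auto
    have 2: "2 * int N dvd int k + int l \<longleftrightarrow> k = 0 \<and> l = 0"
      using kl dvd_abs_less_iff[of "int k + int l" "2 * int N"] by auto
    show ?thesis
      using sum_cos_period[OF N, of "int k - int l" 0]
        sum_cos_period[OF N, of "int k + int l" 0]
      unfolding 1 2 by auto
  qed
  finally show ?thesis by (auto split: if_splits)
qed

lemma cos_pi_int_add: "cos (pi * real_of_int (m + 2 * i + 1)) = - cos (pi * real_of_int m)"
proof -
  have "pi * real_of_int (m + 2 * i + 1) = (pi * real_of_int m + pi) + real_of_int i * (2 * pi)" by (simp add: algebra_simps)
  then show ?thesis by (simp only: cos_add_int_2pi cos_periodic_pi)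
qed

lemma cos_pi_int_add2: "cos (pi * real_of_int (m + 2 * i)) = cos (pi * real_of_int m)"
proof -
  have "pi * real_of_int (m + 2 * i) = pi * real_of_int m + real_of_int i * (2 * pi)" by (simp add: algebra_simps)
  then show ?thesis by (simp only: cos_add_int_2pi)
qed

text \<open>Completeness of the modes below \<open>N\<close>: the kernel is a periodic delta at
  \<open>j\<close> plus its mirror image at -1 - j, the leading 1 being the constant mode. The
  endpoint cosines cancel because l - j and l + j + 1 have opposite parity; mode N itself vanishes
  at half-integers.\<close>

lemma cs_complete:
  assumes N: "N > 0"
  shows "1 + 2 * (\<Sum>k=1..<N. cs N k l * cs N k j)
     = N * ((if 2 * int N dvd l - j then (1::real) else 0) + (if 2 * int N dvd l + j + 1 then (1::real) else 0))"
proof -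
  have "cs N k l * cs N k j = (cos (pi * k * (l - j) / N) + cos (pi * k * (l + j + 1) / N)) / 2" for k
    unfolding cs_mult using N
    by (intro arg_cong2[where f="\<lambda>a b. (a+b)/2"] arg_cong[where f=cos]) (simp_all add: divide_simps algebra_simps)
  then have "2 * (2 * (\<Sum>k=1..<N. cs N k l * cs N k j)) = 2 * (\<Sum>k=1..<N. cos (pi * k * (l - j) / N))
      + 2 * (\<Sum>k=1..<N. cos (pi * k * (l + j + 1) / N))"
    by (simp only: sum.distrib sum_divide_distrib[symmetric]) simp
  moreover have "cos (pi * real_of_int (l + j + 1)) = - cos (pi * real_of_int (l - j))"
    using cos_pi_int_add[of "l - j" j] by (simp add: add_ac)
  ultimately show ?thesis
    using sum_cos_half_period[OF N, of "l - j"] sum_cos_half_period[OF N, of "l + j + 1"]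
    by (simp split: if_splits)
qed

text \<open>The mirror image sits at -j and enters with a minus sign because sines are odd. The
  endpoint terms cancel, l - j and l + j having equal parity.\<close>

lemma sn_complete:
  assumes N: "N > 0"
  shows "2 * (\<Sum>k=1..<N. sn N k l * sn N k j)
     = N * ((if 2 * int N dvd l - j then (1::real) else 0) - (if 2 * int N dvd l + j then (1::real) else 0))"
proof -
  have "sn N k l * sn N k j = (cos (pi * k * (l - j) / N) - cos (pi * k * (l + j) / N)) / 2" for k
    unfolding sn_mult using N
    by (intro arg_cong2[where f="\<lambda>a b. (a-b)/2"] arg_cong[where f=cos]) (simp_all add: divide_simps algebra_simps)
  then have "2 * (2 * (\<Sum>k=1..<N. sn N k l * sn N k j)) = 2 * (\<Sum>k=1..<N. cos (pi * k * (l - j) / N))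
      - 2 * (\<Sum>k=1..<N. cos (pi * k * (l + j) / N))"
    by (simp only: sum_subtractf sum_divide_distrib[symmetric]) simp
  moreover have "cos (pi * real_of_int (l + j)) = cos (pi * real_of_int (l - j))"
    using cos_pi_int_add2[of "l - j" j] by (simp add: add_ac)
  ultimately show ?thesis
    using sum_cos_half_period[OF N, of "l - j"] sum_cos_half_period[OF N, of "l + j"]
    by (simp split: if_splits)
qed

lemma cs_periodic: "N > 0 \<Longrightarrow> cs N k (j + 2 * int N) = cs N k j"
proof -
  assume N: "N > 0"
  have "pi * k * (real_of_int (j + 2 * int N) + 1/2) / N = pi * k * (j + 1/2) / N + real_of_int (int k) * (2 * pi)"
    using N by (simp add: field_simps)
  then show ?thesis unfolding cs_def by (simp only: cos_add_int_2pi)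
qed

lemma sn_periodic: "N > 0 \<Longrightarrow> sn N k (j + 2 * int N) = sn N k j"
proof -
  assume N: "N > 0"
  have "pi * k * (real_of_int (j + 2 * int N)) / N = pi * k * j / N + real_of_int (int k) * (2 * pi)"
    using N by (simp add: field_simps)
  then show ?thesis unfolding sn_def by (simp only: sin_add_int_2pi)
qed

lemma cs_reflect: "cs N k (- 1 - j) = cs N k j"
proof -
  have "real_of_int (- 1 - j) + 1/2 = - (j + 1/2)" by simp
  then have "pi * k * (real_of_int (- 1 - j) + 1/2) / N = - (pi * k * (j + 1/2) / N)" by (simp only: mult_minus_right minus_divide_left)
  then show ?thesis unfolding cs_def by (simp only: cos_minus)
qed

lemma sn_reflect: "sn N k (- j) = - sn N k j"
  by (simp add: sn_def)

lemma sn_diff: "sn N k (j + 1) - sn N k j = 2 * sin (pi * k / (2 * N)) * cs N k j"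
proof (cases "N = 0")
  case False
  have "sn N k (j + 1) - sn N k j = sin (pi * k * (j + 1/2) / N + pi * k / (2 * N)) - sin (pi * k * (j + 1/2) / N - pi * k / (2 * N))"
    unfolding sn_def using False
    by (intro arg_cong2[where f="(-)"] arg_cong[where f=sin]) (simp_all add: divide_simps, simp_all add: algebra_simps)
  then show ?thesis unfolding cs_def by (simp add: sin_add sin_diff)
qed (simp add: sn_def)

lemma cs_diff: "cs N k (j - 1) - cs N k j = 2 * sin (pi * k / (2 * N)) * sn N k j"
proof (cases "N = 0")
  case False
  have "cs N k (j - 1) - cs N k j = cos (pi * k * j / N - pi * k / (2 * N)) - cos (pi * k * j / N + pi * k / (2 * N))"
    unfolding cs_def using False
    by (intro arg_cong2[where f="(-)"] arg_cong[where f=cos]) (simp_all add: divide_simps algebra_simps)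
  then show ?thesis unfolding sn_def by (simp add: cos_add cos_diff)
qed (simp add: cs_def)

lemma jordan_sin_ge:
  assumes "0 \<le> x" "x \<le> pi / 2"
  shows "2 * x / pi \<le> sin x"
proof -
  have "convex_on {0..pi/2} (\<lambda>x. - sin x)"
  proof (rule f''_ge0_imp_convex[where f' = "\<lambda>x. - cos x" and f'' = sin])
    show "0 \<le> sin x" if "x \<in> {0..pi/2}" for x using that by (intro sin_ge_zero) auto
  qed (auto intro!: derivative_eq_intros)
  from convex_onD[OF this, of "2 * x / pi" 0 "pi/2"] assms show ?thesis by (simp add: field_simps)
qed

lemma freq_ge: fixes N k :: nat shows "N > 0 \<Longrightarrow> k \<le> N \<Longrightarrow> 2 * k \<le> 2 * N * sin (pi * k / (2 * N))"
proof -
  assume N: "N > 0" and k: "k \<le> N"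
  have "2 * (pi * k / (2 * N)) / pi \<le> sin (pi * k / (2 * N))"
    using N k by (intro jordan_sin_ge) (auto simp: field_simps)
  then show ?thesis using N by (simp add: field_simps)
qed

lemma freq_1_le: fixes N :: nat shows "2 * N * sin (pi / (2 * N)) \<le> pi"
proof (cases "N = 0")
  case False
  then show ?thesis using sin_x_le_x[of "pi / (2 * N)"] by (simp add: field_simps)
qed simp

subsection \<open>A discrete Sobolev inequality\<close>

text \<open>Squaring a sum of positive frequencies gives a sum of positive frequencies, whose mean square
  is computed exactly by the sampling points; only the counting bound
  \<open>card {(k, l). k + l = m} \<le> m - 1 \<le> k l\<close> enters.\<close>

lemma sum_cos_quartic:
  fixes a :: "nat \<Rightarrow> real" and N :: nat and \<theta> :: real
  assumes N: "N > 0"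
  shows "(\<Sum>j<2*N. (cmod (\<Sum>k=1..<N. a k * cis (pi * k * (real j + \<theta>) / N)))^4) \<le> 2 * N * (\<Sum>k=1..<N. k * (a k)\<^sup>2)\<^sup>2"
proof -
  define A where "A = {1..<N}"
  define S where "S m = {x \<in> A \<times> A. fst x + snd x = m}" for m
  define c where "c m = (\<Sum>x\<in>S m. a (fst x) * a (snd x))" for m
  define w where "w m j = cis (pi * m * (real j + \<theta>) / N)" for m j :: nat
  have grp: "(\<Sum>m<2*N. \<Sum>x\<in>S m. h x) = (\<Sum>x\<in>A \<times> A. h x)" for h :: "nat \<times> nat \<Rightarrow> 'z::comm_monoid_add"
    unfolding S_def by (rule sum.group) (auto simp: A_def)
  have sq: "(\<Sum>k=1..<N. a k * w k j)\<^sup>2 = (\<Sum>m<2*N. c m * w m j)" for j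
  proof -
    have ww: "w k j * w l j = w (k + l) j" for k l
      unfolding w_def cis_mult by (simp add: algebra_simps add_divide_distrib)
    have "(\<Sum>k=1..<N. a k * w k j)\<^sup>2 = (\<Sum>x\<in>A \<times> A. (a (fst x) * w (fst x) j) * (a (snd x) * w (snd x) j))"
      unfolding power2_eq_square sum_product A_def by (simp add: sum.cartesian_product case_prod_beta)
    also have "\<dots> = (\<Sum>x\<in>A \<times> A. complex_of_real (a (fst x) * a (snd x)) * w (fst x + snd x) j)"
      by (intro sum.cong refl) (simp add: ww[symmetric] mult_ac)
    also have "\<dots> = (\<Sum>m<2*N. \<Sum>x\<in>S m. complex_of_real (a (fst x) * a (snd x)) * w (fst x + snd x) j)"
      by (simp only: grp)
    also have "\<dots> = (\<Sum>m<2*N. c m * w m j)"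
      unfolding c_def of_real_sum sum_distrib_right by (intro sum.cong refl) (auto simp: S_def)
    finally show ?thesis by simp
  qed
  \<comment> \<open>All frequencies k + l lie below 2N, so 2N sample points resolve the square
    without aliasing.\<close>
  have pars: "(\<Sum>j<2*N. (cmod (\<Sum>m<2*N. c m * w m j))\<^sup>2) = 2 * N * (\<Sum>m<2*N. (c m)\<^sup>2)"
  proof -
    have one: "(cmod (\<Sum>m<2*N. c m * w m j))\<^sup>2 = (\<Sum>m<2*N. \<Sum>l<2*N. c m * c l * cos (pi * (int m - int l) * j / N + pi * (int m - int l) * \<theta> / N))" for j
    proof -
      have arg: "pi * (int m - int l) * j / N + pi * (int m - int l) * \<theta> / N
          = pi * m * (real j + \<theta>) / N - pi * l * (real j + \<theta>) / N" for m l
        using N by (simp add: field_simps)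
      have "(cmod (\<Sum>m<2*N. c m * w m j))\<^sup>2 = (\<Sum>m<2*N. c m * cos (pi * m * (real j + \<theta>) / N))\<^sup>2 + (\<Sum>m<2*N. c m * sin (pi * m * (real j + \<theta>) / N))\<^sup>2"
        by (simp add: cmod_power2 w_def)
      also have "\<dots> = (\<Sum>m<2*N. \<Sum>l<2*N. c m * c l * cos (pi * (int m - int l) * j / N + pi * (int m - int l) * \<theta> / N))"
        unfolding arg cos_diff power2_eq_square sum_product sum.distrib[symmetric]
        by (intro sum.cong refl) (simp add: algebra_simps)
      finally show ?thesis by simp
    qed
    have "(\<Sum>j<2*N. (cmod (\<Sum>m<2*N. c m * w m j))\<^sup>2) =
      (\<Sum>m<2*N. \<Sum>l<2*N. c m * c l * (\<Sum>j<2*N. cos (pi * (int m - int l) * j / N + pi * (int m - int l) * \<theta> / N)))"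
      unfolding one sum_distrib_left by (rule trans[OF sum.swap]) (intro sum.cong refl sum.swap)
    also have "\<dots> = (\<Sum>m<2*N. \<Sum>l<2*N. if l = m then 2 * N * (c m)\<^sup>2 else 0)"
    proof (intro sum.cong refl)
      fix m l assume ml: "m \<in> {..<2*N}" "l \<in> {..<2*N}"
      have 1: "2 * int N dvd int m - int l \<longleftrightarrow> l = m"
        using ml dvd_abs_less_iff[of "int m - int l" "2 * int N"] by auto
      show "c m * c l * (\<Sum>j<2*N. cos (pi * (int m - int l) * j / N + pi * (int m - int l) * \<theta> / N)) = (if l = m then 2 * N * (c m)\<^sup>2 else 0)"
        using sum_cos_period[OF N, of "int m - int l" "pi * (int m - int l) * \<theta> / N"]
        unfolding 1 by (auto simp: power2_eq_square)
    qed
    also have "\<dots> = 2 * N * (\<Sum>m<2*N. (c m)\<^sup>2)" by (simp add: sum_distrib_left)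
    finally show ?thesis by simp
  qed
  have cb: "(c m)\<^sup>2 \<le> (\<Sum>x\<in>S m. (fst x * (a (fst x))\<^sup>2) * (snd x * (a (snd x))\<^sup>2))" for m
  proof -
    have "(c m)\<^sup>2 \<le> card (S m) * (\<Sum>x\<in>S m. (a (fst x) * a (snd x))\<^sup>2)"
      unfolding c_def by (subst mult.commute) (rule sum_squared_le_sum_of_squares)
    also have "\<dots> = (\<Sum>x\<in>S m. card (S m) * (a (fst x) * a (snd x))\<^sup>2)" by (simp add: sum_distrib_left)
    also have "\<dots> \<le> (\<Sum>x\<in>S m. (fst x * (a (fst x))\<^sup>2) * (snd x * (a (snd x))\<^sup>2))"
    proof (rule sum_mono)
      fix x assume x: "x \<in> S m"
      obtain k l where kl: "x = (k, l)" by force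
      have k: "1 \<le> k" "1 \<le> l" "k + l = m" using x by (auto simp: S_def A_def kl)
      have "card (S m) \<le> card {1..<m}"
        by (rule card_inj_on_le[of fst]) (auto simp: inj_on_def S_def A_def)
      also have "\<dots> = k + l - 1" using k by simp
      also have "\<dots> \<le> k * l"
      proof -
        obtain k' l' where "k = Suc k'" "l = Suc l'" using k by (metis Suc_le_D One_nat_def)
        then show ?thesis by simp
      qed
      finally have "real (card (S m)) \<le> real (k * l)" by (simp only: of_nat_le_iff)
      then have "card (S m) * (a k * a l)\<^sup>2 \<le> real (k * l) * (a k * a l)\<^sup>2" by (rule mult_right_mono) simp
      then show "card (S m) * (a (fst x) * a (snd x))\<^sup>2 \<le> (fst x * (a (fst x))\<^sup>2) * (snd x * (a (snd x))\<^sup>2)"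
        by (simp add: kl power_mult_distrib mult_ac)
    qed
    finally show ?thesis by simp
  qed
  have "(\<Sum>j<2*N. (cmod (\<Sum>k=1..<N. a k * w k j))^4) = (\<Sum>j<2*N. (cmod (\<Sum>m<2*N. c m * w m j))\<^sup>2)"
    unfolding sq[symmetric] norm_power by (simp flip: power_mult)
  also have "\<dots> = 2 * N * (\<Sum>m<2*N. (c m)\<^sup>2)" by (rule pars)
  also have "\<dots> \<le> 2 * N * (\<Sum>m<2*N. \<Sum>x\<in>S m. (fst x * (a (fst x))\<^sup>2) * (snd x * (a (snd x))\<^sup>2))"
    by (intro mult_left_mono sum_mono cb) auto
  also have "\<dots> = 2 * N * (\<Sum>k=1..<N. k * (a k)\<^sup>2)\<^sup>2"
    unfolding grp power2_eq_square[of "sum _ _"] sum_product A_def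
    by (simp add: sum.cartesian_product case_prod_beta)
  finally show ?thesis by (simp add: w_def)
qed

lemma sum_cs_quartic:
  fixes a :: "nat \<Rightarrow> real"
  assumes N: "N > 0"
  shows "(\<Sum>j<2*N. (\<Sum>k=1..<N. a k * cs N k (int j))^4) \<le> 2 * N * (\<Sum>k=1..<N. k * (a k)\<^sup>2)\<^sup>2"
proof -
  have bnd: "(\<Sum>k=1..<N. a k * cs N k (int j))^4 \<le> (cmod (\<Sum>k=1..<N. a k * cis (pi * k * (real j + 1/2) / N)))^4" for j
  proof -
    have eq: "(\<Sum>k=1..<N. a k * cs N k (int j)) = Re (\<Sum>k=1..<N. a k * cis (pi * k * (real j + 1/2) / N))"
      by (simp add: cs_def)
    have "\<bar>\<Sum>k=1..<N. a k * cs N k (int j)\<bar> \<le> cmod (\<Sum>k=1..<N. a k * cis (pi * k * (real j + 1/2) / N))"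
      unfolding eq by (rule abs_Re_le_cmod)
    from power_mono[OF this abs_ge_zero, of 4] show ?thesis by simp
  qed
  have "(\<Sum>j<2*N. (\<Sum>k=1..<N. a k * cs N k (int j))^4) \<le> (\<Sum>j<2*N. (cmod (\<Sum>k=1..<N. a k * cis (pi * k * (real j + 1/2) / N)))^4)"
    by (intro sum_mono bnd)
  also have "\<dots> \<le> 2 * N * (\<Sum>k=1..<N. k * (a k)\<^sup>2)\<^sup>2"
    by (rule sum_cos_quartic[OF N])
  finally show ?thesis by simp
qed

lemma sum_sn_quartic:
  fixes a :: "nat \<Rightarrow> real"
  assumes N: "N > 0"
  shows "(\<Sum>j<2*N. (\<Sum>k=1..<N. a k * sn N k (int j))^4) \<le> 2 * N * (\<Sum>k=1..<N. k * (a k)\<^sup>2)\<^sup>2"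
proof -
  have bnd: "(\<Sum>k=1..<N. a k * sn N k (int j))^4 \<le> (cmod (\<Sum>k=1..<N. a k * cis (pi * k * (real j + 0) / N)))^4" for j
  proof -
    have eq: "(\<Sum>k=1..<N. a k * sn N k (int j)) = Im (\<Sum>k=1..<N. a k * cis (pi * k * (real j + 0) / N))"
      by (simp add: sn_def)
    have "\<bar>\<Sum>k=1..<N. a k * sn N k (int j)\<bar> \<le> cmod (\<Sum>k=1..<N. a k * cis (pi * k * (real j + 0) / N))"
      unfolding eq by (rule abs_Im_le_cmod)
    from power_mono[OF this abs_ge_zero, of 4] show ?thesis by simp
  qed
  have "(\<Sum>j<2*N. (\<Sum>k=1..<N. a k * sn N k (int j))^4) \<le> (\<Sum>j<2*N. (cmod (\<Sum>k=1..<N. a k * cis (pi * k * (real j + 0) / N)))^4)"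
    by (intro sum_mono bnd)
  also have "\<dots> \<le> 2 * N * (\<Sum>k=1..<N. k * (a k)\<^sup>2)\<^sup>2"
    by (rule sum_cos_quartic[OF N])
  finally show ?thesis by simp
qed

subsection \<open>The discretised action functional\<close>

text \<open>\<open>Hb\<close> is asymptotic to a quadratic form with slope \<open>c0\<close> on the
  plane of \<open>u\<close> and \<theta> on the others. The window pi < c0 \<le> 7/2 puts
  \<open>c0\<close> above the first discrete frequency and a fixed distance below the second, which
  is at least 4; \<theta> \<le> 1 stays below every nonzero frequency. Quartic flatness at (x0, 0)
  makes the functional positive on small spheres of positive modes around that constant loop, and
  evenness in \<open>p\<close> is invariance under the antisymplectic involution.\<close>

locale ham_disc =
  fixes Bs :: "'a::euclidean_space set" and u x0 :: 'a
    and Hb :: "'a \<times> 'a \<Rightarrow> real" and DH :: "'a \<times> 'a \<Rightarrow> 'a \<times> 'a"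
    and c0 \<theta> M C0 C4 :: real and N :: nat
  assumes finB: "finite Bs" and orth: "\<And>v w. v \<in> Bs \<Longrightarrow> w \<in> Bs \<Longrightarrow> v \<bullet> w = (if v = w then 1 else 0)"
    and spanB: "span Bs = UNIV" and u: "u \<in> Bs"
    and deriv: "\<And>z. (Hb has_derivative (\<lambda>w. DH z \<bullet> w)) (at z)"
    and uc: "uniformly_continuous_on UNIV DH"
    and c0: "pi < c0" "c0 \<le> 7/2" and \<theta>: "0 < \<theta>" "\<theta> \<le> 1"
    and asym: "\<And>z. norm (DH z - 2 *\<^sub>R (\<Sum>v\<in>Bs. ((if v = u then c0 else \<theta>) * (fst z \<bullet> v)) *\<^sub>R v,
                  \<Sum>v\<in>Bs. ((if v = u then c0 else \<theta>) * (snd z \<bullet> v)) *\<^sub>R v)) \<le> M"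
    and nonneg: "\<And>z. 0 \<le> Hb z"
    and growth: "\<And>z. (\<Sum>v\<in>Bs. (if v = u then c0 else \<theta>) * ((fst z \<bullet> v)\<^sup>2 + (snd z \<bullet> v)\<^sup>2)) - C0 \<le> Hb z"
    and flat: "\<And>z. Hb ((x0, 0) + z) \<le> C4 * (norm z)^4" and C4: "C4 > 0"
    and even: "\<And>q p. Hb (q, - p) = Hb (q, p)"
    and N: "2 \<le> N"
begin

definition cf where "cf v = (if v = u then c0 else \<theta>)"

text \<open>The flag separates the two senses of rotation: \<open>True\<close> marks modes of
  positive action, \<open>False\<close> those of nonpositive action. Constants occur once, with flag
  \<open>False\<close> and action zero; their sine part vanishes, so they lie in the fixed set of
  the involution.\<close>

definition "I = {(s::bool, k, v). v \<in> Bs \<and> k < N \<and> (s \<longrightarrow> 1 \<le> k)}"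
definition "B = {(s::bool, k, v). v \<in> Bs \<and> k < N \<and> \<not> s}"

definition Z :: "(bool \<times> nat \<times> 'a \<Rightarrow> real) \<Rightarrow> int \<Rightarrow> 'a \<times> 'a" where
  "Z x j = (\<Sum>v\<in>Bs. (\<Sum>k<N. (x (True,k,v) + x (False,k,v)) * cs N k j) *\<^sub>R v,
            \<Sum>v\<in>Bs. (\<Sum>k<N. (x (True,k,v) - x (False,k,v)) * sn N k j) *\<^sub>R v)"

definition \<zeta> :: "int \<Rightarrow> bool \<times> nat \<times> 'a \<Rightarrow> 'a \<times> 'a" where
  "\<zeta> j = (\<lambda>(s,k,v). (cs N k j *\<^sub>R v, (if s then sn N k j else - sn N k j) *\<^sub>R v))"

definition lam :: "bool \<times> nat \<times> 'a \<Rightarrow> real" where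
  "lam = (\<lambda>(s,k,v). (if s then 1 else -1) * (N * sin (pi * k / (2 * N))))"

text \<open>Half of the averaging weight 1/(2N): \<Phi> is half of the discrete action, and
  accordingly \<open>lam\<close> approximates plus or minus pi k / 2.\<close>

definition "w = 1 / (4 * real N)"

definition \<Phi> where "\<Phi> x = (\<Sum>i\<in>I. lam i * (x i)\<^sup>2) - w * (\<Sum>j<2*N. Hb (Z x (int j)))"
definition g where "g x i = 2 * lam i * x i - w * (\<Sum>j<2*N. DH (Z x (int j)) \<bullet> \<zeta> (int j) i)"

definition supp :: "(bool \<times> nat \<times> 'a \<Rightarrow> real) \<Rightarrow> bool" where
  "supp x \<longleftrightarrow> (\<forall>i. i \<notin> I \<longrightarrow> x i = (0::real))"

lemma N0: "N > 0" "1 < N" using N by auto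
lemma w: "w > 0" "w * (2 * real N) = 1 / 2" using N0 by (auto simp: w_def)

lemma finI: "finite I"
proof -
  have "I \<subseteq> UNIV \<times> {..<N} \<times> Bs" by (auto simp: I_def)
  then show ?thesis by (rule finite_subset) (use finB in auto)
qed

lemma BI: "B \<subseteq> I" by (auto simp: B_def I_def)

lemma sumI:
  fixes f :: "bool \<times> nat \<times> 'a \<Rightarrow> 'b::comm_monoid_add"
  assumes "\<And>v. f (True, 0, v) = 0"
  shows "(\<Sum>i\<in>I. f i) = (\<Sum>v\<in>Bs. \<Sum>k<N. f (True, k, v) + f (False, k, v))"
proof -
  have "(\<Sum>i\<in>I. f i) = (\<Sum>i\<in>UNIV \<times> {..<N} \<times> Bs. f i)"
  proof (rule sum.mono_neutral_left)
    show "\<forall>i\<in>UNIV \<times> {..<N} \<times> Bs - I. f i = 0"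
    proof
      fix i assume i: "i \<in> UNIV \<times> {..<N} \<times> Bs - I"
      obtain s k v where skv: "i = (s, k, v)" by (cases i)
      with i have "s" "k = 0" by (auto simp: I_def)
      then show "f i = 0" using assms by (simp add: skv)
    qed
  qed (use finB in \<open>auto simp: I_def\<close>)
  also have "\<dots> = (\<Sum>s\<in>UNIV. \<Sum>k<N. \<Sum>v\<in>Bs. f (s, k, v))"
    by (simp add: sum.cartesian_product case_prod_beta)
  also have "\<dots> = (\<Sum>k<N. \<Sum>v\<in>Bs. f (True, k, v) + f (False, k, v))"
    by (simp add: UNIV_bool sum.distrib add.commute)
  also have "\<dots> = (\<Sum>v\<in>Bs. \<Sum>k<N. f (True, k, v) + f (False, k, v))" by (rule sum.swap)
  finally show ?thesis .
qed

lemma suppD: "supp x \<Longrightarrow> x (True, 0, v) = 0" by (auto simp: supp_def I_def)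

lemma basis_inner: "v \<in> Bs \<Longrightarrow> (\<Sum>v'\<in>Bs. f v' *\<^sub>R v') \<bullet> v = f v"
  by (simp add: inner_sum_left orth finB if_distrib cong: if_cong)

lemma basis_expand: "(\<Sum>v\<in>Bs. (y \<bullet> v) *\<^sub>R v) = y"
proof -
  define r where "r = (\<Sum>v\<in>Bs. (y \<bullet> v) *\<^sub>R v) - y"
  have "orthogonal r v" if "v \<in> Bs" for v using basis_inner[OF that, of "\<lambda>v. y \<bullet> v"]
    by (simp add: orthogonal_def r_def inner_diff_left)
  then have "orthogonal r v" if "v \<in> span Bs" for v using that orthogonal_to_span by blast
  then have "orthogonal r r" using spanB by simp
  then show ?thesis by (simp add: orthogonal_def r_def)
qed

lemma inner_basis: "y \<bullet> y' = (\<Sum>v\<in>Bs. (y \<bullet> v) * (y' \<bullet> v))"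
proof -
  have "y \<bullet> y' = (\<Sum>v\<in>Bs. (y \<bullet> v) *\<^sub>R v) \<bullet> y'" by (simp only: basis_expand)
  also have "\<dots> = (\<Sum>v\<in>Bs. (y \<bullet> v) * (v \<bullet> y'))" by (simp only: inner_sum_left inner_scaleR_left)
  also have "\<dots> = (\<Sum>v\<in>Bs. (y \<bullet> v) * (y' \<bullet> v))" by (simp only: inner_commute[of _ y'])
  finally show ?thesis .
qed

lemma eq_basisI: "(\<And>v. v \<in> Bs \<Longrightarrow> y \<bullet> v = y' \<bullet> v) \<Longrightarrow> y = y'"
  using basis_expand[of y] basis_expand[of y'] by (metis (no_types, lifting) sum.cong)

lemma Z_inner: "v \<in> Bs \<Longrightarrow> fst (Z x j) \<bullet> v = (\<Sum>k<N. (x (True,k,v) + x (False,k,v)) * cs N k j)"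
  "v \<in> Bs \<Longrightarrow> snd (Z x j) \<bullet> v = (\<Sum>k<N. (x (True,k,v) - x (False,k,v)) * sn N k j)"
  unfolding Z_def by (simp_all add: basis_inner)

lemma Z_zeta: "supp x \<Longrightarrow> Z x j = (\<Sum>i\<in>I. x i *\<^sub>R \<zeta> j i)"
  by (subst sumI) (auto simp: suppD Z_def \<zeta>_def prod_eq_iff fst_sum snd_sum scaleR_sum_left sum.distrib
     algebra_simps intro!: sum.cong)

lemma Z_add: "Z (\<lambda>i. x i + y i) j = Z x j + Z y j"
  by (simp add: Z_def prod_eq_iff sum.distrib[symmetric] scaleR_add_left[symmetric] algebra_simps)

lemma Z_basis_scale: "supp x \<Longrightarrow> Z (\<lambda>i. c (snd (snd i)) * x i) j
     = (\<Sum>v\<in>Bs. (c v * (fst (Z x j) \<bullet> v)) *\<^sub>R v, \<Sum>v\<in>Bs. (c v * (snd (Z x j) \<bullet> v)) *\<^sub>R v)"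
  by (subst Z_def) (auto simp: Z_inner sum_distrib_left algebra_simps intro!: sum.cong)

lemma supp_mult: "supp x \<Longrightarrow> supp (\<lambda>i. c i * x i)" by (simp add: supp_def)

text \<open>For k \<ge> 1 the identity (x + x')(y + y') + (x - x')(y - y') = 2(xy + x'y') meets
  equal weights \<open>N\<close> for cosines and sines. For k = 0 the sine is absent and
  \<open>supp\<close> excludes the flag \<open>True\<close>, but the cosine weight doubles.\<close>

lemma parseval:
  fixes x y :: "bool \<times> nat \<times> 'a \<Rightarrow> real"
  assumes x: "supp x" and y: "supp y"
  shows "(\<Sum>j<2*N. Z x (int j) \<bullet> Z y (int j)) = 2 * N * (\<Sum>i\<in>I. x i * y i)"
proof -
  define a b a' b' :: "nat \<Rightarrow> 'a \<Rightarrow> real" where "a k v = x (True,k,v) + x (False,k,v)" and "b k v = x (True,k,v) - x (False,k,v)"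
    and "a' k v = y (True,k,v) + y (False,k,v)" and "b' k v = y (True,k,v) - y (False,k,v)" for k v
  note ab = a_def b_def a'_def b'_def
  have one: "(\<Sum>j<2*N. (\<Sum>k<N. a k v * cs N k (int j)) * (\<Sum>k<N. a' k v * cs N k (int j))
         + (\<Sum>k<N. b k v * sn N k (int j)) * (\<Sum>k<N. b' k v * sn N k (int j)))
       = (\<Sum>k<N. 2 * N * (x (True,k,v) * y (True,k,v) + x (False,k,v) * y (False,k,v)))" for v
  proof -
    have C: "(\<Sum>j<2*N. (\<Sum>k<N. a k v * cs N k (int j)) * (\<Sum>k<N. a' k v * cs N k (int j)))
       = (\<Sum>k<N. a k v * a' k v * (if k = 0 then 2 * real N else real N))"
    proof -
      have "(\<Sum>j<2*N. (\<Sum>k<N. a k v * cs N k (int j)) * (\<Sum>k<N. a' k v * cs N k (int j)))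
         = (\<Sum>j<2*N. \<Sum>k<N. \<Sum>l<N. a k v * a' l v * (cs N k (int j) * cs N l (int j)))"
        by (simp only: sum_product) (simp add: mult_ac)
      also have "\<dots> = (\<Sum>k<N. \<Sum>l<N. a k v * a' l v * (\<Sum>j<2*N. cs N k (int j) * cs N l (int j)))"
        unfolding sum_distrib_left by (rule trans[OF sum.swap]) (intro sum.cong refl sum.swap)
      also have "\<dots> = (\<Sum>k<N. \<Sum>l<N. if l = k then a k v * a' k v * (if k = 0 then 2 * real N else real N) else 0)"
        by (intro sum.cong refl) (subst cs_orth[OF N0(1)], auto)
      also have "\<dots> = (\<Sum>k<N. a k v * a' k v * (if k = 0 then 2 * real N else real N))"
        by (intro sum.cong refl) simp
      finally show ?thesis .
    qed
    have S: "(\<Sum>j<2*N. (\<Sum>k<N. b k v * sn N k (int j)) * (\<Sum>k<N. b' k v * sn N k (int j)))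
       = (\<Sum>k<N. b k v * b' k v * (if k = 0 then 0 else real N))"
    proof -
      have "(\<Sum>j<2*N. (\<Sum>k<N. b k v * sn N k (int j)) * (\<Sum>k<N. b' k v * sn N k (int j)))
         = (\<Sum>j<2*N. \<Sum>k<N. \<Sum>l<N. b k v * b' l v * (sn N k (int j) * sn N l (int j)))"
        by (simp only: sum_product) (simp add: mult_ac)
      also have "\<dots> = (\<Sum>k<N. \<Sum>l<N. b k v * b' l v * (\<Sum>j<2*N. sn N k (int j) * sn N l (int j)))"
        unfolding sum_distrib_left by (rule trans[OF sum.swap]) (intro sum.cong refl sum.swap)
      also have "\<dots> = (\<Sum>k<N. \<Sum>l<N. if l = k then b k v * b' k v * (if k = 0 then 0 else real N) else 0)"
        by (intro sum.cong refl) (subst sn_orth[OF N0(1)], auto)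
      also have "\<dots> = (\<Sum>k<N. b k v * b' k v * (if k = 0 then 0 else real N))"
        by (intro sum.cong refl) simp
      finally show ?thesis .
    qed
    show ?thesis unfolding sum.distrib C S unfolding sum.distrib[symmetric]
      by (intro sum.cong refl) (auto simp: ab suppD[OF x] suppD[OF y] algebra_simps)
  qed
  have "(\<Sum>j<2*N. Z x (int j) \<bullet> Z y (int j)) = (\<Sum>j<2*N. \<Sum>v\<in>Bs. (\<Sum>k<N. a k v * cs N k (int j)) * (\<Sum>k<N. a' k v * cs N k (int j))
         + (\<Sum>k<N. b k v * sn N k (int j)) * (\<Sum>k<N. b' k v * sn N k (int j)))"
  proof (intro sum.cong refl)
    fix j
    have "Z x (int j) \<bullet> Z y (int j) = (\<Sum>v\<in>Bs. (fst (Z x (int j)) \<bullet> v) * (fst (Z y (int j)) \<bullet> v))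
        + (\<Sum>v\<in>Bs. (snd (Z x (int j)) \<bullet> v) * (snd (Z y (int j)) \<bullet> v))"
      by (simp only: inner_prod_def inner_basis[symmetric])
    then show "Z x (int j) \<bullet> Z y (int j) = (\<Sum>v\<in>Bs. (\<Sum>k<N. a k v * cs N k (int j)) * (\<Sum>k<N. a' k v * cs N k (int j))
         + (\<Sum>k<N. b k v * sn N k (int j)) * (\<Sum>k<N. b' k v * sn N k (int j)))"
      by (simp add: Z_inner ab sum.distrib cong: sum.cong)
  qed
  also have "\<dots> = (\<Sum>v\<in>Bs. \<Sum>k<N. 2 * N * (x (True,k,v) * y (True,k,v) + x (False,k,v) * y (False,k,v)))"
    by (rule trans[OF sum.swap]) (intro sum.cong refl one)
  also have "\<dots> = 2 * N * (\<Sum>i\<in>I. x i * y i)"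
    by (subst sumI) (simp_all add: suppD[OF x] sum_distrib_left)
  finally show ?thesis .
qed

section \<open>Norm estimates and the first-order expansion\<close>

definition nm :: "(bool \<times> nat \<times> 'a \<Rightarrow> real) \<Rightarrow> real" where
  "nm x = sqrt (\<Sum>i\<in>I. (x i)\<^sup>2)"

lemma nm_nonneg: "0 \<le> nm x" and nm_sq: "(nm x)\<^sup>2 = (\<Sum>i\<in>I. (x i)\<^sup>2)"
  by (auto simp: nm_def sum_nonneg)

lemma parseval_norm: "supp x \<Longrightarrow> (\<Sum>j<2*N. (norm (Z x (int j)))\<^sup>2) = 2 * N * (nm x)\<^sup>2"
  using parseval[of x x] by (simp add: nm_sq power2_norm_eq_inner) (simp add: power2_eq_square)

lemma norm_Z_le:
  assumes "supp x" "j < 2 * N"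
  shows "norm (Z x (int j)) \<le> sqrt (2 * N) * nm x"
proof -
  have "(norm (Z x (int j)))\<^sup>2 \<le> (\<Sum>j<2*N. (norm (Z x (int j)))\<^sup>2)"
    using assms(2) by (intro member_le_sum) auto
  also have "\<dots> = (sqrt (2 * N) * nm x)\<^sup>2" using parseval_norm[OF assms(1)] by (simp add: power_mult_distrib)
  finally show ?thesis by (rule power2_le_imp_le) (simp add: nm_nonneg)
qed

lemma sum_norm_Z_le:
  assumes "supp x"
  shows "w * (\<Sum>j<2*N. norm (Z x (int j))) \<le> nm x / 2"
proof -
  have "(\<Sum>j<2*N. norm (Z x (int j)))\<^sup>2 \<le> (\<Sum>j<2*N. (norm (Z x (int j)))\<^sup>2) * card {..<2*N}"
    by (rule sum_squared_le_sum_of_squares)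
  also have "\<dots> = (2 * N * nm x)\<^sup>2" using parseval_norm[OF assms] by (simp add: power_mult_distrib power2_eq_square)
  finally have "(\<Sum>j<2*N. norm (Z x (int j))) \<le> 2 * N * nm x"
    by (rule power2_le_imp_le) (simp add: nm_nonneg)
  then have "w * (\<Sum>j<2*N. norm (Z x (int j))) \<le> w * (2 * N * nm x)"
    using w(1) by (intro mult_left_mono) auto
  also have "\<dots> = nm x / 2" using w(2) by (simp add: mult.assoc[symmetric])
  finally show ?thesis .
qed

lemma cont_Z: "continuous_on UNIV (\<lambda>x. Z x j)"
  unfolding Z_def by (intro continuous_intros) auto

lemma cont_Hb: "continuous_on UNIV Hb"
  by (rule has_derivative_continuous_on, rule deriv)

lemma cont_DH: "continuous_on UNIV DH" using uc by (rule uniformly_continuous_imp_continuous)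

lemma cont_\<Phi>: "continuous_on UNIV \<Phi>"
  unfolding \<Phi>_def
  by (intro continuous_intros continuous_on_compose2[OF cont_Hb cont_Z]) auto

lemma cont_g: "continuous_on UNIV (\<lambda>x. g x i)"
  unfolding g_def
  by (intro continuous_intros continuous_on_compose2[OF cont_DH cont_Z]) auto

text \<open>Uniform continuity of the gradient makes the first-order error uniform over the
  unbounded phase space. The estimate is from below because \<open>Hb\<close> enters \<Phi> with a
  minus sign.\<close>

lemma Hb_expand:
  assumes "\<epsilon> > 0"
  obtains d where "d > 0" "\<And>z y. norm y \<le> d \<Longrightarrow> Hb z + DH z \<bullet> y - \<epsilon> * norm y \<le> Hb (z + y)"
proof -
  from uc assms obtain d where d: "d > 0" "\<And>z z'. dist z' z < d \<Longrightarrow> dist (DH z') (DH z) < \<epsilon>"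
    unfolding uniformly_continuous_on_def by (metis UNIV_I)
  show thesis
  proof (rule that[of "d/2"])
    fix z y :: "'a \<times> 'a" assume y: "norm y \<le> d / 2"
    define f where "f t = Hb (z + t *\<^sub>R y)" for t :: real
    have "(f has_derivative (\<lambda>h. DH (z + t *\<^sub>R y) \<bullet> (h *\<^sub>R y))) (at t)" for t
      unfolding f_def by (rule has_derivative_compose[OF _ deriv, of "\<lambda>t. z + t *\<^sub>R y" "\<lambda>h. h *\<^sub>R y", unfolded o_def])
        (auto intro!: derivative_eq_intros)
    then have fd: "(f has_real_derivative (DH (z + t *\<^sub>R y) \<bullet> y)) (at t)" for t
      by (simp add: has_field_derivative_def mult_commute_abs)
    obtain t where t: "0 < t" "t < 1" "f 1 - f 0 = (1 - 0) * (DH (z + t *\<^sub>R y) \<bullet> y)"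
      using MVT2[of 0 1 f "\<lambda>t. DH (z + t *\<^sub>R y) \<bullet> y"] fd by auto
    have "norm (t *\<^sub>R y) \<le> d / 2" using t y mult_left_le_one_le[of "norm y" t] by simp
    then have "norm (DH (z + t *\<^sub>R y) - DH z) < \<epsilon>"
      using d(2)[of "z + t *\<^sub>R y" z] d(1) by (auto simp: dist_norm)
    then have "\<bar>(DH (z + t *\<^sub>R y) - DH z) \<bullet> y\<bar> \<le> \<epsilon> * norm y"
      by (intro order_trans[OF Cauchy_Schwarz_ineq2] mult_right_mono) auto
    then show "Hb z + DH z \<bullet> y - \<epsilon> * norm y \<le> Hb (z + y)"
      using t(3) by (simp add: f_def inner_diff_left)
  qed (use d in auto)
qed

lemma lam_le: "i \<in> I \<Longrightarrow> \<bar>lam i\<bar> \<le> N"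
  by (auto simp: lam_def abs_mult mult_left_le split: prod.splits)

lemma sum_inner_zeta:
  assumes "supp v"
  shows "(\<Sum>i\<in>I. g x i * v i) = 2 * (\<Sum>i\<in>I. lam i * x i * v i) - w * (\<Sum>j<2*N. DH (Z x (int j)) \<bullet> Z v (int j))"
proof -
  have "w * (\<Sum>j<2*N. DH (Z x (int j)) \<bullet> Z v (int j)) = (\<Sum>i\<in>I. w * (\<Sum>j<2*N. DH (Z x (int j)) \<bullet> \<zeta> (int j) i) * v i)"
    unfolding Z_zeta[OF assms] inner_sum_right sum_distrib_left sum_distrib_right
    by (rule trans[OF sum.swap]) (simp add: mult_ac)
  moreover have "(\<Sum>i\<in>I. g x i * v i) = (\<Sum>i\<in>I. 2 * (lam i * x i * v i) - w * (\<Sum>j<2*N. DH (Z x (int j)) \<bullet> \<zeta> (int j) i) * v i)"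
    by (simp add: g_def algebra_simps)
  ultimately show ?thesis
    by (simp only: sum_subtractf sum_distrib_left[symmetric])
qed

lemma descent:
  assumes "\<epsilon> > 0"
  shows "\<exists>r>0. \<forall>(x :: bool \<times> nat \<times> 'a \<Rightarrow> real) (v :: bool \<times> nat \<times> 'a \<Rightarrow> real). (\<forall>i. i \<notin> I \<longrightarrow> x i = 0) \<and> (\<forall>i. i \<notin> I \<longrightarrow> v i = 0) \<and> sqrt (\<Sum>i\<in>I. (v i)\<^sup>2) \<le> r \<longrightarrow>
        \<Phi> (\<lambda>i. x i + v i) \<le> \<Phi> x + (\<Sum>i\<in>I. g x i * v i) + \<epsilon> * sqrt (\<Sum>i\<in>I. (v i)\<^sup>2)"
proof -
  define s where "s = sqrt (2 * N)"
  have s: "s > 0" using N0 by (simp add: s_def)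
  obtain d where d: "d > 0" "\<And>z y. norm y \<le> d \<Longrightarrow> Hb z + DH z \<bullet> y - \<epsilon> * norm y \<le> Hb (z + y)"
    using Hb_expand[OF assms] by blast
  \<comment> \<open>The first entry keeps all sampled displacements within \<open>d\<close>. The
    second makes the quadratic term, at most N |v|^2, half of the tolerance; the other half absorbs
    the error of \<open>Hb\<close>.\<close>
  define r where "r = min (d / s) (\<epsilon> / (2 * N))"
  show ?thesis
  proof (intro exI[of _ r] conjI allI impI)
    show "r > 0" using d s assms N0 by (simp add: r_def)
    fix x v :: "bool \<times> nat \<times> 'a \<Rightarrow> real" assume "(\<forall>i. i \<notin> I \<longrightarrow> x i = 0) \<and> (\<forall>i. i \<notin> I \<longrightarrow> v i = 0) \<and> sqrt (\<Sum>i\<in>I. (v i)\<^sup>2) \<le> r"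
    then have x: "supp x" and v: "supp v" and vr: "nm v \<le> r" by (auto simp: supp_def nm_def)
    have e1: "Hb (Z x (int j)) + DH (Z x (int j)) \<bullet> Z v (int j) - \<epsilon> * norm (Z v (int j)) \<le> Hb (Z x (int j) + Z v (int j))"
      if "j < 2 * N" for j
    proof (rule d(2))
      have "s * nm v \<le> s * (d / s)" using vr s by (intro mult_left_mono) (auto simp: r_def)
      then show "norm (Z v (int j)) \<le> d" using norm_Z_le[OF v that] s by (simp add: s_def)
    qed
    have "(\<Sum>j<2*N. Hb (Z x (int j))) + (\<Sum>j<2*N. DH (Z x (int j)) \<bullet> Z v (int j)) - \<epsilon> * (\<Sum>j<2*N. norm (Z v (int j)))
        \<le> (\<Sum>j<2*N. Hb (Z x (int j) + Z v (int j)))"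
      unfolding sum_distrib_left sum.distrib[symmetric] sum_subtractf[symmetric] by (intro sum_mono e1) auto
    then have "w * ((\<Sum>j<2*N. Hb (Z x (int j))) + (\<Sum>j<2*N. DH (Z x (int j)) \<bullet> Z v (int j)) - \<epsilon> * (\<Sum>j<2*N. norm (Z v (int j))))
        \<le> w * (\<Sum>j<2*N. Hb (Z x (int j) + Z v (int j)))"
      using w(1) by (intro mult_left_mono) auto
    moreover have "\<epsilon> * (w * (\<Sum>j<2*N. norm (Z v (int j)))) \<le> \<epsilon> * (nm v / 2)"
      using sum_norm_Z_le[OF v] assms by (intro mult_left_mono) auto
    moreover have "(\<Sum>i\<in>I. lam i * (v i)\<^sup>2) \<le> \<epsilon> * (nm v / 2)"
    proof -
      have "(\<Sum>i\<in>I. lam i * (v i)\<^sup>2) \<le> (\<Sum>i\<in>I. N * (v i)\<^sup>2)"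
        using lam_le by (intro sum_mono mult_right_mono) (auto simp: abs_le_iff)
      also have "\<dots> = N * nm v * nm v" using nm_sq[of v] by (simp add: sum_distrib_left[symmetric] power2_eq_square)
      also have "\<dots> \<le> N * (\<epsilon> / (2 * N)) * nm v"
        using vr nm_nonneg by (intro mult_right_mono mult_left_mono) (auto simp: r_def)
      finally show ?thesis using N0 by simp
    qed
    moreover have "(\<Sum>i\<in>I. lam i * (x i + v i)\<^sup>2) = (\<Sum>i\<in>I. lam i * (x i)\<^sup>2) + 2 * (\<Sum>i\<in>I. lam i * x i * v i) + (\<Sum>i\<in>I. lam i * (v i)\<^sup>2)"
      unfolding sum_distrib_left sum.distrib[symmetric] by (intro sum.cong refl) (simp add: power2_eq_square algebra_simps)
    ultimately show "\<Phi> (\<lambda>i. x i + v i) \<le> \<Phi> x + (\<Sum>i\<in>I. g x i * v i) + \<epsilon> * sqrt (\<Sum>i\<in>I. (v i)\<^sup>2)"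
      unfolding sum_inner_zeta[OF v] \<Phi>_def Z_add nm_def[symmetric] by (simp add: algebra_simps)
  qed
qed

section \<open>The linking sets\<close>

lemma w2: "w * real (2 * N) = 1 / 2" using w by simp

text \<open>The radius at which the quartic bound on the potential amounts to half of the quadratic
  action \<alpha>^2. It does not involve \<open>N\<close>.\<close>

definition "\<alpha> = 1 / (2 * sqrt (card Bs * C4))"
definition "zc = (\<lambda>(s, k, v). if \<not> s \<and> k = 0 \<and> v \<in> Bs then x0 \<bullet> v else 0)"
text \<open>The Sobolev norm of order one half of the positive part. Together with the centre
  \<open>zc\<close>, the constant loop at (x0, 0), it describes one linking set; the mode
  \<open>i1\<close> spans the positive direction of the other.\<close>

definition "D x = sqrt (\<Sum>i\<in>I. (if fst i then real (fst (snd i)) else 0) * (x i)\<^sup>2)"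
definition "i1 = (True, 1::nat, u)"

lemma i1: "i1 \<in> I" "i1 \<notin> B" using u N0 by (auto simp: i1_def I_def B_def)

lemma card0: "0 < card Bs" using finB u card_gt_0_iff by blast

lemma \<alpha>: "\<alpha> > 0" "2 * card Bs * C4 * \<alpha>\<^sup>2 = 1 / 2"
  using card0 C4 by (auto simp: \<alpha>_def power_divide power_mult_distrib)

lemma Z_zc: "Z zc j = (x0, 0)"
proof -
  have s: "(\<Sum>k<N. f k) = f 0" if "\<And>k. k \<noteq> 0 \<Longrightarrow> f k = 0" for f :: "nat \<Rightarrow> real"
  proof -
    have "(\<Sum>k<N. f k) = (\<Sum>k\<in>{0}. f k)"
      using N0 that by (intro sum.mono_neutral_right) auto
    then show ?thesis by simp
  qed
  have "(\<Sum>k<N. (zc (True,k,v) + zc (False,k,v)) * cs N k j) = x0 \<bullet> v" if "v \<in> Bs" for v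
    by (subst s) (auto simp: zc_def that)
  moreover have "(\<Sum>k<N. (zc (True,k,v) - zc (False,k,v)) * sn N k j) = 0" for v
    by (subst s) (auto simp: zc_def)
  ultimately show ?thesis by (simp add: Z_def basis_expand cong: sum.cong)
qed

lemma norm_basis: "(norm z)\<^sup>2 = (\<Sum>v\<in>Bs. (fst z \<bullet> v)\<^sup>2 + (snd z \<bullet> v)\<^sup>2)"
proof -
  have "(norm z)\<^sup>2 = fst z \<bullet> fst z + snd z \<bullet> snd z" by (simp add: power2_norm_eq_inner inner_prod_def)
  also have "\<dots> = (\<Sum>v\<in>Bs. (fst z \<bullet> v) * (fst z \<bullet> v)) + (\<Sum>v\<in>Bs. (snd z \<bullet> v) * (snd z \<bullet> v))"
    by (simp only: inner_basis[symmetric])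
  finally show ?thesis by (simp add: sum.distrib power2_eq_square)
qed

lemma norm_quartic: "(norm z)^4 \<le> 2 * card Bs * (\<Sum>v\<in>Bs. (fst z \<bullet> v)^4 + (snd z \<bullet> v)^4)"
proof -
  have "(norm z)^4 = ((norm z)\<^sup>2)\<^sup>2" by simp
  also have "\<dots> \<le> (\<Sum>v\<in>Bs. ((fst z \<bullet> v)\<^sup>2 + (snd z \<bullet> v)\<^sup>2)\<^sup>2) * card Bs"
    unfolding norm_basis by (rule sum_squared_le_sum_of_squares)
  also have "\<dots> \<le> (\<Sum>v\<in>Bs. 2 * ((fst z \<bullet> v)^4 + (snd z \<bullet> v)^4)) * card Bs"
  proof (intro mult_right_mono sum_mono)
    fix v
    have "(A + B)\<^sup>2 \<le> 2 * (A\<^sup>2 + B\<^sup>2)" for A B :: real using sum_squares_bound[of A B] by (simp add: power2_sum)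
    from this[of "(fst z \<bullet> v)\<^sup>2" "(snd z \<bullet> v)\<^sup>2"]
    show "((fst z \<bullet> v)\<^sup>2 + (snd z \<bullet> v)\<^sup>2)\<^sup>2 \<le> 2 * ((fst z \<bullet> v)^4 + (snd z \<bullet> v)^4)" by simp
  qed simp
  finally show ?thesis unfolding sum_distrib_left[symmetric] by (simp only: mult_ac)
qed

lemma lam_pos_ge: "i \<in> I \<Longrightarrow> fst i \<Longrightarrow> real (fst (snd i)) \<le> lam i"
  using freq_ge[OF N0(1)] by (force simp: lam_def I_def split: prod.splits)

lemma lam_neg_le: "i \<in> I \<Longrightarrow> \<not> fst i \<Longrightarrow> lam i \<le> 0"
proof -
  assume i: "i \<in> I" "\<not> fst i"
  obtain s k v where skv: "i = (s, k, v)" by (cases i)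
  have "2 * real k \<le> 2 * N * sin (pi * k / (2 * N))" using i freq_ge[OF N0(1), of k] by (auto simp: I_def skv)
  then show ?thesis using i by (simp add: lam_def skv)
qed

text \<open>On this set the loop is the constant (x0, 0) plus positive modes \<open>y\<close>. The
  quadratic part is at least \<alpha>^2 because \<open>lam\<close> dominates the weight k, while
  flatness and the discrete fourth-power estimate bound the potential part by \<alpha>^2 /
  2.\<close>

lemma link:
  assumes x: "supp x" and xB: "\<forall>i\<in>B. x i = zc i" and Dx: "D x = \<alpha>"
  shows "\<alpha>\<^sup>2 / 2 \<le> \<Phi> x"
proof -
  define y where "y = (\<lambda>i. if fst i then x i else 0)"
  have y: "supp y" using x by (simp add: supp_def y_def)
  have "x i = zc i + y i" for i
  proof (cases "i \<in> B")
    case True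
    then show ?thesis using xB by (auto simp: y_def B_def)
  next
    case False
    then show ?thesis using x N0 by (cases i) (auto simp: supp_def y_def zc_def I_def B_def)
  qed
  then have "x = (\<lambda>i. zc i + y i)" by auto
  then have Zx: "Z x j = (x0, 0) + Z y j" for j using Z_add[of zc y j] by (simp add: Z_zc)
  define d where "d v = (\<Sum>k=1..<N. k * (y (True, k, v))\<^sup>2)" for v
  have d0: "0 \<le> d v" for v by (simp add: d_def sum_nonneg)
  have ks: "(\<Sum>k<N. f k) = (\<Sum>k=1..<N. f k)" if "f 0 = 0" for f :: "nat \<Rightarrow> real"
    by (rule sum.mono_neutral_right) (use that in \<open>auto simp: Suc_le_eq\<close>)
  have D2: "\<alpha>\<^sup>2 = (\<Sum>v\<in>Bs. d v)"
  proof -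
    have "\<alpha>\<^sup>2 = (\<Sum>i\<in>I. (if fst i then real (fst (snd i)) else 0) * (x i)\<^sup>2)"
      unfolding Dx[symmetric] D_def by (intro real_sqrt_pow2 sum_nonneg) auto
    also have "\<dots> = (\<Sum>v\<in>Bs. \<Sum>k<N. k * (x (True, k, v))\<^sup>2)" by (subst sumI) auto
    also have "\<dots> = (\<Sum>v\<in>Bs. d v)" by (intro sum.cong refl) (subst ks, auto simp: d_def y_def)
    finally show ?thesis .
  qed
  have q: "fst (Z y j) \<bullet> v = (\<Sum>k=1..<N. y (True,k,v) * cs N k j)" "snd (Z y j) \<bullet> v = (\<Sum>k=1..<N. y (True,k,v) * sn N k j)"
    if "v \<in> Bs" for j v
    using that suppD[OF y] by (simp_all add: Z_inner ks y_def)
  have "(\<Sum>j<2*N. (norm (Z y (int j)))^4) \<le> (\<Sum>j<2*N. 2 * card Bs * (\<Sum>v\<in>Bs. (fst (Z y (int j)) \<bullet> v)^4 + (snd (Z y (int j)) \<bullet> v)^4))"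
    by (intro sum_mono norm_quartic)
  also have "\<dots> = 2 * card Bs * (\<Sum>v\<in>Bs. (\<Sum>j<2*N. (fst (Z y (int j)) \<bullet> v)^4) + (\<Sum>j<2*N. (snd (Z y (int j)) \<bullet> v)^4))"
    unfolding sum_distrib_left[symmetric] sum.distrib[symmetric] by (subst sum.swap) (rule refl)
  also have "\<dots> \<le> 2 * card Bs * (\<Sum>v\<in>Bs. 2 * N * (d v)\<^sup>2 + 2 * N * (d v)\<^sup>2)"
  proof (intro mult_left_mono sum_mono add_mono)
    fix v assume v: "v \<in> Bs"
    show "(\<Sum>j<2*N. (fst (Z y (int j)) \<bullet> v)^4) \<le> 2 * N * (d v)\<^sup>2"
      using sum_cs_quartic[OF N0(1), of "\<lambda>k. y (True,k,v)"] by (simp add: q[OF v] d_def)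
    show "(\<Sum>j<2*N. (snd (Z y (int j)) \<bullet> v)^4) \<le> 2 * N * (d v)\<^sup>2"
      using sum_sn_quartic[OF N0(1), of "\<lambda>k. y (True,k,v)"] by (simp add: q[OF v] d_def)
  qed simp
  also have "\<dots> = 8 * card Bs * N * (\<Sum>v\<in>Bs. (d v)\<^sup>2)" by (simp add: sum_distrib_left[symmetric])
  also have "\<dots> \<le> 8 * card Bs * N * (\<alpha>\<^sup>2)\<^sup>2"
  proof (intro mult_left_mono)
    have "(\<Sum>v\<in>Bs. (d v)\<^sup>2) \<le> (\<Sum>v\<in>Bs. d v * (\<Sum>v\<in>Bs. d v))"
      unfolding power2_eq_square using finB d0 by (intro sum_mono mult_left_mono member_le_sum) auto
    then show "(\<Sum>v\<in>Bs. (d v)\<^sup>2) \<le> (\<alpha>\<^sup>2)\<^sup>2" unfolding D2 by (simp add: sum_distrib_right[symmetric] power2_eq_square)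
  qed simp
  finally have quart: "(\<Sum>j<2*N. (norm (Z y (int j)))^4) \<le> 8 * card Bs * N * (\<alpha>\<^sup>2)\<^sup>2" .
  have "w * (\<Sum>j<2*N. Hb (Z x (int j))) \<le> w * (\<Sum>j<2*N. C4 * (norm (Z y (int j)))^4)"
    unfolding Zx using w(1) by (intro mult_left_mono sum_mono flat) auto
  also have "\<dots> = w * (C4 * (\<Sum>j<2*N. (norm (Z y (int j)))^4))" by (simp add: sum_distrib_left)
  also have "\<dots> \<le> w * (C4 * (8 * card Bs * N * (\<alpha>\<^sup>2)\<^sup>2))"
    using w(1) C4 quart by (intro mult_left_mono) auto
  also have "\<dots> = (w * (2 * N)) * 2 * (2 * card Bs * C4 * \<alpha>\<^sup>2) * \<alpha>\<^sup>2" by (simp add: power2_eq_square)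
  also have "\<dots> = \<alpha>\<^sup>2 / 2" unfolding w2 \<alpha>(2) by simp
  finally have h: "w * (\<Sum>j<2*N. Hb (Z x (int j))) \<le> \<alpha>\<^sup>2 / 2" .
  have "\<alpha>\<^sup>2 = (\<Sum>i\<in>I. (if fst i then real (fst (snd i)) else 0) * (x i)\<^sup>2)"
    unfolding Dx[symmetric] D_def by (intro real_sqrt_pow2 sum_nonneg) auto
  also have "\<dots> \<le> (\<Sum>i\<in>I. lam i * (x i)\<^sup>2)"
  proof (rule sum_mono)
    fix i assume i: "i \<in> I"
    show "(if fst i then real (fst (snd i)) else 0) * (x i)\<^sup>2 \<le> lam i * (x i)\<^sup>2"
    proof (cases "fst i")
      case True
      then show ?thesis using lam_pos_ge[OF i] by (auto intro: mult_right_mono)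
    next
      case False
      then have "i \<in> B" using i by (auto simp: I_def B_def)
      then have "x i = zc i" using xB by auto
      \<comment> \<open>The centre \<open>zc\<close> lives in the constant modes, whose eigenvalue
        is zero, so its position does not affect the quadratic part.\<close>
      then have "lam i * (x i)\<^sup>2 = 0" by (cases i) (auto simp: zc_def lam_def)
      then have "0 \<le> lam i * (x i)\<^sup>2" by (rule eq_refl[OF sym])
      then show ?thesis using False by simp
    qed
  qed
  finally show ?thesis using h by (simp add: \<Phi>_def)
qed

section \<open>Upper bounds and nonresonance\<close>

definition "Qf z = (\<Sum>v\<in>Bs. cf v * ((fst z \<bullet> v)\<^sup>2 + (snd z \<bullet> v)\<^sup>2))"
definition "ci i = cf (snd (snd i))"

lemma ci: "\<theta> \<le> ci i" using c0 \<theta> pi_gt3 by (auto simp: ci_def cf_def)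

lemma Z_ci: "supp x \<Longrightarrow> Z (\<lambda>i. ci i * x i) j = (\<Sum>v\<in>Bs. (cf v * (fst (Z x j) \<bullet> v)) *\<^sub>R v, \<Sum>v\<in>Bs. (cf v * (snd (Z x j) \<bullet> v)) *\<^sub>R v)"
  unfolding ci_def by (rule Z_basis_scale)

lemma sum_Qf: "supp x \<Longrightarrow> w * (\<Sum>j<2*N. Qf (Z x (int j))) = (\<Sum>i\<in>I. ci i * (x i)\<^sup>2) / 2"
proof -
  assume x: "supp x"
  have "Qf (Z x j) = Z (\<lambda>i. ci i * x i) j \<bullet> Z x j" for j
    unfolding Z_ci[OF x] Qf_def inner_prod_def fst_conv snd_conv inner_sum_left inner_scaleR_left
    by (simp add: sum.distrib power2_eq_square distrib_left mult.assoc inner_commute)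
  then have "(\<Sum>j<2*N. Qf (Z x (int j))) = 2 * N * (\<Sum>i\<in>I. ci i * x i * x i)"
    using parseval[OF supp_mult[OF x, of ci] x] by simp
  then have "w * (\<Sum>j<2*N. Qf (Z x (int j))) = (w * (2 * N)) * (\<Sum>i\<in>I. ci i * (x i)\<^sup>2)"
    by (simp add: power2_eq_square mult.assoc)
  then show ?thesis unfolding w2 by simp
qed

text \<open>The first estimate comes from Hb \<ge> 0 and settles the face s = 0. In the second,
  growth trades the coefficient pi/2 of the first mode for the negative (pi - c0)/2, which settles
  the remote faces.\<close>

lemma \<Phi>_upper:
  assumes "\<forall>i. i \<notin> B \<longrightarrow> b i = 0"
  shows "\<Phi> (\<lambda>i. b i + s * (if i = i1 then 1 else 0)) \<le> pi / 2 * s\<^sup>2"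
    "\<Phi> (\<lambda>i. b i + s * (if i = i1 then 1 else 0)) \<le> (pi - c0) / 2 * s\<^sup>2 - \<theta> / 2 * (\<Sum>i\<in>B. (b i)\<^sup>2) + C0 / 2"
proof -
  define x where "x = (\<lambda>i. b i + s * (if i = i1 then 1 else 0))"
  have x: "supp x" using assms i1 BI by (auto simp: supp_def x_def)
  have "b i1 = 0" using assms i1(2) by blast
  then have x1: "x i1 = s" by (simp add: x_def)
  have xb: "x i = b i" if "i \<in> I - {i1}" for i using that by (simp add: x_def)
  have lam1: "lam i1 \<le> pi / 2" using freq_1_le[of N] by (simp add: lam_def i1_def)
  have "(\<Sum>i\<in>I. lam i * (x i)\<^sup>2) = lam i1 * s\<^sup>2 + (\<Sum>i\<in>I-{i1}. lam i * (b i)\<^sup>2)"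
    by (subst sum.remove[OF finI i1(1)]) (simp add: x1 xb)
  moreover have "(\<Sum>i\<in>I-{i1}. lam i * (b i)\<^sup>2) \<le> 0"
  proof (rule sum_nonpos)
    fix i assume i: "i \<in> I - {i1}"
    show "lam i * (b i)\<^sup>2 \<le> 0"
    proof (cases "i \<in> B")
      case True
      then show ?thesis using lam_neg_le[of i] i by (auto simp: B_def intro!: mult_nonpos_nonneg)
    next
      case False
      then have "b i = 0" using assms by blast
      then show ?thesis by simp
    qed
  qed
  moreover have "lam i1 * s\<^sup>2 \<le> pi / 2 * s\<^sup>2" using lam1 by (rule mult_right_mono) simp
  ultimately have L: "(\<Sum>i\<in>I. lam i * (x i)\<^sup>2) \<le> pi / 2 * s\<^sup>2" by linarith
  have "0 \<le> w * (\<Sum>j<2*N. Hb (Z x (int j)))" using w(1) nonneg by (simp add: sum_nonneg)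
  with L show "\<Phi> (\<lambda>i. b i + s * (if i = i1 then 1 else 0)) \<le> pi / 2 * s\<^sup>2"
    unfolding x_def[symmetric] \<Phi>_def by linarith
  have "(\<Sum>i\<in>I. ci i * (x i)\<^sup>2) = c0 * s\<^sup>2 + (\<Sum>i\<in>I-{i1}. ci i * (b i)\<^sup>2)"
    by (subst sum.remove[OF finI i1(1)]) (simp add: x1 xb, simp add: ci_def cf_def i1_def)
  moreover have "\<theta> * (\<Sum>i\<in>B. (b i)\<^sup>2) \<le> (\<Sum>i\<in>I-{i1}. ci i * (b i)\<^sup>2)"
  proof -
    have "\<theta> * (\<Sum>i\<in>B. (b i)\<^sup>2) \<le> (\<Sum>i\<in>B. ci i * (b i)\<^sup>2)"
      unfolding sum_distrib_left by (intro sum_mono mult_right_mono ci) auto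
    also have "\<dots> \<le> (\<Sum>i\<in>I-{i1}. ci i * (b i)\<^sup>2)"
      using finI BI i1 ci \<theta> by (intro sum_mono2) (auto intro!: mult_nonneg_nonneg order_trans[OF less_imp_le[OF \<theta>(1)] ci])
    finally show ?thesis .
  qed
  moreover have "w * (\<Sum>j<2*N. Qf (Z x (int j)) - C0) \<le> w * (\<Sum>j<2*N. Hb (Z x (int j)))"
    using w(1) growth by (intro mult_left_mono sum_mono) (auto simp: Qf_def cf_def)
  moreover have "w * (\<Sum>j<2*N. Qf (Z x (int j)) - C0) = (\<Sum>i\<in>I. ci i * (x i)\<^sup>2) / 2 - C0 / 2"
  proof -
    have "w * (\<Sum>j<2*N. Qf (Z x (int j)) - C0) = w * (\<Sum>j<2*N. Qf (Z x (int j))) - (w * real (2 * N)) * C0"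
      by (simp add: sum_subtractf right_diff_distrib)
    then show ?thesis using sum_Qf[OF x] unfolding w2 by simp
  qed
  ultimately show "\<Phi> (\<lambda>i. b i + s * (if i = i1 then 1 else 0)) \<le> (pi - c0) / 2 * s\<^sup>2 - \<theta> / 2 * (\<Sum>i\<in>B. (b i)\<^sup>2) + C0 / 2"
    using L unfolding x_def[symmetric] \<Phi>_def by (simp add: algebra_simps diff_divide_distrib)
qed

definition "\<delta> = min \<theta> (min (c0 - pi) (1/2))"
lemma \<delta>: "\<delta> > 0" using c0 \<theta> by (simp add: \<delta>_def)

text \<open>The signs of the eigenvalues 2 lam - ci at infinity. The mode \<open>i1\<close> counts
  as negative because \<open>c0\<close> exceeds its frequency; this change of sign between the
  centre and infinity is what the linking exploits.\<close>

definition "\<sigma> i = (if fst i \<and> i \<noteq> i1 then 1 else - 1 :: real)"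

text \<open>The entries of \<delta> match the cases: \<theta> for nonpositive modes, c0 - pi for
  \<open>i1\<close>, and 1/2 = 4 - 7/2 for the higher positive modes along \<open>u\<close>.
  Positive modes in other directions have room 2 - \<theta> \<ge> 1.\<close>

lemma sign_gap: "i \<in> I \<Longrightarrow> \<delta> \<le> \<sigma> i * (2 * lam i - ci i)"
proof -
  assume i: "i \<in> I"
  obtain s k v where skv: "i = (s, k, v)" by (cases i)
  have f: "2 * real k \<le> 2 * N * sin (pi * k / (2 * N))" using i freq_ge[OF N0(1), of k] by (auto simp: I_def skv)
  show ?thesis
  proof (cases s)
    case False
    then show ?thesis using f ci[of i] \<theta> by (simp add: \<sigma>_def lam_def skv \<delta>_def min_le_iff_disj)
  next
    case True
    then have k: "1 \<le> real k" using i by (auto simp: I_def skv)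
    show ?thesis
    proof (cases "i = i1")
      case True
      then show ?thesis using freq_1_le[of N] by (simp add: \<sigma>_def lam_def i1_def \<delta>_def ci_def cf_def min_le_iff_disj)
    next
      case False
      have "\<delta> \<le> 2 * k - ci i"
      proof (cases "v = u")
        case True
        then have "k \<noteq> 1" using False \<open>s\<close> by (auto simp: i1_def skv)
        then have "2 \<le> k" using k by auto
        then have "2 \<le> real k" by simp
        then show ?thesis using True c0 by (simp add: ci_def cf_def skv \<delta>_def min_le_iff_disj)
      next
        case False
        then show ?thesis using k \<theta> by (simp add: ci_def cf_def skv \<delta>_def min_le_iff_disj)
      qed
      then show ?thesis using f False \<open>s\<close> by (simp add: \<sigma>_def lam_def skv)
    qed
  qed
qed

lemma M0: "0 \<le> M" using asym[of 0] norm_ge_zero order_trans by blast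

text \<open>Testing the gradient against \<sigma> x makes the asymptotic quadratic part definite
  with constant \<delta>; the rest of \<open>DH\<close> is bounded by \<open>M\<close> and
  contributes only linearly.\<close>

lemma coercive:
  assumes x: "supp x"
  shows "\<delta> * nm x \<le> sqrt (\<Sum>i\<in>I. (g x i)\<^sup>2) + M / 2"
proof (cases "nm x = 0")
  case True
  then show ?thesis using M0 by (simp add: sum_nonneg)
next
  case False
  then have nx: "nm x > 0" using nm_nonneg[of x] by simp
  define y where "y = (\<lambda>i. \<sigma> i * x i)"
  have y: "supp y" unfolding y_def by (rule supp_mult[OF x])
  have nmy: "nm y = nm x" by (auto simp: nm_def y_def \<sigma>_def power_mult_distrib intro!: arg_cong[where f=sqrt] sum.cong)
  define R where "R z = DH z - 2 *\<^sub>R (\<Sum>v\<in>Bs. (cf v * (fst z \<bullet> v)) *\<^sub>R v, \<Sum>v\<in>Bs. (cf v * (snd z \<bullet> v)) *\<^sub>R v)" for z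
  have R: "norm (R z) \<le> M" for z using asym[of z] by (simp add: R_def cf_def)
  have "DH (Z x j) = 2 *\<^sub>R Z (\<lambda>i. ci i * x i) j + R (Z x j)" for j
    unfolding Z_ci[OF x] R_def by simp
  then have "(\<Sum>j<2*N. DH (Z x (int j)) \<bullet> Z y (int j)) = 2 * (\<Sum>j<2*N. Z (\<lambda>i. ci i * x i) (int j) \<bullet> Z y (int j)) + (\<Sum>j<2*N. R (Z x (int j)) \<bullet> Z y (int j))"
    by (simp add: inner_add_left sum.distrib sum_distrib_left)
  then have "w * (\<Sum>j<2*N. DH (Z x (int j)) \<bullet> Z y (int j)) = 2 * ((w * (2 * N)) * (\<Sum>i\<in>I. ci i * x i * y i)) + w * (\<Sum>j<2*N. R (Z x (int j)) \<bullet> Z y (int j))"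
    using parseval[OF supp_mult[OF x, of ci] y] by (simp add: algebra_simps)
  then have A: "w * (\<Sum>j<2*N. DH (Z x (int j)) \<bullet> Z y (int j)) = (\<Sum>i\<in>I. ci i * x i * y i) + w * (\<Sum>j<2*N. R (Z x (int j)) \<bullet> Z y (int j))"
    unfolding w2 by linarith
  have "w * (\<Sum>j<2*N. R (Z x (int j)) \<bullet> Z y (int j)) \<le> w * (\<Sum>j<2*N. M * norm (Z y (int j)))"
  proof (intro mult_left_mono sum_mono)
    fix j
    have "R (Z x (int j)) \<bullet> Z y (int j) \<le> norm (R (Z x (int j))) * norm (Z y (int j))" by (rule norm_cauchy_schwarz)
    also have "\<dots> \<le> M * norm (Z y (int j))" by (intro mult_right_mono R) simp
    finally show "R (Z x (int j)) \<bullet> Z y (int j) \<le> M * norm (Z y (int j))" .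
  qed (use w(1) in simp)
  also have "\<dots> = M * (w * (\<Sum>j<2*N. norm (Z y (int j))))" by (simp add: sum_distrib_left mult_ac)
  also have "\<dots> \<le> M * (nm x / 2)" using sum_norm_Z_le[OF y] M0 by (intro mult_left_mono) (auto simp: nmy)
  finally have Rb: "w * (\<Sum>j<2*N. R (Z x (int j)) \<bullet> Z y (int j)) \<le> M * (nm x / 2)" .
  have "\<delta> * (nm x)\<^sup>2 = (\<Sum>i\<in>I. \<delta> * (x i)\<^sup>2)" by (simp add: nm_sq sum_distrib_left)
  also have "\<dots> \<le> (\<Sum>i\<in>I. (\<sigma> i * (2 * lam i - ci i)) * (x i)\<^sup>2)"
    by (intro sum_mono mult_right_mono sign_gap) auto
  also have "\<dots> = 2 * (\<Sum>i\<in>I. lam i * x i * y i) - (\<Sum>i\<in>I. ci i * x i * y i)"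
    unfolding sum_distrib_left sum_subtractf[symmetric] by (intro sum.cong refl) (simp add: y_def power2_eq_square algebra_simps)
  also have "\<dots> = (\<Sum>i\<in>I. g x i * y i) + w * (\<Sum>j<2*N. R (Z x (int j)) \<bullet> Z y (int j))"
    using A sum_inner_zeta[OF y, of x] by simp
  also have "(\<Sum>i\<in>I. g x i * y i) \<le> sqrt (\<Sum>i\<in>I. (g x i)\<^sup>2) * nm x"
  proof -
    have "(\<Sum>i\<in>I. g x i * y i)\<^sup>2 \<le> (\<Sum>i\<in>I. (g x i)\<^sup>2) * (\<Sum>i\<in>I. (y i)\<^sup>2)"
      by (rule Cauchy_Schwarz_ineq_sum)
    then have "(\<Sum>i\<in>I. g x i * y i) \<le> sqrt ((\<Sum>i\<in>I. (g x i)\<^sup>2) * (\<Sum>i\<in>I. (y i)\<^sup>2))" by (rule real_le_rsqrt)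
    then show ?thesis by (simp add: real_sqrt_mult nmy[symmetric]) (simp add: nm_def)
  qed
  finally have "\<delta> * (nm x)\<^sup>2 \<le> sqrt (\<Sum>i\<in>I. (g x i)\<^sup>2) * nm x + M * (nm x / 2)" using Rb by simp
  then have "(\<delta> * nm x) * nm x \<le> (sqrt (\<Sum>i\<in>I. (g x i)\<^sup>2) + M / 2) * nm x" by (simp add: power2_eq_square algebra_simps)
  then show ?thesis using nx by simp
qed

lemma critical_exists:
  obtains x where "supp x" "\<alpha>\<^sup>2 / 4 \<le> \<Phi> x" "\<forall>i\<in>I. g x i = 0"
proof -
  \<comment> \<open>Large enough to contain radius and centre of the linking set, and to let both
    quadratic losses in \<open>\<Phi>_upper\<close> outweigh \<open>C0\<close> on the far
    faces.\<close>
  define \<rho> where "\<rho> = 1 + \<alpha> + norm x0 + \<bar>C0\<bar> / \<theta> + \<bar>C0\<bar> / (c0 - pi)"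
  have \<rho>1: "\<rho> \<ge> 1" "\<alpha> < \<rho>" "norm x0 < \<rho>" "\<bar>C0\<bar> / \<theta> \<le> \<rho>" "\<bar>C0\<bar> / (c0 - pi) \<le> \<rho>"
    using \<alpha>(1) \<theta> c0 by (auto simp: \<rho>_def add_nonneg_nonneg add_increasing add_increasing2 add_pos_nonneg)
  have \<rho>2: "\<rho> \<le> \<rho>\<^sup>2" using \<rho>1 by (simp add: power2_eq_square)
  have \<rho>3: "C0 \<le> \<theta> * \<rho>\<^sup>2" "C0 \<le> (c0 - pi) * \<rho>\<^sup>2"
  proof -
    have "\<bar>C0\<bar> \<le> \<theta> * \<rho>" using \<rho>1(4) \<theta> by (simp add: pos_divide_le_eq mult.commute)
    also have "\<dots> \<le> \<theta> * \<rho>\<^sup>2" using \<rho>2 \<theta> by (intro mult_left_mono) auto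
    finally show "C0 \<le> \<theta> * \<rho>\<^sup>2" by simp
    have "\<bar>C0\<bar> \<le> (c0 - pi) * \<rho>" using \<rho>1(5) c0 by (simp add: pos_divide_le_eq mult.commute)
    also have "\<dots> \<le> (c0 - pi) * \<rho>\<^sup>2" using \<rho>2 c0 by (intro mult_left_mono) auto
    finally show "C0 \<le> (c0 - pi) * \<rho>\<^sup>2" by simp
  qed
  define K where "K = (1 + M / 2) / \<delta>"
  obtain x where "\<forall>i. i \<notin> I \<longrightarrow> x i = 0" "\<alpha>\<^sup>2 / 2 / 2 \<le> \<Phi> x" "\<forall>i\<in>I. g x i = 0"
  proof (rule linking_critical[OF finI BI, of i1 \<Phi> g D "\<lambda>i. if i = i1 then 1 else 0" \<alpha> \<rho> zc "\<alpha>\<^sup>2 / 2" "pi / 2 * \<rho>\<^sup>2" K])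
    show "i1 \<in> I - B" using i1 by simp
    show "continuous_on UNIV \<Phi>" "\<And>i. continuous_on UNIV (\<lambda>x. g x i)" by (rule cont_\<Phi>, rule cont_g)
    show "continuous_on UNIV D" unfolding D_def by (intro continuous_intros) auto
  next
    fix \<epsilon> :: real assume "\<epsilon> > 0" then show "\<exists>r>0. \<forall>x v. (\<forall>i. i \<notin> I \<longrightarrow> x i = 0) \<and> (\<forall>i. i \<notin> I \<longrightarrow> v i = 0) \<and> sqrt (\<Sum>i\<in>I. (v i)\<^sup>2) \<le> r \<longrightarrow>
        \<Phi> (\<lambda>i. x i + v i) \<le> \<Phi> x + (\<Sum>i\<in>I. g x i * v i) + \<epsilon> * sqrt (\<Sum>i\<in>I. (v i)\<^sup>2)" by (rule descent)
  next
    show "(if i = i1 then 1 else 0) = (0::real)" if "i \<in> B" for i using that i1 by auto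
    show "(if i = i1 then 1 else 0) = (0::real)" if "i \<notin> I" for i using that i1 by auto
  next
    fix b :: "bool \<times> nat \<times> 'a \<Rightarrow> real" and s :: real assume b: "\<forall>i. i \<notin> B \<longrightarrow> b i = 0" and s: "0 \<le> s"
    have "(\<Sum>i\<in>I. (if fst i then real (fst (snd i)) else 0) * (b i + s * (if i = i1 then 1 else 0))\<^sup>2)
      = (\<Sum>i\<in>I. if i = i1 then s\<^sup>2 else 0)"
    proof (intro sum.cong refl)
      fix i assume i: "i \<in> I"
      show "(if fst i then real (fst (snd i)) else 0) * (b i + s * (if i = i1 then 1 else 0))\<^sup>2 = (if i = i1 then s\<^sup>2 else 0)"
        using b i1 by (cases "i \<in> B") (auto simp: B_def i1_def)
    qed
    then show "D (\<lambda>i. b i + s * (if i = i1 then 1 else 0)) = s" using s finI i1 by (simp add: D_def)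
    assume "\<forall>i. \<bar>b i\<bar> \<le> \<rho>" and sr: "s \<le> \<rho>"
    note up = \<Phi>_upper[OF b, of s]
    have "pi / 2 * s\<^sup>2 \<le> pi / 2 * \<rho>\<^sup>2" using s sr by (intro mult_left_mono power_mono) auto
    with up(1) show "\<Phi> (\<lambda>i. b i + s * (if i = i1 then 1 else 0)) \<le> pi / 2 * \<rho>\<^sup>2" by linarith
    have fB: "finite B" using finI BI finite_subset by blast
    have sb: "0 \<le> (\<Sum>i\<in>B. (b i)\<^sup>2)" by (simp add: sum_nonneg)
    assume "s = 0 \<or> s = \<rho> \<or> (\<exists>i\<in>B. \<bar>b i\<bar> = \<rho>)"
    then show "\<Phi> (\<lambda>i. b i + s * (if i = i1 then 1 else 0)) \<le> 0"
    proof (elim disjE bexE)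
      assume "s = 0" then show ?thesis using up(1) by simp
    next
      assume "s = \<rho>"
      moreover have "0 \<le> \<theta> / 2 * (\<Sum>i\<in>B. (b i)\<^sup>2)" using sb \<theta> by simp
      moreover have "(pi - c0) / 2 * s\<^sup>2 = - ((c0 - pi) * s\<^sup>2) / 2" by (simp add: algebra_simps)
      ultimately show ?thesis using up(2) \<rho>3(2) by simp
    next
      fix i assume i: "i \<in> B" "\<bar>b i\<bar> = \<rho>"
      have "\<rho>\<^sup>2 \<le> (\<Sum>i\<in>B. (b i)\<^sup>2)" using member_le_sum[of i B "\<lambda>i. (b i)\<^sup>2"] i(1) fB by (simp add: i(2)[symmetric])
      then have "\<theta> * \<rho>\<^sup>2 \<le> \<theta> * (\<Sum>i\<in>B. (b i)\<^sup>2)" using \<theta> by (intro mult_left_mono) auto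
      moreover have "(pi - c0) / 2 * s\<^sup>2 \<le> 0" using c0 by (intro mult_nonpos_nonneg) auto
      ultimately show ?thesis using up(2) \<rho>3(1) by linarith
    qed
  next
    show "0 < \<alpha>" "\<alpha> < \<rho>" "0 < \<alpha>\<^sup>2 / 2" using \<alpha> \<rho>1 by auto
    show "\<bar>zc i\<bar> < \<rho>" if "i \<in> B" for i
    proof -
      obtain s k v where skv: "i = (s, k, v)" by (cases i)
      have "\<bar>zc i\<bar> \<le> norm x0"
      proof (cases "\<not> s \<and> k = 0 \<and> v \<in> Bs")
        case True
        then have "norm v = 1" using orth[of v v] by (simp add: norm_eq_1)
        then show ?thesis using Cauchy_Schwarz_ineq2[of x0 v] True by (simp add: zc_def skv)
      qed (auto simp: zc_def skv)
      then show ?thesis using \<rho>1 by linarith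
    qed
  next
    fix x :: "bool \<times> nat \<times> 'a \<Rightarrow> real" assume "\<forall>i. i \<notin> I \<longrightarrow> x i = 0" "\<forall>i\<in>B. x i = zc i" "D x = \<alpha>"
    then show "\<alpha>\<^sup>2 / 2 \<le> \<Phi> x" by (intro link) (auto simp: supp_def)
  next
    fix x :: "bool \<times> nat \<times> 'a \<Rightarrow> real" and i assume x: "\<forall>i. i \<notin> I \<longrightarrow> x i = 0" and g: "sqrt (\<Sum>i\<in>I. (g x i)\<^sup>2) \<le> 1"
    have "\<delta> * nm x \<le> 1 + M / 2" using coercive[of x, unfolded supp_def, OF x] g by linarith
    then have "nm x \<le> K" using \<delta> by (simp add: K_def pos_le_divide_eq mult.commute)
    moreover have "\<bar>x i\<bar> \<le> nm x"
    proof (cases "i \<in> I")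
      case True
      then show ?thesis using member_le_sum[of i I "\<lambda>i. (x i)\<^sup>2"] finI by (auto simp: nm_def intro!: real_le_rsqrt)
    next
      case False
      then have "x i = 0" using x by blast
      then show ?thesis using nm_nonneg by simp
    qed
    ultimately show "\<bar>x i\<bar> \<le> K" by linarith
  qed
  then show thesis using that[of x] by (simp add: supp_def)
qed

end

section \<open>From critical points to a symplectic Euler scheme\<close>

lemma periodic_int_multiple:
  fixes f :: "int \<Rightarrow> 'b" and P m :: int
  assumes per: "\<And>j. f (j + P) = f j"
  shows "f (j + P * m) = f j"
proof (induction m arbitrary: j rule: int_induct[where k=0])
  case base
  show ?case by simp
next
  case (step1 m)
  have "f (j + P * (m + 1)) = f ((j + P * m) + P)" by (simp add: algebra_simps)
  then show ?case using per step1 by simp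
next
  case (step2 m)
  have "f (j + P * m) = f ((j + P * (m - 1)) + P)" by (simp add: algebra_simps)
  then show ?case using per step2 by simp
qed

lemma sum_residue:
  fixes f :: "int \<Rightarrow> real" and N :: nat
  assumes N: "N > 0" and per: "\<And>j. f (j + 2 * int N) = f j"
  shows "(\<Sum>l<2*N. f (int l) * (if 2 * int N dvd int l - j then 1 else 0)) = f j"
proof -
  define l0 where "l0 = nat (j mod (2 * int N))"
  have l0: "int l0 = j mod (2 * int N)" "l0 < 2 * N"
    using N pos_mod_bound[of "2 * int N" j] by (auto simp: l0_def nat_less_iff)
  have iff: "2 * int N dvd int l - j \<longleftrightarrow> l = l0" if "l < 2 * N" for l
  proof -
    have "2 * int N dvd int l - j \<longleftrightarrow> int l mod (2 * int N) = j mod (2 * int N)"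
      by (rule mod_eq_dvd_iff[symmetric])
    also have "int l mod (2 * int N) = int l" using that by simp
    finally show ?thesis using l0(1) by linarith
  qed
  have "(\<Sum>l<2*N. f (int l) * (if 2 * int N dvd int l - j then 1 else 0)) = (\<Sum>l<2*N. if l = l0 then f (int l0) else 0)"
    by (intro sum.cong refl) (use iff in auto)
  also have "\<dots> = f (int l0)" using l0 by simp
  also have "\<dots> = f (int l0 + 2 * int N * (j div (2 * int N)))"
    by (rule periodic_int_multiple[of f, OF per, symmetric])
  also have "\<dots> = f j" by (simp add: l0(1))
  finally show ?thesis .
qed

context ham_disc begin

lemma DH_even: "DH (q, - p) = (fst (DH (q, p)), - snd (DH (q, p)))"
proof -
  define t where "t z = (fst z, - snd z)" for z :: "'a \<times> 'a"
  have tl: "(t has_derivative t) (at z)" for z unfolding t_def by (auto intro!: derivative_eq_intros)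
  have "((\<lambda>z. Hb (t z)) has_derivative (\<lambda>w. DH (t (q,p)) \<bullet> t w)) (at (q,p))"
    by (rule has_derivative_compose[OF tl deriv])
  moreover have "(\<lambda>z. Hb (t z)) = Hb" using even by (auto simp: t_def)
  ultimately have "(\<lambda>w. DH (t (q,p)) \<bullet> t w) = (\<lambda>w. DH (q,p) \<bullet> w)"
    using deriv has_derivative_unique by metis
  then have "DH (t (q,p)) \<bullet> t (t w) = DH (q,p) \<bullet> t w" for w by metis
  then have "DH (t (q,p)) \<bullet> w = t (DH (q,p)) \<bullet> w" for w
    by (simp add: t_def inner_prod_def)
  then have "DH (t (q,p)) = t (DH (q,p))" by (metis vector_eq_rdot)
  then show ?thesis by (simp add: t_def)
qed

lemma Z_periodic: "Z x (j + 2 * int N) = Z x j"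
  by (simp add: Z_def cs_periodic[OF N0(1)] sn_periodic[OF N0(1)])

text \<open>Since \<open>q\<close> sits at half-integers and \<open>p\<close> at integers, time
  reversal sends the index j to -1 - j in the one and to -j in the other. The mixed points (q_j,
  p_(j+1)) of the scheme arise from this offset.\<close>

lemma Z_reflect: "Z x (- 1 - j) = (fst (Z x j), - snd (Z x (j + 1)))"
proof -
  have "sn N k (- 1 - j) = - sn N k (j + 1)" for k using sn_reflect[of N k "j + 1"] by (simp add: algebra_simps)
  then show ?thesis by (simp add: Z_def cs_reflect sum_negf[symmetric] scaleR_minus_left[symmetric] del: scaleR_minus_left)
qed

lemma Z_reflect': "Z x (- j) = (fst (Z x (j - 1)), - snd (Z x j))"
  using Z_reflect[of x "j - 1"] by simp

text \<open>Adding and subtracting the equations for the two senses of rotation decouples them: sine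
  coefficients of \<open>p\<close> are driven by cosine coefficients of the
  \<open>q\<close>-gradient, and conversely. The constant mode yields the vanishing mean.\<close>

lemma critical_modes:
  assumes crit: "\<forall>i\<in>I. g x i = 0" and v: "v \<in> Bs"
  shows "(\<Sum>l<2*N. fst (DH (Z x (int l))) \<bullet> v) = 0"
    and "1 \<le> k \<Longrightarrow> k < N \<Longrightarrow> 2 * N * sin (pi * k / (2 * N)) * (x (True,k,v) - x (False,k,v)) = 2 * w * (\<Sum>l<2*N. (fst (DH (Z x (int l))) \<bullet> v) * cs N k (int l))"
    and "1 \<le> k \<Longrightarrow> k < N \<Longrightarrow> 2 * N * sin (pi * k / (2 * N)) * (x (True,k,v) + x (False,k,v)) = 2 * w * (\<Sum>l<2*N. (snd (DH (Z x (int l))) \<bullet> v) * sn N k (int l))"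
proof -
  have "(False, 0, v) \<in> I" using v N0 by (simp add: I_def)
  then have "g x (False, 0, v) = 0" using crit by blast
  then show "(\<Sum>l<2*N. fst (DH (Z x (int l))) \<bullet> v) = 0"
    using w(1) by (simp add: g_def lam_def \<zeta>_def inner_prod_def)
next
  assume k: "1 \<le> k" "k < N"
  define Q P where "Q = (\<Sum>l<2*N. (fst (DH (Z x (int l))) \<bullet> v) * cs N k (int l))"
    and "P = (\<Sum>l<2*N. (snd (DH (Z x (int l))) \<bullet> v) * sn N k (int l))"
  have "(s, k, v) \<in> I" for s using v k by (simp add: I_def)
  then have "g x (True, k, v) = 0" "g x (False, k, v) = 0" using crit by blast+
  moreover have "(\<Sum>l<2*N. DH (Z x (int l)) \<bullet> \<zeta> (int l) (True,k,v)) = Q + P"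
    "(\<Sum>l<2*N. DH (Z x (int l)) \<bullet> \<zeta> (int l) (False,k,v)) = Q - P"
    by (simp_all add: Q_def P_def \<zeta>_def inner_prod_def sum.distrib sum_subtractf mult.commute)
  ultimately have "2 * (N * sin (pi * k / (2 * N))) * x (True, k, v) = w * (Q + P)"
    "- (2 * (N * sin (pi * k / (2 * N))) * x (False, k, v)) = w * (Q - P)"
    by (simp_all add: g_def lam_def)
  then show "2 * N * sin (pi * k / (2 * N)) * (x (True,k,v) - x (False,k,v)) = 2 * w * Q"
    "2 * N * sin (pi * k / (2 * N)) * (x (True,k,v) + x (False,k,v)) = 2 * w * P"
    by (simp_all add: algebra_simps)
qed

text \<open>Differencing the sines gives a cosine series whose coefficients are those of the
  gradient, and completeness resums it to point values at j and -1 - j. By reflection and evenness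
  the mirror value is the gradient at (q_j, p_(j+1)).\<close>

lemma euler_p:
  assumes x: "supp x" and crit: "\<forall>i\<in>I. g x i = 0"
  shows "snd (Z x (j + 1)) - snd (Z x j) = w *\<^sub>R (fst (DH (Z x j)) + fst (DH (fst (Z x j), snd (Z x (j + 1)))))"
proof (rule eq_basisI)
  fix v assume v: "v \<in> Bs"
  define h where "h l = fst (DH (Z x l)) \<bullet> v" for l
  note cm = critical_modes[OF crit v, folded h_def]
  have ks: "(\<Sum>k<N. f k) = (\<Sum>k=1..<N. f k)" if "f 0 = 0" for f :: "nat \<Rightarrow> real"
    by (rule sum.mono_neutral_right) (use that in \<open>auto simp: Suc_le_eq\<close>)
  have hp: "h (i + 2 * int N) = h i" for i by (simp add: h_def Z_periodic)
  have "(snd (Z x (j + 1)) - snd (Z x j)) \<bullet> v = (\<Sum>k<N. (x (True,k,v) - x (False,k,v)) * (sn N k (j + 1) - sn N k j))"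
    using v by (simp add: inner_diff_left Z_inner sum_subtractf[symmetric] algebra_simps)
  also have "\<dots> = (\<Sum>k=1..<N. (x (True,k,v) - x (False,k,v)) * (2 * sin (pi * k / (2 * N)) * cs N k j))"
    unfolding sn_diff by (rule ks) simp
  finally have "N * ((snd (Z x (j + 1)) - snd (Z x j)) \<bullet> v) = (\<Sum>k=1..<N. (2 * N * sin (pi * k / (2 * N)) * (x (True,k,v) - x (False,k,v))) * cs N k j)"
    by (simp add: sum_distrib_left mult_ac)
  also have "\<dots> = (\<Sum>k=1..<N. (2 * w * (\<Sum>l<2*N. h (int l) * cs N k (int l))) * cs N k j)"
    by (intro sum.cong refl) (subst cm(2), auto)
  also have "\<dots> = (\<Sum>k=1..<N. \<Sum>l<2*N. w * h (int l) * (2 * (cs N k (int l) * cs N k j)))"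
    by (simp add: sum_distrib_left sum_distrib_right mult_ac)
  also have "\<dots> = (\<Sum>l<2*N. w * h (int l) * (2 * (\<Sum>k=1..<N. cs N k (int l) * cs N k j)))"
    unfolding sum_distrib_left by (rule sum.swap)
  also have "\<dots> = (\<Sum>l<2*N. w * h (int l) * (N * ((if 2 * int N dvd int l - j then (1::real) else 0) + (if 2 * int N dvd int l - (- 1 - j) then (1::real) else 0)) - 1))"
  proof (rule sum.cong[OF refl], rule arg_cong2[where f="(*)", OF refl])
    fix l
    have e: "int l - (- 1 - j) = int l + j + 1" by simp
    show "2 * (\<Sum>k=1..<N. cs N k (int l) * cs N k j) = N * ((if 2 * int N dvd int l - j then (1::real) else 0) + (if 2 * int N dvd int l - (- 1 - j) then (1::real) else 0)) - 1"
      unfolding e using cs_complete[OF N0(1), of "int l" j] by linarith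
  qed
  also have "\<dots> = w * N * ((\<Sum>l<2*N. h (int l) * (if 2 * int N dvd int l - j then (1::real) else 0)) + (\<Sum>l<2*N. h (int l) * (if 2 * int N dvd int l - (- 1 - j) then (1::real) else 0))) - w * (\<Sum>l<2*N. h (int l))"
    unfolding sum_distrib_left sum.distrib[symmetric] sum_subtractf[symmetric] by (intro sum.cong refl) (simp add: algebra_simps)
  \<comment> \<open>The sum over k \<ge> 1 lacks the constant mode; the correction is the sum of
    \<open>h\<close>, which vanishes by the equation of that mode.\<close>
  also have "\<dots> = w * N * (h j + h (- 1 - j))"
    unfolding sum_residue[of N h, OF N0(1) hp] cm(1) by simp
  finally have "(snd (Z x (j + 1)) - snd (Z x j)) \<bullet> v = w * (h j + h (- 1 - j))" using N0 by simp
  then show "(snd (Z x (j + 1)) - snd (Z x j)) \<bullet> v = (w *\<^sub>R (fst (DH (Z x j)) + fst (DH (fst (Z x j), snd (Z x (j + 1)))))) \<bullet> v"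
    by (simp add: h_def Z_reflect DH_even inner_add_left)
qed

text \<open>Here the minus sign of the sine kernel is undone by the oddness of the
  \<open>p\<close>-gradient in \<open>p\<close>.\<close>

lemma euler_q:
  assumes x: "supp x" and crit: "\<forall>i\<in>I. g x i = 0"
  shows "fst (Z x (j - 1)) - fst (Z x j) = w *\<^sub>R (snd (DH (Z x j)) + snd (DH (fst (Z x (j - 1)), snd (Z x j))))"
proof (rule eq_basisI)
  fix v assume v: "v \<in> Bs"
  define h where "h l = snd (DH (Z x l)) \<bullet> v" for l
  note cm = critical_modes[OF crit v, folded h_def]
  have ks: "(\<Sum>k<N. f k) = (\<Sum>k=1..<N. f k)" if "f 0 = 0" for f :: "nat \<Rightarrow> real"
    by (rule sum.mono_neutral_right) (use that in \<open>auto simp: Suc_le_eq\<close>)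
  have hp: "h (i + 2 * int N) = h i" for i by (simp add: h_def Z_periodic)
  have "(fst (Z x (j - 1)) - fst (Z x j)) \<bullet> v = (\<Sum>k<N. (x (True,k,v) + x (False,k,v)) * (cs N k (j - 1) - cs N k j))"
    using v by (simp add: inner_diff_left Z_inner sum_subtractf[symmetric] algebra_simps)
  also have "\<dots> = (\<Sum>k=1..<N. (x (True,k,v) + x (False,k,v)) * (2 * sin (pi * k / (2 * N)) * sn N k j))"
    unfolding cs_diff by (rule ks) simp
  finally have "N * ((fst (Z x (j - 1)) - fst (Z x j)) \<bullet> v) = (\<Sum>k=1..<N. (2 * N * sin (pi * k / (2 * N)) * (x (True,k,v) + x (False,k,v))) * sn N k j)"
    by (simp add: sum_distrib_left mult_ac)
  also have "\<dots> = (\<Sum>k=1..<N. (2 * w * (\<Sum>l<2*N. h (int l) * sn N k (int l))) * sn N k j)"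
    by (intro sum.cong refl) (subst cm(3), auto)
  also have "\<dots> = (\<Sum>k=1..<N. \<Sum>l<2*N. w * h (int l) * (2 * (sn N k (int l) * sn N k j)))"
    by (simp add: sum_distrib_left sum_distrib_right mult_ac)
  also have "\<dots> = (\<Sum>l<2*N. w * h (int l) * (2 * (\<Sum>k=1..<N. sn N k (int l) * sn N k j)))"
    unfolding sum_distrib_left by (rule sum.swap)
  also have "\<dots> = (\<Sum>l<2*N. w * h (int l) * (N * ((if 2 * int N dvd int l - j then (1::real) else 0) - (if 2 * int N dvd int l - (- j) then (1::real) else 0))))"
  proof (rule sum.cong[OF refl], rule arg_cong2[where f="(*)", OF refl])
    fix l
    have e: "int l - (- j) = int l + j" by simp
    show "2 * (\<Sum>k=1..<N. sn N k (int l) * sn N k j) = N * ((if 2 * int N dvd int l - j then (1::real) else 0) - (if 2 * int N dvd int l - (- j) then (1::real) else 0))"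
      unfolding e using sn_complete[OF N0(1), of "int l" j] by linarith
  qed
  also have "\<dots> = w * N * ((\<Sum>l<2*N. h (int l) * (if 2 * int N dvd int l - j then (1::real) else 0)) - (\<Sum>l<2*N. h (int l) * (if 2 * int N dvd int l - (- j) then (1::real) else 0)))"
    unfolding right_diff_distrib sum_distrib_left sum_subtractf[symmetric] by (intro sum.cong refl) (simp add: algebra_simps)
  also have "\<dots> = w * N * (h j - h (- j))"
    unfolding sum_residue[of N h, OF N0(1) hp] by simp
  finally have "(fst (Z x (j - 1)) - fst (Z x j)) \<bullet> v = w * (h j - h (- j))" using N0 by simp
  then show "(fst (Z x (j - 1)) - fst (Z x j)) \<bullet> v = (w *\<^sub>R (snd (DH (Z x j)) + snd (DH (fst (Z x (j - 1)), snd (Z x j))))) \<bullet> v"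
    by (simp add: h_def Z_reflect' DH_even inner_add_left)
qed

text \<open>All recorded bounds are free of \<open>N\<close>. The last one replaces the action level
  by a value at a single sample, which passes to the limit and later separates the orbit from
  equilibria and from the region of the extension.\<close>

theorem discrete_solution:
  obtains z :: "int \<Rightarrow> 'a \<times> 'a" where
    "\<And>j. snd (z (j + 1)) - snd (z j) = (1 / (4 * real N)) *\<^sub>R (fst (DH (z j)) + fst (DH (fst (z j), snd (z (j + 1)))))"
    "\<And>j. fst (z (j - 1)) - fst (z j) = (1 / (4 * real N)) *\<^sub>R (snd (DH (z j)) + snd (DH (fst (z (j - 1)), snd (z j))))"
    "\<And>j. z (j + 2 * int N) = z j"
    "\<And>j. z (- j) = (fst (z (j - 1)), - snd (z j))"
    "(\<Sum>j<2*N. (norm (z (int j)))\<^sup>2) \<le> 2 * real N * (M / min \<theta> (min (c0 - pi) (1/2)))\<^sup>2"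
    "\<exists>j<2*N. 1 / (8 * (card Bs * C4)) \<le> DH (z (int j)) \<bullet> z (int j) / 2 - Hb (z (int j))"
proof -
  obtain x where x: "supp x" and \<Phi>x: "\<alpha>\<^sup>2 / 4 \<le> \<Phi> x" and crit: "\<forall>i\<in>I. g x i = 0" by (rule critical_exists)
  have "\<delta> * nm x \<le> M / 2" using coercive[OF x] crit by simp
  also have "\<dots> \<le> M" using M0 by simp
  finally have "nm x \<le> M / \<delta>" using \<delta> by (simp add: pos_le_divide_eq mult.commute)
  then have nb: "(nm x)\<^sup>2 \<le> (M / \<delta>)\<^sup>2" using nm_nonneg by (rule power_mono)
  define \<psi> where "\<psi> j = DH (Z x (int j)) \<bullet> Z x (int j) / 2 - Hb (Z x (int j))" for j
  \<comment> \<open>The gradient tested against \<open>x\<close> itself. At a critical point \<Phi>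
    becomes a sum of \<psi> with total weight 1/2, so some sample carries at least twice the
    level.\<close>
  have "0 = 2 * (\<Sum>i\<in>I. lam i * x i * x i) - w * (\<Sum>j<2*N. DH (Z x (int j)) \<bullet> Z x (int j))"
    using sum_inner_zeta[OF x, of x] crit by simp
  then have "\<Phi> x = w * (\<Sum>j<2*N. \<psi> j)"
    by (simp add: \<Phi>_def \<psi>_def power2_eq_square sum_subtractf right_diff_distrib sum_divide_distrib[symmetric] mult.assoc)
  moreover have al: "\<alpha>\<^sup>2 = 1 / (4 * (card Bs * C4))" using C4 card0 by (simp add: \<alpha>_def power_divide power_mult_distrib)
  have "\<exists>j<2*N. \<alpha>\<^sup>2 / 2 \<le> \<psi> j"
  proof (rule ccontr)
    assume "\<not> ?thesis"
    then have "(\<Sum>j<2*N. \<psi> j) < (\<Sum>j<2*N. \<alpha>\<^sup>2 / 2)" using N0 by (intro sum_strict_mono) (auto simp: not_le lessThan_empty_iff)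
    then have "w * (\<Sum>j<2*N. \<psi> j) < w * (\<Sum>j<2*N. \<alpha>\<^sup>2 / 2)" using w(1) by simp
    also have "\<dots> = (w * real (2 * N)) * (\<alpha>\<^sup>2 / 2)" by simp
    also have "\<dots> = \<alpha>\<^sup>2 / 4" unfolding w2 by simp
    finally show False using \<Phi>x \<open>\<Phi> x = w * (\<Sum>j<2*N. \<psi> j)\<close> by linarith
  qed
  moreover have "\<alpha>\<^sup>2 / 2 = 1 / (8 * (card Bs * C4))" by (simp add: al)
  ultimately have ex: "\<exists>j<2*N. 1 / (8 * (card Bs * C4)) \<le> \<psi> j" by simp
  show thesis
  proof (rule that[of "Z x"])
    show "(\<Sum>j<2*N. (norm (Z x (int j)))\<^sup>2) \<le> 2 * real N * (M / min \<theta> (min (c0 - pi) (1/2)))\<^sup>2"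
      unfolding parseval_norm[OF x] using nb by (simp add: \<delta>_def mult_left_mono)
  qed (use euler_p[OF x crit] euler_q[OF x crit] ex in \<open>auto simp: w_def \<psi>_def Z_periodic Z_reflect'\<close>)
qed

end

subsection \<open>Passage to the continuous limit\<close>

text \<open>Arzela-Ascoli for step functions, whose jumps are allowed for by \<epsilon>: a diagonal
  sequence converges at rational times, and the Lipschitz bound carries convergence to the
  others.\<close>

lemma almost_lipschitz_subsequence:
  fixes f :: "nat \<Rightarrow> real \<Rightarrow> 'b::{real_normed_vector,heine_borel,complete_space}"
  assumes bnd: "\<And>n t. norm (f n t) \<le> S" and L: "0 \<le> L"
    and lip: "\<And>n s t. dist (f n s) (f n t) \<le> L * \<bar>s - t\<bar> + \<epsilon> n" and \<epsilon>: "\<epsilon> \<longlonglongrightarrow> 0"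
  obtains k X where "strict_mono (k :: nat \<Rightarrow> nat)" "\<And>t. (\<lambda>n. f (k n) t) \<longlonglongrightarrow> X t"
proof -
  obtain k where k: "strict_mono (k::nat\<Rightarrow>nat)" "\<And>t. t \<in> \<rat> \<Longrightarrow> \<exists>l. (\<lambda>n. f (k n) t) \<longlonglongrightarrow> l"
    using function_convergent_subsequence[of "\<rat>" f S] bnd countable_rat by blast
  have ek: "(\<lambda>n. \<epsilon> (k n)) \<longlonglongrightarrow> 0" using LIMSEQ_subseq_LIMSEQ[OF \<epsilon> k(1)] by (simp add: o_def)
  have "\<exists>l. (\<lambda>n. f (k n) t) \<longlonglongrightarrow> l" for t
  proof -
    have "Cauchy (\<lambda>n. f (k n) t)"
    proof (rule metric_CauchyI)
      fix e :: real assume e: "0 < e"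
      have "0 < e / (8 * (L + 1))" using e L by simp
      then obtain r where r: "r \<in> \<rat>" "t < r" "r < t + e / (8 * (L + 1))"
        using Rats_dense_in_real[of t "t + e / (8 * (L + 1))"] by auto
      have "\<bar>t - r\<bar> \<le> e / (8 * (L + 1))" using r by simp
      then have "L * \<bar>t - r\<bar> \<le> (L + 1) * (e / (8 * (L + 1)))" using L by (intro mult_mono) auto
      also have "\<dots> = e / 8" using L by (simp add: divide_simps)
      finally have Lr: "L * \<bar>t - r\<bar> \<le> e / 8" .
      have "Cauchy (\<lambda>n. f (k n) r)" using k(2)[OF r(1)] LIMSEQ_imp_Cauchy by blast
      then obtain M1 where M1: "\<And>m n. m \<ge> M1 \<Longrightarrow> n \<ge> M1 \<Longrightarrow> dist (f (k m) r) (f (k n) r) < e / 4"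
        using e metric_CauchyD[of _ "e/4"] by (metis divide_pos_pos zero_less_numeral)
      obtain M2 where M2: "\<And>n. n \<ge> M2 \<Longrightarrow> \<bar>\<epsilon> (k n)\<bar> < e / 8"
        using LIMSEQ_D[OF ek, of "e/8"] e by auto
      show "\<exists>M. \<forall>m\<ge>M. \<forall>n\<ge>M. dist (f (k m) t) (f (k n) t) < e"
      proof (intro exI[of _ "max M1 M2"] allI impI)
        fix m n assume mn: "max M1 M2 \<le> m" "max M1 M2 \<le> n"
        have "dist (f (k m) t) (f (k m) r) \<le> e / 8 + e / 8" using lip[of "k m" t r] Lr M2[of m] mn by auto
        moreover have "dist (f (k n) t) (f (k n) r) \<le> e / 8 + e / 8" using lip[of "k n" t r] Lr M2[of n] mn by auto
        moreover have "dist (f (k m) r) (f (k n) r) < e / 4" using M1 mn by simp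
        moreover have "dist (f (k m) t) (f (k n) t) \<le> dist (f (k m) t) (f (k m) r) + (dist (f (k m) r) (f (k n) r) + dist (f (k n) t) (f (k n) r))"
          using dist_triangle[of "f (k m) t" "f (k n) t" "f (k m) r"] dist_triangle[of "f (k m) r" "f (k n) t" "f (k n) r"]
          by (simp add: dist_commute)
        ultimately show "dist (f (k m) t) (f (k n) t) < e" using e by linarith
      qed
    qed
    then show ?thesis by (simp add: Cauchy_convergent_iff convergent_def)
  qed
  then obtain X where "\<And>t. (\<lambda>n. f (k n) t) \<longlonglongrightarrow> X t" by metis
  then show thesis using that k(1) by blast
qed

text \<open>The rotation with \<open>omega0 (sympl d) v = - (d \<bullet> v)\<close>, hence the map
  from gradients to Hamiltonian vector fields.\<close>

definition sympl :: "'a \<times> 'a \<Rightarrow> 'a::real_normed_vector \<times> 'a" where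
  "sympl z = (- snd z, fst z)"

section \<open>A priori bounds for the Euler scheme\<close>

lemma norm_pair_le: "norm (z :: 'a::real_normed_vector \<times> 'b::real_normed_vector) \<le> norm (fst z) + norm (snd z)"
  by (cases z) (simp add: norm_Pair sqrt_sum_squares_le_sum)

lemma norm_fst_snd_le: "norm (fst z) \<le> norm z" "norm (snd z) \<le> norm z" for z :: "'a::real_normed_vector \<times> 'b::real_normed_vector"
  by (cases z; simp add: norm_fst_le norm_snd_le)+

locale euler_scheme =
  fixes DH :: "'a::euclidean_space \<times> 'a \<Rightarrow> 'a \<times> 'a" and z :: "int \<Rightarrow> 'a \<times> 'a" and N :: nat and C K :: real
  assumes N: "N > 0" and C: "C \<ge> 0" and K: "K \<ge> 0"
    and growth: "\<And>y. norm (DH y) \<le> C * (1 + norm y)"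
    and P: "\<And>j. snd (z (j + 1)) - snd (z j) = (1 / (4 * real N)) *\<^sub>R (fst (DH (z j)) + fst (DH (fst (z j), snd (z (j + 1)))))"
    and Q: "\<And>j. fst (z (j - 1)) - fst (z j) = (1 / (4 * real N)) *\<^sub>R (snd (DH (z j)) + snd (DH (fst (z (j - 1)), snd (z j))))"
    and per: "\<And>j. z (j + 2 * int N) = z j"
    and refl: "\<And>j. z (- j) = (fst (z (j - 1)), - snd (z j))"
    and l2: "(\<Sum>j<2*N. (norm (z (int j)))\<^sup>2) \<le> 2 * real N * K\<^sup>2"
begin

text \<open>\<open>K\<close> bounds some sample, and C (2 + 3 K) the total variation over a period.
  \<open>L\<close> bounds \<open>N\<close> times a single step once all samples lie within
  \<open>S\<close>.\<close>

definition "S = K + C * (2 + 3 * K)"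
definition "L = C * (4 + 6 * S) / 4"

lemma S0: "0 \<le> S" using C K by (simp add: S_def)
lemma L0: "0 \<le> L" using C S0 by (simp add: L_def)

lemma Q': "fst (z j) - fst (z (j + 1)) = (1 / (4 * real N)) *\<^sub>R (snd (DH (z (j + 1))) + snd (DH (fst (z j), snd (z (j + 1)))))"
  using Q[of "j + 1"] by simp

lemma step_le: "norm (z (j + 1) - z j) \<le> C / (4 * N) * (4 + 3 * norm (z j) + 3 * norm (z (j + 1)))"
proof -
  let ?y = "(fst (z j), snd (z (j + 1)))"
  have y: "norm ?y \<le> norm (z j) + norm (z (j + 1))"
    using norm_pair_le[of ?y] norm_fst_snd_le(1)[of "z j"] norm_fst_snd_le(2)[of "z (j+1)"] by simp
  have D: "norm (DH ?y) \<le> C * (1 + (norm (z j) + norm (z (j + 1))))"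
    using growth[of ?y] mult_left_mono[OF _ C, of "1 + norm ?y" "1 + (norm (z j) + norm (z (j + 1)))"] y by simp
  have N4: "0 \<le> 1 / (4 * real N)" by simp
  have "norm (snd (z (j + 1)) - snd (z j)) \<le> (1 / (4 * real N)) * (norm (DH (z j)) + norm (DH ?y))"
    unfolding P norm_scaleR abs_of_nonneg[OF N4]
    by (intro mult_left_mono order_trans[OF norm_triangle_ineq] add_mono norm_fst_snd_le) simp
  also have "\<dots> \<le> (1 / (4 * real N)) * (C * (1 + norm (z j)) + C * (1 + (norm (z j) + norm (z (j + 1)))))"
    by (intro mult_left_mono add_mono growth D) simp
  finally have 1: "norm (snd (z (j + 1)) - snd (z j)) \<le> (1 / (4 * real N)) * (C * (1 + norm (z j)) + C * (1 + (norm (z j) + norm (z (j + 1)))))" .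
  have "norm (fst (z j) - fst (z (j + 1))) \<le> (1 / (4 * real N)) * (norm (DH (z (j + 1))) + norm (DH ?y))"
    unfolding Q' norm_scaleR abs_of_nonneg[OF N4]
    by (intro mult_left_mono order_trans[OF norm_triangle_ineq] add_mono norm_fst_snd_le) simp
  also have "\<dots> \<le> (1 / (4 * real N)) * (C * (1 + norm (z (j + 1))) + C * (1 + (norm (z j) + norm (z (j + 1)))))"
    by (intro mult_left_mono add_mono growth D) simp
  finally have 2: "norm (fst (z j) - fst (z (j + 1))) \<le> (1 / (4 * real N)) * (C * (1 + norm (z (j + 1))) + C * (1 + (norm (z j) + norm (z (j + 1)))))" .
  have "norm (z (j + 1) - z j) \<le> norm (fst (z j) - fst (z (j + 1))) + norm (snd (z (j + 1)) - snd (z j))"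
    using norm_pair_le[of "z (j + 1) - z j"] by (simp add: norm_minus_commute)
  also have "\<dots> \<le> (1 / (4 * real N)) * (C * (1 + norm (z (j + 1))) + C * (1 + (norm (z j) + norm (z (j + 1)))))
      + (1 / (4 * real N)) * (C * (1 + norm (z j)) + C * (1 + (norm (z j) + norm (z (j + 1)))))"
    by (rule add_mono[OF 2 1])
  also have "\<dots> = C / (4 * N) * (4 + 3 * norm (z j) + 3 * norm (z (j + 1)))"
  proof -
    have "w * (C * (1 + b) + C * (1 + (a + b))) + w * (C * (1 + a) + C * (1 + (a + b))) = w * C * (4 + 3 * a + 3 * b)"
      for w a b :: real by (simp add: algebra_simps)
    from this[of "1 / (4 * real N)"] show ?thesis by simp
  qed
  finally show ?thesis .
qed

lemma per_mod: "z j = z (int (nat (j mod (2 * int N))))"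
proof -
  have "0 \<le> j mod (2 * int N)" using N by simp
  then have "int (nat (j mod (2 * int N))) = j mod (2 * int N)" by simp
  moreover have "z (j mod (2 * int N) + 2 * int N * (j div (2 * int N))) = z (j mod (2 * int N))"
    by (rule periodic_int_multiple[of z, OF per])
  ultimately show ?thesis by simp
qed

text \<open>The mean square bound yields one sample of size at most \<open>K\<close>. Summing
  \<open>step_le\<close> over a period estimates the total variation by the mean of the norms, so
  the other samples cannot be far from that one.\<close>

lemma norm_z: "norm (z j) \<le> S"
proof -
  have main: "norm (z (int j)) \<le> S" if j: "j < 2 * N" for j
  proof -
    have "(\<Sum>j<2*N. norm (z (int j)))\<^sup>2 \<le> (\<Sum>j<2*N. (norm (z (int j)))\<^sup>2) * card {..<2*N}"
      by (rule sum_squared_le_sum_of_squares)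
    also have "\<dots> \<le> (2 * real N * K\<^sup>2) * card {..<2*N}" by (intro mult_right_mono l2) simp
    also have "\<dots> = (2 * real N * K)\<^sup>2" by (simp add: power2_eq_square)
    finally have s1: "(\<Sum>j<2*N. norm (z (int j))) \<le> 2 * real N * K"
      by (rule power2_le_imp_le) (use K in simp)
    obtain j0 where j0: "j0 < 2 * N" "norm (z (int j0)) \<le> K"
    proof (rule ccontr)
      assume "\<not> thesis"
      then have "K < norm (z (int j))" if "j < 2 * N" for j using that not_le \<open>\<not> thesis\<close> \<open>\<And>j0. j0 < 2 * N \<Longrightarrow> norm (z (int j0)) \<le> K \<Longrightarrow> thesis\<close> by blast
      then have "(\<Sum>j<2*N. K) < (\<Sum>j<2*N. norm (z (int j)))"
        using N by (intro sum_strict_mono) (auto simp: lessThan_empty_iff)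
      then show False using s1 by simp
    qed
    define d where "d i = norm (z (int i + 1) - z (int i))" for i :: nat
    have shift: "(\<Sum>i<2*N. norm (z (int i + 1))) = (\<Sum>i<2*N. norm (z (int i)))"
    proof -
      have "(\<Sum>i<2*N. norm (z (int (Suc i))) - norm (z (int i))) = norm (z (int (2 * N))) - norm (z (int 0))"
        by (rule sum_lessThan_telescope)
      also have "\<dots> = 0" using per[of 0] by simp
      finally show ?thesis by (simp add: sum_subtractf add.commute)
    qed
    have "(\<Sum>i<2*N. d i) \<le> (\<Sum>i<2*N. C / (4 * N) * (4 + 3 * norm (z (int i)) + 3 * norm (z (int i + 1))))"
      unfolding d_def by (intro sum_mono step_le)
    also have "\<dots> = C / (4 * N) * (8 * N + 6 * (\<Sum>i<2*N. norm (z (int i))))"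
      unfolding sum_distrib_left[symmetric] sum.distrib shift by simp
    also have "\<dots> \<le> C / (4 * N) * (8 * N + 6 * (2 * real N * K))"
      using C s1 by (intro mult_left_mono add_left_mono) auto
    also have "\<dots> = C * (2 + 3 * K)" using N by (simp add: field_simps)
    finally have tv: "(\<Sum>i<2*N. d i) \<le> C * (2 + 3 * K)" .
    have diff: "norm (z (int b) - z (int a)) \<le> (\<Sum>i<2*N. d i)" if "a \<le> b" "b \<le> 2 * N" for a b :: nat
    proof -
      have "z (int b) - z (int a) = (\<Sum>i=a..<b. z (int (Suc i)) - z (int i))"
        using sum_Suc_diff'[OF that(1), of "\<lambda>i. z (int i)"] by simp
      also have "norm \<dots> \<le> (\<Sum>i=a..<b. d i)" unfolding d_def by (intro sum_norm_le) (simp add: add.commute)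
      also have "\<dots> \<le> (\<Sum>i<2*N. d i)" using that by (intro sum_mono2) (auto simp: d_def)
      finally show ?thesis .
    qed
    have "norm (z (int j) - z (int j0)) \<le> (\<Sum>i<2*N. d i)"
      using diff[of j j0] diff[of j0 j] j j0(1) by (cases "j \<le> j0") (auto simp: norm_minus_commute)
    then show ?thesis
      using tv j0(2) norm_triangle_ineq2[of "z (int j)" "z (int j0)"] unfolding S_def by linarith
  qed
  show ?thesis unfolding per_mod[of j]
    by (rule main) (use N pos_mod_bound[of "2 * int N" j] in \<open>simp add: nat_less_iff\<close>)
qed

lemma step_bound: "norm (z (j + 1) - z j) \<le> L / N"
proof -
  have "norm (z (j + 1) - z j) \<le> C / (4 * N) * (4 + 3 * norm (z j) + 3 * norm (z (j + 1)))" by (rule step_le)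
  also have "\<dots> \<le> C / (4 * N) * (4 + 3 * S + 3 * S)"
    using C by (intro mult_left_mono add_mono norm_z order_refl) auto
  finally show ?thesis by (simp add: L_def add.commute)
qed

lemma diff_le: "a \<le> b \<Longrightarrow> norm (z b - z a) \<le> (b - a) * (L / N)"
proof (induction b rule: int_ge_induct)
  case (step b)
  have "norm (z (b + 1) - z a) \<le> norm (z (b + 1) - z b) + norm (z b - z a)"
    using norm_triangle_ineq[of "z (b + 1) - z b" "z b - z a"] by simp
  also have "\<dots> \<le> L / N + (b - a) * (L / N)" using step by (intro add_mono step_bound) auto
  finally show ?case by (simp add: algebra_simps add_divide_distrib diff_divide_distrib)
qed simp

lemma diff_abs_le: "norm (z b - z a) \<le> real_of_int \<bar>b - a\<bar> * (L / N)"
  using diff_le[of a b] diff_le[of b a] by (cases "a \<le> b") (auto simp: norm_minus_commute)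

definition X :: "real \<Rightarrow> 'a \<times> 'a" where "X t = z \<lfloor>2 * real N * t\<rfloor>"

lemma floor_diff: "\<bar>real_of_int \<lfloor>2 * real N * s\<rfloor> - real_of_int \<lfloor>2 * real N * t\<rfloor>\<bar> \<le> 2 * real N * \<bar>s - t\<bar> + 1"
proof -
  have "\<bar>2 * real N * s - 2 * real N * t\<bar> = 2 * real N * \<bar>s - t\<bar>" by (simp add: abs_mult right_diff_distrib[symmetric])
  then show ?thesis by linarith
qed

lemma X_dist: "dist (X s) (X t) \<le> 2 * L * \<bar>s - t\<bar> + L / N"
proof -
  have "dist (X s) (X t) \<le> \<bar>\<lfloor>2 * real N * s\<rfloor> - \<lfloor>2 * real N * t\<rfloor>\<bar> * (L / N)"
    unfolding X_def dist_norm by (rule diff_abs_le)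
  also have "\<dots> \<le> (2 * real N * \<bar>s - t\<bar> + 1) * (L / N)"
    using floor_diff[of s t] L0 by (intro mult_right_mono) auto
  also have "\<dots> = 2 * L * \<bar>s - t\<bar> + L / N" using N by (simp add: field_simps)
  finally show ?thesis .
qed

lemma X_periodic: "X (t + 1) = X t"
proof -
  have "2 * real N * (t + 1) = 2 * real N * t + of_int (2 * int N)" by (simp add: algebra_simps)
  then have "\<lfloor>2 * real N * (t + 1)\<rfloor> = \<lfloor>2 * real N * t\<rfloor> + 2 * int N" by (simp only: floor_add_int)
  then show ?thesis by (simp add: X_def per)
qed

text \<open>Reflection turns the floor into the ceiling, and the staggering shifts one index;
  together this moves each component by at most one grid step.\<close>

lemma X_reflect: "dist (X (- t)) (fst (X t), - snd (X t)) \<le> 2 * (L / N)"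
proof -
  define c where "c = \<lceil>2 * real N * t\<rceil>"
  define f where "f = \<lfloor>2 * real N * t\<rfloor>"
  have fc: "f = c \<or> f = c - 1" unfolding c_def f_def by linarith
  have "X (- t) = z (- c)" by (simp add: X_def c_def ceiling_def)
  then have Xm: "X (- t) = (fst (z (c - 1)), - snd (z c))" by (simp add: refl)
  have "norm (z (c - 1) - z f) \<le> \<bar>c - 1 - f\<bar> * (L / N)" "norm (z c - z f) \<le> \<bar>c - f\<bar> * (L / N)" by (rule diff_abs_le)+
  then have "norm (z (c - 1) - z f) \<le> L / N" "norm (z c - z f) \<le> L / N"
    using fc L0 by auto
  then have "norm (fst (z (c - 1)) - fst (z f)) \<le> L / N" "norm (snd (z c) - snd (z f)) \<le> L / N"
    using norm_fst_snd_le(1)[of "z (c - 1) - z f"] norm_fst_snd_le(2)[of "z c - z f"] by (auto simp: fst_diff snd_diff)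
  moreover have "X t = z f" by (simp add: X_def f_def)
  ultimately show ?thesis
    using norm_pair_le[of "X (- t) - (fst (X t), - snd (X t))"]
    by (simp add: dist_norm Xm norm_minus_commute)
qed

lemma one_step:
  assumes e: "\<And>y. norm (y - x) < \<eta> \<Longrightarrow> norm (DH y - DH x) \<le> e"
    and near: "norm (z j - x) < \<eta> / 2" "norm (z (j + 1) - x) < \<eta> / 2"
  shows "norm (z (j + 1) - z j - (1 / (2 * real N)) *\<^sub>R sympl (DH x)) \<le> e / N"
proof -
  let ?y = "(fst (z j), snd (z (j + 1)))"
  let ?w = "1 / (4 * real N)"
  have "norm (?y - x) \<le> norm (z j - x) + norm (z (j + 1) - x)"
    using norm_pair_le[of "?y - x"] norm_fst_snd_le(1)[of "z j - x"] norm_fst_snd_le(2)[of "z (j+1) - x"] by (simp add: fst_diff snd_diff)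
  then have y: "norm (DH ?y - DH x) \<le> e" using near by (intro e) simp
  have "0 < \<eta>" using near(1) norm_ge_zero[of "z j - x"] by linarith
  then have z: "norm (DH (z j) - DH x) \<le> e" "norm (DH (z (j + 1)) - DH x) \<le> e"
    using near by (auto intro!: e)
  have N4: "0 \<le> ?w" by simp
  have eqs: "snd (z (j + 1) - z j - (1 / (2 * real N)) *\<^sub>R sympl (DH x)) = ?w *\<^sub>R (fst (DH (z j) - DH x) + fst (DH ?y - DH x))"
  proof -
    have "(1 / (2 * real N)) *\<^sub>R fst (DH x) = ?w *\<^sub>R (fst (DH x) + fst (DH x))"
      using N by (simp add: scaleR_add_left[symmetric] scaleR_add_right)
    then show ?thesis using P[of j] by (simp add: sympl_def scaleR_add_right scaleR_diff_right)
  qed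
  have eqf: "fst (z (j + 1) - z j - (1 / (2 * real N)) *\<^sub>R sympl (DH x)) = - (?w *\<^sub>R (snd (DH (z (j + 1)) - DH x) + snd (DH ?y - DH x)))"
  proof -
    have "(1 / (2 * real N)) *\<^sub>R snd (DH x) = ?w *\<^sub>R (snd (DH x) + snd (DH x))"
      using N by (simp add: scaleR_add_left[symmetric] scaleR_add_right)
    then show ?thesis using Q'[of j] by (simp add: sympl_def scaleR_add_right scaleR_diff_right algebra_simps)
  qed
  have "norm (snd (z (j + 1) - z j - (1 / (2 * real N)) *\<^sub>R sympl (DH x))) \<le> ?w * (e + e)"
    unfolding eqs norm_scaleR abs_of_nonneg[OF N4]
    by (intro mult_left_mono order_trans[OF norm_triangle_ineq] add_mono order_trans[OF norm_fst_snd_le(1)] y z) simp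
  moreover have "norm (fst (z (j + 1) - z j - (1 / (2 * real N)) *\<^sub>R sympl (DH x))) \<le> ?w * (e + e)"
    unfolding eqf norm_minus_cancel norm_scaleR abs_of_nonneg[OF N4]
    by (intro mult_left_mono order_trans[OF norm_triangle_ineq] add_mono order_trans[OF norm_fst_snd_le(2)] y z) simp
  moreover have "?w * (e + e) + ?w * (e + e) = e / N" by simp
  ultimately show ?thesis
    using norm_pair_le[of "z (j + 1) - z j - (1 / (2 * real N)) *\<^sub>R sympl (DH x)"] by linarith
qed

text \<open>Telescoping \<open>one_step\<close> keeps the error proportional to the elapsed time
  with the small factor \<open>e\<close>, so the estimate survives division by the time
  increment.\<close>

lemma many_steps:
  assumes e: "\<And>y. norm (y - x) < \<eta> \<Longrightarrow> norm (DH y - DH x) \<le> e" and ab: "a \<le> b"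
    and near: "\<And>i. a \<le> i \<Longrightarrow> i \<le> b \<Longrightarrow> norm (z i - x) < \<eta> / 2"
  shows "norm (z b - z a - (real_of_int (b - a) / (2 * real N)) *\<^sub>R sympl (DH x)) \<le> real_of_int (b - a) * (e / N)"
  using ab near
proof (induction b rule: int_ge_induct)
  case base
  show ?case by simp
next
  case (step b)
  let ?v = "sympl (DH x)"
  have eq: "z (b + 1) - z a - (real_of_int (b + 1 - a) / (2 * real N)) *\<^sub>R ?v
      = (z (b + 1) - z b - (1 / (2 * real N)) *\<^sub>R ?v) + (z b - z a - (real_of_int (b - a) / (2 * real N)) *\<^sub>R ?v)"
  proof -
    have "real_of_int (b + 1 - a) / (2 * real N) = 1 / (2 * real N) + real_of_int (b - a) / (2 * real N)"
      by (simp add: add_divide_distrib[symmetric])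
    then show ?thesis by (simp add: scaleR_add_left)
  qed
  have "norm (z (b + 1) - z b - (1 / (2 * real N)) *\<^sub>R ?v) \<le> e / N"
  proof (rule one_step[OF e])
    show "norm (z b - x) < \<eta> / 2" by (rule step.prems) (use step.hyps in auto)
    show "norm (z (b + 1) - x) < \<eta> / 2" by (rule step.prems) (use step.hyps in auto)
  qed
  moreover have "norm (z b - z a - (real_of_int (b - a) / (2 * real N)) *\<^sub>R ?v) \<le> real_of_int (b - a) * (e / N)"
    using step.prems by (intro step.IH) auto
  ultimately have "norm (z (b + 1) - z a - (real_of_int (b + 1 - a) / (2 * real N)) *\<^sub>R ?v) \<le> e / N + real_of_int (b - a) * (e / N)"
    unfolding eq by (intro order_trans[OF norm_triangle_ineq] add_mono)
  then show ?case by (simp add: algebra_simps add_divide_distrib diff_divide_distrib)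
qed

end

text \<open>Differentiability of the limit comes from passing \<open>many_steps\<close>, with base
  point X t, to the limit, rather than from convergence of derivatives. The shift n + 2 respects the
  least admissible number of modes.\<close>

theorem limit_orbit:
  fixes DH :: "'a::euclidean_space \<times> 'a \<Rightarrow> 'a \<times> 'a" and Hb :: "'a \<times> 'a \<Rightarrow> real" and z :: "nat \<Rightarrow> int \<Rightarrow> 'a \<times> 'a"
  assumes scheme: "\<And>n. euler_scheme DH (z n) (n + 2) C K"
    and contD: "continuous_on UNIV DH" and contH: "continuous_on UNIV Hb"
    and act: "\<And>n. \<exists>j<2*(n+2). \<beta> \<le> DH (z n (int j)) \<bullet> z n (int j) / 2 - Hb (z n (int j))"
  obtains X where "\<And>t. (X has_vector_derivative sympl (DH (X t))) (at t)"
    "\<And>t. X (t + 1) = X t" "\<And>t. X (- t) = (fst (X t), - snd (X t))"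
    "\<exists>t. \<beta> \<le> DH (X t) \<bullet> X t / 2 - Hb (X t)"
proof -
  define Lc where "Lc = euler_scheme.L C K"
  define Sc where "Sc = euler_scheme.S C K"
  define f where "f n = euler_scheme.X (z n) (n + 2)" for n
  define h where "h n = inverse (real (Suc n))" for n
  have Lc0: "0 \<le> Lc" using euler_scheme.L0[OF scheme] by (simp add: Lc_def)
  have f_eq: "f n t = z n \<lfloor>2 * real (n + 2) * t\<rfloor>" for n t
    using euler_scheme.X_def[OF scheme] by (simp add: f_def)
  have LN: "Lc / real (n + 2) \<le> Lc * h n" for n
    using Lc0 by (simp add: h_def divide_inverse mult_left_mono le_imp_inverse_le)
  have lip: "dist (f n s) (f n t) \<le> 2 * Lc * \<bar>s - t\<bar> + Lc * h n" for n s t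
    using euler_scheme.X_dist[OF scheme, of n s t] LN[of n] by (simp add: Lc_def f_def)
  have h0: "h \<longlonglongrightarrow> 0" unfolding h_def by (rule LIMSEQ_inverse_real_of_nat)
  have Lh0: "(\<lambda>n. Lc * h n) \<longlonglongrightarrow> 0" using tendsto_mult_right_zero[OF h0] by simp
  obtain k X where k: "strict_mono (k :: nat \<Rightarrow> nat)" and lim: "\<And>t. (\<lambda>n. f (k n) t) \<longlonglongrightarrow> X t"
  proof (rule almost_lipschitz_subsequence[of f Sc "2 * Lc" "\<lambda>n. Lc * h n"])
    show "norm (f n t) \<le> Sc" for n t
      using euler_scheme.norm_z[OF scheme] by (simp add: f_eq Sc_def)
  qed (use Lc0 lip Lh0 in auto)
  have Lhk: "(\<lambda>n. Lc * h (k n)) \<longlonglongrightarrow> 0" using LIMSEQ_subseq_LIMSEQ[OF Lh0 k] by (simp add: o_def)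
  have deriv: "(X has_vector_derivative sympl (DH (X t))) (at t)" for t
    unfolding has_vector_derivative_def has_derivative_at_alt
  proof (intro conjI allI impI)
    show "bounded_linear (\<lambda>x. x *\<^sub>R sympl (DH (X t)))" by (rule bounded_linear_scaleR_left)
    fix e :: real assume e: "e > 0"
    have "isCont DH (X t)" using contD continuous_on_eq_continuous_at[OF open_UNIV, of DH] by blast
    then obtain \<eta> where \<eta>: "\<eta> > 0" "\<And>y. norm (y - X t) < \<eta> \<Longrightarrow> norm (DH y - DH (X t)) < e / 2"
      using e unfolding continuous_at_eps_delta by (metis dist_norm half_gt_zero)
    \<comment> \<open>Between the two times the samples drift by at most \<eta>/8, apart from a grid
      error below \<eta>/16 and a distance below \<eta>/8 to the limit; in all they stay within
      \<eta>/2 of X t.\<close>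
    define d where "d = \<eta> / (16 * (Lc + 1))"
    have d: "d > 0" using \<eta> Lc0 by (simp add: d_def)
    show "\<exists>d>0. \<forall>y. norm (y - t) < d \<longrightarrow> norm (X y - X t - (y - t) *\<^sub>R sympl (DH (X t))) \<le> e * norm (y - t)"
    proof (intro exI[of _ d] conjI d allI impI)
      fix s assume s: "norm (s - t) < d"
      define v where "v = sympl (DH (X t))"
      \<comment> \<open>Time rounded down to the grid; its increments stand in for s - t until the
        limit is taken.\<close>
      define T where "T n r = real_of_int \<lfloor>2 * real (n + 2) * r\<rfloor> / (2 * real (n + 2))" for n r
      have Tl: "(\<lambda>n. T (k n) r) \<longlonglongrightarrow> r" for r
      proof -
        have "\<bar>T n r - r\<bar> \<le> h n" for n
        proof -
          have "\<bar>real_of_int \<lfloor>2 * real (n + 2) * r\<rfloor> - 2 * real (n + 2) * r\<bar> \<le> 1" by linarith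
          moreover have "T n r - r = (real_of_int \<lfloor>2 * real (n + 2) * r\<rfloor> - 2 * real (n + 2) * r) / (2 * real (n + 2))"
            by (simp add: T_def diff_divide_distrib)
          ultimately have "\<bar>T n r - r\<bar> \<le> 1 / (2 * real (n + 2))" by (simp add: abs_divide divide_right_mono)
          also have "\<dots> \<le> h n" by (simp add: h_def field_simps)
          finally show ?thesis .
        qed
        then have "(\<lambda>n. T n r - r) \<longlonglongrightarrow> 0" by (intro Lim_null_comparison[OF _ h0]) auto
        then have "(\<lambda>n. T n r) \<longlonglongrightarrow> r" by (simp add: LIM_zero_iff)
        from LIMSEQ_subseq_LIMSEQ[OF this k] show ?thesis by (simp add: o_def)
      qed
      have ev: "\<forall>\<^sub>F n in sequentially. norm (f (k n) s - f (k n) t - (T (k n) s - T (k n) t) *\<^sub>R v) \<le> e * \<bar>T (k n) s - T (k n) t\<bar>"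
      proof -
        have "\<forall>\<^sub>F n in sequentially. Lc * h (k n) < \<eta> / 16"
          using order_tendstoD(2)[OF Lhk, of "\<eta> / 16"] \<eta> by simp
        moreover have "\<forall>\<^sub>F n in sequentially. dist (f (k n) t) (X t) < \<eta> / 8"
          using tendstoD[OF lim[of t], of "\<eta> / 8"] \<eta> by simp
        ultimately show ?thesis
        proof eventually_elim
          case (elim n)
          define m where "m = k n"
          interpret euler_scheme DH "z m" "m + 2" C K by (rule scheme)
          define c where "c r = \<lfloor>2 * real (m + 2) * r\<rfloor>" for r
          have fz: "f m r = z m (c r)" for r by (simp add: f_eq c_def)
          have near: "norm (z m i - X t) < \<eta> / 2" if i: "min (c s) (c t) \<le> i" "i \<le> max (c s) (c t)" for i
          proof -
            have "real_of_int \<bar>i - c t\<bar> \<le> \<bar>real_of_int (c s) - real_of_int (c t)\<bar>" using i by linarith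
            also have "\<dots> \<le> 2 * real (m + 2) * \<bar>s - t\<bar> + 1" unfolding c_def by (rule floor_diff)
            finally have ic: "real_of_int \<bar>i - c t\<bar> \<le> 2 * real (m + 2) * \<bar>s - t\<bar> + 1" .
            have "norm (z m i - z m (c t)) \<le> real_of_int \<bar>i - c t\<bar> * (euler_scheme.L C K / (m + 2))" by (rule diff_abs_le)
            also have "\<dots> \<le> (2 * real (m + 2) * \<bar>s - t\<bar> + 1) * (Lc / (m + 2))"
              using ic Lc0 unfolding Lc_def by (intro mult_right_mono) auto
            also have "\<dots> = 2 * Lc * \<bar>s - t\<bar> + Lc / (m + 2)" by (simp add: field_simps)
            also have "\<dots> \<le> 2 * Lc * d + \<eta> / 16"
            proof (intro add_mono mult_left_mono)
              show "Lc / real (m + 2) \<le> \<eta> / 16" using LN[of m] elim(1) unfolding m_def by linarith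
            qed (use s Lc0 in auto)
            also have "2 * Lc * d \<le> 2 * (Lc + 1) * d" using d by simp
            also have "\<dots> = \<eta> / 8" using Lc0 by (simp add: d_def field_simps)
            finally have "norm (z m i - z m (c t)) \<le> \<eta> / 8 + \<eta> / 16" by simp
            moreover have "norm (z m (c t) - X t) < \<eta> / 8" using elim(2) unfolding m_def[symmetric] dist_norm fz .
            moreover have "norm (z m i - X t) \<le> norm (z m i - z m (c t)) + norm (z m (c t) - X t)"
              using norm_triangle_ineq[of "z m i - z m (c t)" "z m (c t) - X t"] by simp
            ultimately show ?thesis using \<eta>(1) by linarith
          qed
          have e': "norm (y - X t) < \<eta> \<Longrightarrow> norm (DH y - DH (X t)) \<le> e / 2" for y using \<eta>(2) less_imp_le by blast
          have main: "norm (z m b - z m a - ((real_of_int b - real_of_int a) / (2 * real (m + 2))) *\<^sub>R v) \<le> (real_of_int b - real_of_int a) * (e / 2 / real (m + 2))"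
            if "a \<le> b" "min (c s) (c t) \<le> a" "b \<le> max (c s) (c t)" for a b
            unfolding v_def of_int_diff[symmetric]
          proof (rule many_steps[where \<eta> = \<eta>])
            show "norm (z m i - X t) < \<eta> / 2" if "a \<le> i" "i \<le> b" for i
              by (rule near) (use that \<open>min (c s) (c t) \<le> a\<close> \<open>b \<le> max (c s) (c t)\<close> in linarith)+
          qed (use e' that in auto)
          have Tc: "T m s - T m t = (real_of_int (c s) - real_of_int (c t)) / (2 * real (m + 2))"
            by (simp add: T_def c_def diff_divide_distrib)
          have "norm (z m (c s) - z m (c t) - ((real_of_int (c s) - real_of_int (c t)) / (2 * real (m + 2))) *\<^sub>R v) \<le> \<bar>real_of_int (c s) - real_of_int (c t)\<bar> * (e / 2 / real (m + 2))"
          proof (cases "c t \<le> c s")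
            case True
            then show ?thesis using main[of "c t" "c s"] by simp
          next
            case False
            have "norm (z m (c s) - z m (c t) - ((real_of_int (c s) - real_of_int (c t)) / (2 * real (m + 2))) *\<^sub>R v)
              = norm (z m (c t) - z m (c s) - ((real_of_int (c t) - real_of_int (c s)) / (2 * real (m + 2))) *\<^sub>R v)"
            proof -
              have "(real_of_int (c s) - real_of_int (c t)) / (2 * real (m + 2)) = - ((real_of_int (c t) - real_of_int (c s)) / (2 * real (m + 2)))"
                by (simp only: minus_divide_left minus_diff_eq)
              then have "z m (c s) - z m (c t) - ((real_of_int (c s) - real_of_int (c t)) / (2 * real (m + 2))) *\<^sub>R v
                 = - (z m (c t) - z m (c s) - ((real_of_int (c t) - real_of_int (c s)) / (2 * real (m + 2))) *\<^sub>R v)"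
                by simp
              then show ?thesis by (simp only: norm_minus_cancel)
            qed
            then show ?thesis using main[of "c s" "c t"] False by simp
          qed
          moreover have "\<bar>real_of_int (c s) - real_of_int (c t)\<bar> * (e / 2 / real (m + 2)) = e * \<bar>T m s - T m t\<bar>"
            unfolding Tc by (simp add: abs_divide)
          ultimately show ?case unfolding m_def[symmetric] fz Tc by (simp add: mult.commute[of _ e])
        qed
      qed
      have "norm (X s - X t - (s - t) *\<^sub>R v) \<le> e * \<bar>s - t\<bar>"
      proof (rule tendsto_le[OF trivial_limit_sequentially _ _ ev])
        show "(\<lambda>n. norm (f (k n) s - f (k n) t - (T (k n) s - T (k n) t) *\<^sub>R v)) \<longlonglongrightarrow> norm (X s - X t - (s - t) *\<^sub>R v)"
          by (intro tendsto_intros lim Tl)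
        show "(\<lambda>n. e * \<bar>T (k n) s - T (k n) t\<bar>) \<longlonglongrightarrow> e * \<bar>s - t\<bar>" by (intro tendsto_intros Tl)
      qed
      then show "norm (X s - X t - (s - t) *\<^sub>R sympl (DH (X t))) \<le> e * norm (s - t)" by (simp add: v_def)
    qed
  qed
  have per: "X (t + 1) = X t" for t
  proof -
    have "f n (t + 1) = f n t" for n using euler_scheme.X_periodic[OF scheme] by (simp add: f_def)
    then show ?thesis using LIMSEQ_unique[OF lim[of t], of "X (t + 1)"] lim[of "t + 1"] by simp
  qed
  have refl: "X (- t) = (fst (X t), - snd (X t))" for t
  proof -
    have a: "(\<lambda>n. dist (f (k n) (- t)) (fst (f (k n) t), - snd (f (k n) t))) \<longlonglongrightarrow> dist (X (- t)) (fst (X t), - snd (X t))"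
      by (intro tendsto_dist tendsto_Pair tendsto_fst tendsto_snd tendsto_minus lim)
    have b: "dist (f n (- t)) (fst (f n t), - snd (f n t)) \<le> 2 * (Lc * h n)" for n
      using euler_scheme.X_reflect[OF scheme, of n t] LN[of n] by (simp add: f_def Lc_def)
    have c: "(\<lambda>n. 2 * (Lc * h (k n))) \<longlonglongrightarrow> 0" using tendsto_mult_right_zero[OF Lhk] by simp
    have "dist (X (- t)) (fst (X t), - snd (X t)) \<le> 0"
      by (rule LIMSEQ_le[OF a c]) (use b in blast)
    then show ?thesis by simp
  qed
  obtain j where j: "\<And>n. j n < 2 * (n + 2)" "\<And>n. \<beta> \<le> DH (z n (int (j n))) \<bullet> z n (int (j n)) / 2 - Hb (z n (int (j n)))"
    using act by metis
  \<comment> \<open>Times of the samples with large action. Compactness of the unit interval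
    supplies a limit time, and the almost Lipschitz bound lets the time vary together with the index
    of the sequence.\<close>
  define \<tau> where "\<tau> n = real (j (k n)) / (2 * real (k n + 2))" for n
  have "\<tau> n \<in> {0..1}" for n using j(1)[of "k n"] by (auto simp: \<tau>_def divide_simps)
  then obtain t r where r: "strict_mono (r :: nat \<Rightarrow> nat)" "(\<tau> \<circ> r) \<longlonglongrightarrow> t"
    using compact_Icc[of 0 "1::real"] unfolding compact_def by blast
  have fj: "f (k n) (\<tau> n) = z (k n) (int (j (k n)))" for n
    by (simp add: f_eq \<tau>_def)
  have conv: "(\<lambda>n. f (k (r n)) (\<tau> (r n))) \<longlonglongrightarrow> X t"
  proof -
    have a: "(\<lambda>n. f (k (r n)) t) \<longlonglongrightarrow> X t" using LIMSEQ_subseq_LIMSEQ[OF lim[of t] r(1)] by (simp add: o_def)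
    have b: "(\<lambda>n. dist (f (k (r n)) (\<tau> (r n))) (f (k (r n)) t)) \<longlonglongrightarrow> 0"
    proof (rule Lim_null_comparison)
      show "\<forall>\<^sub>F n in sequentially. norm (dist (f (k (r n)) (\<tau> (r n))) (f (k (r n)) t)) \<le> 2 * Lc * \<bar>\<tau> (r n) - t\<bar> + Lc * h (k (r n))"
        using lip by simp
      have "(\<lambda>n. 2 * Lc * \<bar>\<tau> (r n) - t\<bar> + Lc * h (k (r n))) \<longlonglongrightarrow> 2 * Lc * \<bar>t - t\<bar> + 0"
        using r(2) LIMSEQ_subseq_LIMSEQ[OF Lhk r(1)] by (intro tendsto_intros) (auto simp: o_def)
      then show "(\<lambda>n. 2 * Lc * \<bar>\<tau> (r n) - t\<bar> + Lc * h (k (r n))) \<longlonglongrightarrow> 0" by simp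
    qed
    show ?thesis by (rule Lim_transform[OF a]) (use b in \<open>simp add: dist_norm tendsto_norm_zero_iff\<close>)
  qed
  have "(\<lambda>n. DH (f (k (r n)) (\<tau> (r n))) \<bullet> f (k (r n)) (\<tau> (r n)) / 2 - Hb (f (k (r n)) (\<tau> (r n)))) \<longlonglongrightarrow> DH (X t) \<bullet> X t / 2 - Hb (X t)"
    by (intro tendsto_intros conv continuous_on_tendsto_compose[OF contD conv] continuous_on_tendsto_compose[OF contH conv]) auto
  then have "\<beta> \<le> DH (X t) \<bullet> X t / 2 - Hb (X t)"
    using j(2) by (intro LIMSEQ_le_const) (auto simp: fj)
  then show thesis using that[of X] deriv per refl by blast
qed

subsection \<open>Symmetric orbits of Hamiltonians supported in a round cylinder\<close>

lemma uniformly_continuous_on_compact_support: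
  fixes f :: "'a::euclidean_space \<Rightarrow> 'b::real_normed_vector"
  assumes cont: "continuous_on UNIV f" and supp: "\<And>x. r < norm x \<Longrightarrow> f x = 0"
  shows "uniformly_continuous_on UNIV f" "\<exists>M. \<forall>x. norm (f x) \<le> M"
proof -
  have uc: "uniformly_continuous_on (cball 0 (r + 1)) f"
    by (intro compact_uniformly_continuous continuous_on_subset[OF cont]) auto
  show "uniformly_continuous_on UNIV f"
    unfolding uniformly_continuous_on_def
  proof (intro allI impI)
    fix e :: real assume e: "0 < e"
    from uc e obtain d where d: "d > 0" "\<And>x y. x \<in> cball 0 (r+1) \<Longrightarrow> y \<in> cball 0 (r+1) \<Longrightarrow> dist y x < d \<Longrightarrow> dist (f y) (f x) < e"
      unfolding uniformly_continuous_on_def by metis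
    show "\<exists>d>0. \<forall>x\<in>UNIV. \<forall>x'\<in>UNIV. dist x' x < d \<longrightarrow> dist (f x') (f x) < e"
    proof (intro exI[of _ "min d 1"] conjI ballI impI)
      fix x y :: 'a assume xy: "dist y x < min d 1"
      show "dist (f y) (f x) < e"
      proof (cases "x \<in> cball 0 (r+1) \<and> y \<in> cball 0 (r+1)")
        case True
        then show ?thesis using d xy by auto
      next
        case False
        have "norm x \<le> norm y + dist y x" "norm y \<le> norm x + dist y x"
          using norm_triangle_sub[of x y] norm_triangle_sub[of y x] by (simp_all add: dist_norm norm_minus_commute)
        then have "r < norm x" "r < norm y" using False xy by auto
        then show ?thesis using supp e by simp
      qed
    qed (use d in auto)
  qed
  have "bounded (f ` cball 0 r)"
    by (intro compact_imp_bounded compact_continuous_image continuous_on_subset[OF cont]) auto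
  then obtain M where M: "\<And>x. x \<in> cball 0 r \<Longrightarrow> norm (f x) \<le> M" unfolding bounded_iff by blast
  have "norm (f x) \<le> max M 0" for x
    using M[of x] supp[of x] by (cases "norm x \<le> r") auto
  then show "\<exists>M. \<forall>x. norm (f x) \<le> M" by blast
qed

lemma has_derivative_zero_on_open:
  fixes f :: "'a::real_inner \<Rightarrow> real"
  assumes "open U" "z \<in> U" "\<And>y. y \<in> U \<Longrightarrow> f y = c" "(f has_derivative (\<lambda>w. d \<bullet> w)) (at z)"
  shows "d = 0"
proof -
  have "((\<lambda>_. c) has_derivative (\<lambda>w. d \<bullet> w)) (at z)"
    by (rule has_derivative_transform_within_open[OF assms(4,1,2)]) (use assms(3) in auto)
  moreover have "((\<lambda>_. c) has_derivative (\<lambda>w. 0)) (at z)" by simp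
  ultimately have "(\<lambda>w. d \<bullet> w) = (\<lambda>w. 0)" by (rule has_derivative_unique)
  then have "d \<bullet> d = 0" by meson
  then show ?thesis by simp
qed

lemma norm_sympl [simp]: "norm (sympl z) = norm z"
  by (cases z) (simp add: sympl_def norm_Pair add.commute)

text \<open>Uniqueness at an equilibrium from a Lipschitz bound centred at that point alone: on an
  interval with L r \<le> 1/2 the largest distance from X t is at most half of itself.\<close>

lemma stationary_near_equilibrium:
  fixes X :: "real \<Rightarrow> 'a::euclidean_space" and V :: "'a \<Rightarrow> 'a"
  assumes r0: "r0 > 0" and X: "\<And>s. \<bar>s - t\<bar> < r0 \<Longrightarrow> (X has_vector_derivative V (X s)) (at s)"
    and d: "d > 0" and L: "\<And>y. dist y (X t) < d \<Longrightarrow> norm (V y) \<le> L * dist y (X t)"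
  shows "\<exists>r>0. \<forall>s. \<bar>s - t\<bar> < r \<longrightarrow> X s = X t"
proof -
  have "isCont X t" using X[of t] r0 has_vector_derivative_continuous by auto
  then have "\<exists>r1>0. \<forall>s. dist s t < r1 \<longrightarrow> dist (X s) (X t) < d"
    using d by (simp add: continuous_at_eps_delta)
  then obtain r1 where r1: "r1 > 0" "\<And>s. dist s t < r1 \<Longrightarrow> dist (X s) (X t) < d" by blast
  define r where "r = min (min r0 r1 / 2) (1 / (2 * (\<bar>L\<bar> + 1)))"
  have r: "r > 0" "r < r0" "r < r1" "\<bar>L\<bar> * r \<le> 1 / 2"
  proof -
    show "r > 0" "r < r0" "r < r1" using r0 r1 by (auto simp: r_def min_def)
    have "\<bar>L\<bar> * r \<le> (\<bar>L\<bar> + 1) * (1 / (2 * (\<bar>L\<bar> + 1)))" using r0 r1 by (intro mult_mono) (auto simp: r_def)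
    also have "\<dots> = 1 / 2" by (simp add: divide_simps)
    finally show "\<bar>L\<bar> * r \<le> 1 / 2" .
  qed
  define I where "I = cball t r"
  have I: "s \<in> I \<Longrightarrow> \<bar>s - t\<bar> \<le> r" for s by (simp add: I_def dist_real_def abs_minus_commute)
  have "continuous_on I (\<lambda>s. norm (X s - X t))"
  proof (intro continuous_intros continuous_at_imp_continuous_on ballI)
    fix s assume "s \<in> I" then show "isCont X s" using X[of s] I[of s] r has_vector_derivative_continuous by auto
  qed
  then obtain s0 where s0: "s0 \<in> I" "\<And>s. s \<in> I \<Longrightarrow> norm (X s - X t) \<le> norm (X s0 - X t)"
    using continuous_attains_sup[of I "\<lambda>s. norm (X s - X t)"] r by (auto simp: I_def)
  define M where "M = norm (X s0 - X t)"
  have "norm (X s0 - X t) \<le> (\<bar>L\<bar> * M) * norm (s0 - t)"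
  proof (rule differentiable_bound[where S = I and f = X and f' = "\<lambda>s h. h *\<^sub>R V (X s)"])
    fix s assume s: "s \<in> I"
    have "\<bar>s - t\<bar> < r0" using I[OF s] r by linarith
    from X[OF this] show "(X has_derivative (\<lambda>h. h *\<^sub>R V (X s))) (at s within I)"
      unfolding has_vector_derivative_def by (rule has_derivative_at_withinI)
    show "onorm (\<lambda>h. h *\<^sub>R V (X s)) \<le> \<bar>L\<bar> * M"
    proof (rule onorm_le)
      fix h :: real
      have "norm (V (X s)) \<le> L * dist (X s) (X t)" using r1(2)[of s] I[OF s] r by (intro L) (auto simp: dist_real_def)
      also have "\<dots> \<le> \<bar>L\<bar> * M" using s0(2)[OF s] by (intro mult_mono) (auto simp: M_def dist_norm)
      finally have "\<bar>h\<bar> * norm (V (X s)) \<le> \<bar>h\<bar> * (\<bar>L\<bar> * M)" by (intro mult_left_mono) auto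
      then show "norm (h *\<^sub>R V (X s)) \<le> \<bar>L\<bar> * M * norm h" by (simp add: mult_ac)
    qed
  qed (use s0 r in \<open>auto simp: I_def\<close>)
  also have "\<dots> \<le> (\<bar>L\<bar> * M) * r" using I[OF s0(1)] by (intro mult_left_mono) (auto simp: M_def)
  also have "\<dots> = (\<bar>L\<bar> * r) * M" by simp
  also have "\<dots> \<le> 1 / 2 * M" using r(4) by (intro mult_right_mono) (auto simp: M_def)
  finally have "M = 0" by (simp add: M_def)
  then have "X s = X t" if "\<bar>s - t\<bar> < r" for s
    using s0(2)[of s] that by (simp add: M_def I_def dist_real_def abs_minus_commute)
  then show ?thesis using r(1) by blast
qed

lemma max0_sq_derivative: "((\<lambda>r::real. (max 0 (r - a))\<^sup>2) has_real_derivative 2 * max 0 (r - a)) (at r)"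
proof -
  consider "r < a" | "r > a" | "r = a" by linarith
  then show ?thesis
  proof cases
    case 1
    have "((\<lambda>_. 0) has_real_derivative 0) (at r)" by simp
    then have "((\<lambda>r::real. (max 0 (r - a))\<^sup>2) has_real_derivative 0) (at r)"
      by (rule has_field_derivative_transform_within[where d = "a - r"]) (use 1 in \<open>auto simp: dist_real_def\<close>)
    then show ?thesis using 1 by simp
  next
    case 2
    have "((\<lambda>r. (r - a)\<^sup>2) has_real_derivative 2 * (r - a)) (at r)" by (auto intro!: derivative_eq_intros)
    then have "((\<lambda>r::real. (max 0 (r - a))\<^sup>2) has_real_derivative 2 * (r - a)) (at r)"
      by (rule has_field_derivative_transform_within[where d = "r - a"]) (use 2 in \<open>auto simp: dist_real_def\<close>)
    then show ?thesis using 2 by simp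
  next
    case 3
    have "((\<lambda>y. ((max 0 (y - a))\<^sup>2 - (max 0 (a - a))\<^sup>2) / (y - a)) \<longlongrightarrow> 0) (at a)"
    proof (rule Lim_null_comparison)
      show "\<forall>\<^sub>F y in at a. norm (((max 0 (y - a))\<^sup>2 - (max 0 (a - a))\<^sup>2) / (y - a)) \<le> \<bar>y - a\<bar>"
        by (rule always_eventually) (auto simp: max_def power2_eq_square)
      show "((\<lambda>y. \<bar>y - a\<bar>) \<longlongrightarrow> 0) (at a)" by (rule tendsto_eq_intros tendsto_rabs_zero | simp)+
    qed
    then show ?thesis using 3 by (simp add: has_field_derivative_iff)
  qed
qed

text \<open>\<open>F\<close> is extended by a multiple of k (Q / \<eta> - 1), where the quadratic
  form \<open>Q\<close> is below \<eta> on \<open>K\<close>. The orbit found belongs to the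
  extension; its action value puts one point where \<open>F\<close> has nonzero gradient, and the
  set of such times turns out to be open and closed.\<close>

theorem symmetric_orbit_exists:
  fixes F :: "'a::euclidean_space \<times> 'a \<Rightarrow> real" and DF :: "'a \<times> 'a \<Rightarrow> 'a \<times> 'a"
    and u x0 :: 'a and R m \<rho>0 :: real
  assumes u: "norm u = 1" and R: "R > 0" and m: "pi * R\<^sup>2 < m"
    and derivF: "\<And>z. (F has_derivative (\<lambda>w. DF z \<bullet> w)) (at z)" and contDF: "continuous_on UNIV DF"
    and evenF: "\<And>q p. F (q, - p) = F (q, p)" and F0: "\<And>z. 0 \<le> F z"
    and K: "compact K" and FK: "\<And>z. z \<notin> K \<Longrightarrow> F z = m"
    and KR: "\<And>z. z \<in> K \<Longrightarrow> (fst z \<bullet> u)\<^sup>2 + (snd z \<bullet> u)\<^sup>2 < R\<^sup>2"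
    and \<rho>0: "\<rho>0 > 0" and zero: "\<And>z. dist z (x0, 0) < \<rho>0 \<Longrightarrow> F z = 0"
    and equil: "\<And>z. DF z = 0 \<Longrightarrow> \<exists>L d. d > 0 \<and> (\<forall>y. dist y z < d \<longrightarrow> norm (DF y) \<le> L * dist y z)"
  shows "\<exists>X. (\<forall>t. (X has_vector_derivative sympl (DF (X t))) (at t)) \<and>
    (\<forall>t. X (t + 1) = X t) \<and> (\<forall>t. X (- t) = (fst (X t), - snd (X t))) \<and> (\<forall>t. X t \<in> K) \<and> (\<forall>t. DF (X t) \<noteq> 0)"
proof -
  obtain Bs where Bs: "u \<in> Bs" "pairwise orthogonal Bs" "\<And>x. x \<in> Bs \<Longrightarrow> norm x = 1" "independent Bs" "span Bs = UNIV"
    using vector_in_orthonormal_basis[OF u] by metis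
  have finB: "finite Bs" using Bs(4) independent_imp_finite by blast
  have orth: "v \<bullet> w = (if v = w then 1 else 0)" if "v \<in> Bs" "w \<in> Bs" for v w
    using that Bs(2,3) by (auto simp: pairwise_def orthogonal_def norm_eq_1)
  have m0: "0 < m" using m R by (smt (verit) mult_pos_pos pi_gt_zero zero_less_power)
  have DFK: "DF z = 0" if "z \<notin> K" for z
    by (rule has_derivative_zero_on_open[OF _ _ _ derivF, of "- K" z m]) (use that K FK compact_imp_closed in auto)
  have x0K: "z \<in> K" if "dist z (x0, 0) < \<rho>0" for z using FK[of z] zero[OF that] m0 by auto
  have x0K': "(x0, 0) \<in> K" using x0K[of "(x0,0)"] \<rho>0 by simp
  \<comment> \<open>Midway between pi and m / R^2, capped at 7/2: the first resonance is crossed,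
    while \<eta> = c0 R^2 remains below \<open>m\<close>.\<close>
  define c0 where "c0 = min (7/2) ((pi + m / R\<^sup>2) / 2)"
  have mR: "pi < m / R\<^sup>2" using m R by (simp add: pos_less_divide_eq)
  have c0: "pi < c0" "c0 \<le> 7/2" "c0 < m / R\<^sup>2"
  proof -
    define q where "q = m / R\<^sup>2"
    have "pi < q" "pi < 7 / 2" using mR pi_approx(2) by (simp_all add: q_def)
    then show "pi < c0" "c0 \<le> 7/2" "c0 < m / R\<^sup>2" unfolding c0_def q_def[symmetric] by (auto simp: min_less_iff_disj)
  qed
  define \<eta> where "\<eta> = c0 * R\<^sup>2"
  have c0p: "c0 > 0" using c0 pi_gt_zero by linarith
  have \<eta>: "0 < \<eta>" "\<eta> < m" using c0 c0p R by (auto simp: \<eta>_def pos_less_divide_eq)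
  \<comment> \<open>The length of the transition zone of \<open>k\<close>, fixed by \<eta> (1 + c/2)
    = m so that the action outside is at most zero.\<close>
  define c where "c = 2 * (m / \<eta> - 1)"
  have c: "0 < c" "\<eta> * (1 + c / 2) = m" using \<eta> by (auto simp: c_def field_simps)
  obtain zm where zm: "zm \<in> K" "\<And>z. z \<in> K \<Longrightarrow> (fst z \<bullet> u)\<^sup>2 + (snd z \<bullet> u)\<^sup>2 \<le> (fst zm \<bullet> u)\<^sup>2 + (snd zm \<bullet> u)\<^sup>2"
  proof -
    have "continuous_on K (\<lambda>z. (fst z \<bullet> u)\<^sup>2 + (snd z \<bullet> u)\<^sup>2)" by (intro continuous_intros)
    then have "\<exists>x\<in>K. \<forall>y\<in>K. (fst y \<bullet> u)\<^sup>2 + (snd y \<bullet> u)\<^sup>2 \<le> (fst x \<bullet> u)\<^sup>2 + (snd x \<bullet> u)\<^sup>2"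
      using x0K' by (intro continuous_attains_sup[OF K]) auto
    then show thesis using that by blast
  qed
  define e1 where "e1 = R\<^sup>2 - ((fst zm \<bullet> u)\<^sup>2 + (snd zm \<bullet> u)\<^sup>2)"
  have e1: "e1 > 0" using KR[OF zm(1)] by (simp add: e1_def)
  obtain S where S: "\<And>z. z \<in> K \<Longrightarrow> norm z \<le> S" "S > 0" using K compact_imp_bounded bounded_pos by metis
  \<comment> \<open>On \<open>K\<close> the squared radius in the plane of \<open>u\<close> stays
    \<open>e1\<close> below R^2; this slack pays for the weak growth \<theta> in the other
    directions, so that Q < \<eta> on \<open>K\<close>.\<close>
  define \<theta> where "\<theta> = min 1 (c0 * e1 / (2 * S\<^sup>2))"
  have \<theta>: "0 < \<theta>" "\<theta> \<le> 1" "\<theta> * S\<^sup>2 < c0 * e1"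
  proof -
    show "0 < \<theta>" "\<theta> \<le> 1" using c0p e1 S by (auto simp: \<theta>_def)
    have "\<theta> * S\<^sup>2 \<le> (c0 * e1 / (2 * S\<^sup>2)) * S\<^sup>2" by (intro mult_right_mono) (auto simp: \<theta>_def)
    also have "\<dots> < c0 * e1" using S c0p e1 by simp
    finally show "\<theta> * S\<^sup>2 < c0 * e1" .
  qed
  define cf where "cf v = (if v = u then c0 else \<theta>)" for v
  have cfb: "\<theta> \<le> cf v" "cf v \<le> c0" for v using \<theta> c0 pi_gt3 by (auto simp: cf_def)
  define Q where "Q z = (\<Sum>v\<in>Bs. cf v * ((fst z \<bullet> v)\<^sup>2 + (snd z \<bullet> v)\<^sup>2))" for z
  define A where "A z = (\<Sum>v\<in>Bs. (cf v * (fst z \<bullet> v)) *\<^sub>R v, \<Sum>v\<in>Bs. (cf v * (snd z \<bullet> v)) *\<^sub>R v)" for z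
  have expand: "(\<Sum>v\<in>Bs. (y \<bullet> v) *\<^sub>R v) = y" for y
  proof -
    define r where "r = (\<Sum>v\<in>Bs. (y \<bullet> v) *\<^sub>R v) - y"
    have "orthogonal r v" if "v \<in> Bs" for v using that
      by (simp add: orthogonal_def r_def inner_diff_left inner_sum_left orth finB if_distrib cong: if_cong)
    then have "orthogonal r v" if "v \<in> span Bs" for v using that orthogonal_to_span by blast
    then have "orthogonal r r" using Bs(5) by simp
    then show ?thesis by (simp add: orthogonal_def r_def)
  qed
  have norm2: "(norm z)\<^sup>2 = (\<Sum>v\<in>Bs. (fst z \<bullet> v)\<^sup>2 + (snd z \<bullet> v)\<^sup>2)" for z :: "'a \<times> 'a"
  proof -
    have e: "y \<bullet> y = (\<Sum>v\<in>Bs. (y \<bullet> v)\<^sup>2)" for y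
    proof -
      have "y \<bullet> y = (\<Sum>v\<in>Bs. (y \<bullet> v) *\<^sub>R v) \<bullet> y" by (simp only: expand)
      also have "\<dots> = (\<Sum>v\<in>Bs. (y \<bullet> v) * (v \<bullet> y))" by (simp only: inner_sum_left inner_scaleR_left)
      finally show ?thesis by (simp add: inner_commute power2_eq_square)
    qed
    have "(norm z)\<^sup>2 = fst z \<bullet> fst z + snd z \<bullet> snd z" by (simp add: power2_norm_eq_inner inner_prod_def)
    then show ?thesis by (simp only: e sum.distrib)
  qed
  have Qlow: "\<theta> * (norm z)\<^sup>2 \<le> Q z" and Qup: "Q z \<le> c0 * (norm z)\<^sup>2" for z
    unfolding Q_def norm2 sum_distrib_left by (intro sum_mono mult_right_mono cfb; simp)+
  have Q0: "0 \<le> Q z" for z using Qlow[of z] \<theta> by (smt (verit) mult_nonneg_nonneg zero_le_power2)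
  have QK: "Q z < \<eta>" if z: "z \<in> K" for z
  proof -
    have "Q z = c0 * ((fst z \<bullet> u)\<^sup>2 + (snd z \<bullet> u)\<^sup>2) + (\<Sum>v\<in>Bs-{u}. \<theta> * ((fst z \<bullet> v)\<^sup>2 + (snd z \<bullet> v)\<^sup>2))"
      unfolding Q_def by (subst sum.remove[OF finB Bs(1)]) (simp add: cf_def cong: sum.cong_simp)
    also have "(\<Sum>v\<in>Bs-{u}. \<theta> * ((fst z \<bullet> v)\<^sup>2 + (snd z \<bullet> v)\<^sup>2)) \<le> (\<Sum>v\<in>Bs. \<theta> * ((fst z \<bullet> v)\<^sup>2 + (snd z \<bullet> v)\<^sup>2))"
      using finB \<theta> by (intro sum_mono2) auto
    also have "\<dots> = \<theta> * (norm z)\<^sup>2" by (simp add: norm2 sum_distrib_left)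
    also have "\<dots> \<le> \<theta> * S\<^sup>2" using S(1)[OF z] \<theta> by (intro mult_left_mono power_mono) auto
    also have "c0 * ((fst z \<bullet> u)\<^sup>2 + (snd z \<bullet> u)\<^sup>2) \<le> c0 * (R\<^sup>2 - e1)"
      using zm(2)[OF z] c0p by (intro mult_left_mono) (auto simp: e1_def)
    finally have "Q z \<le> c0 * (R\<^sup>2 - e1) + \<theta> * S\<^sup>2" by simp
    also have "\<dots> < \<eta>" using \<theta>(3) by (simp add: \<eta>_def algebra_simps)
    finally show ?thesis .
  qed
  have linA: "bounded_linear A" unfolding A_def
    by (intro bounded_linear_Pair bounded_linear_sum) (auto intro!: bounded_linear_intros bounded_linear_scaleR_left[THEN bounded_linear_compose] bounded_linear_mult_right[THEN bounded_linear_compose] bounded_linear_inner_left[THEN bounded_linear_compose] bounded_linear_fst bounded_linear_snd)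
  have derivQ: "(Q has_derivative (\<lambda>w. 2 * (A z \<bullet> w))) (at z)" for z
  proof -
    have "(Q has_derivative (\<lambda>w. \<Sum>v\<in>Bs. cf v * (2 * (fst z \<bullet> v) * (fst w \<bullet> v) + 2 * (snd z \<bullet> v) * (snd w \<bullet> v)))) (at z)"
      unfolding Q_def by (auto intro!: derivative_eq_intros sum.cong simp: algebra_simps)
    moreover have "2 * (A z \<bullet> w) = (\<Sum>v\<in>Bs. cf v * (2 * (fst z \<bullet> v) * (fst w \<bullet> v) + 2 * (snd z \<bullet> v) * (snd w \<bullet> v)))" for w
      unfolding A_def inner_prod_def fst_conv snd_conv inner_sum_left inner_scaleR_left
      by (simp add: sum.distrib[symmetric] sum_distrib_left distrib_left mult_ac inner_commute)
    ultimately show ?thesis by (simp only:)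
  qed
  have AQ: "A z \<bullet> z = Q z" for z
    unfolding Q_def A_def inner_prod_def fst_conv snd_conv inner_sum_left inner_scaleR_left
    by (simp add: sum.distrib power2_eq_square distrib_left mult.assoc inner_commute)
  \<comment> \<open>A continuously differentiable ramp: zero for r \<le> 0, quadratic up to
    \<open>c\<close>, then r - c/2.\<close>
  define k where "k r = ((max 0 (r - 0))\<^sup>2 - (max 0 (r - c))\<^sup>2) / (2 * c)" for r
  define k' where "k' r = (max 0 (r - 0) - max 0 (r - c)) / c" for r
  have kd: "(k has_real_derivative k' r) (at r)" for r
  proof -
    have "(k has_real_derivative (2 * max 0 (r - 0) - 2 * max 0 (r - c)) / (2 * c)) (at r)"
      unfolding k_def by (intro DERIV_cdivide DERIV_diff max0_sq_derivative)
    moreover have "(2 * x - 2 * y) / (2 * c) = (x - y) / c" for x y by (simp add: diff_divide_distrib)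
    ultimately show ?thesis unfolding k'_def by (simp only:)
  qed
  have k'c: "continuous_on UNIV k'" unfolding k'_def using c by (intro continuous_intros) auto
  have k0: "k r = 0" "k' r = 0" if "r \<le> 0" for r using that c by (auto simp: k_def k'_def)
  have klow: "r - c / 2 \<le> k r" for r
  proof -
    consider "r \<le> 0" | "0 \<le> r" "r \<le> c" | "c \<le> r" by linarith
    then show ?thesis
    proof cases
      case 2
      have "k r - (r - c / 2) = (r - c)\<^sup>2 / (2 * c)" using 2 c by (simp add: k_def field_simps power2_eq_square)
      also have "\<dots> \<ge> 0" using c by simp
      finally show ?thesis by simp
    next
      case 3
      then show ?thesis using c by (simp add: k_def power2_eq_square field_simps)
    qed (use c k0 in auto)
  qed
  have kpos: "0 \<le> k r" for r
    using c by (auto simp: k_def intro!: divide_nonneg_nonneg power_mono)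
  have kup: "k r \<le> max 0 r" for r
  proof -
    consider "r \<le> 0" | "0 \<le> r" "r \<le> c" | "c \<le> r" by linarith
    then show ?thesis
    proof cases
      case 2
      have "r * r \<le> r * (2 * c)" using 2 c by (intro mult_left_mono) auto
      then show ?thesis using 2 c by (simp add: k_def power2_eq_square pos_divide_le_eq)
    next
      case 3
      then show ?thesis using c by (simp add: k_def power2_eq_square field_simps)
    qed (use k0 in auto)
  qed
  have k1: "k' r = 1" if "c \<le> r" for r using that c by (simp add: k'_def)
  \<comment> \<open>Where Q = \<eta> (1 + r) with r \<ge> 0, hence outside \<open>K\<close>, the
    action density is \<eta> (k' r (1 + r) - k r) - m. This bound makes it nonpositive.\<close>
  have kk: "k' r * (1 + r) - k r \<le> 1 + c / 2" if r: "0 \<le> r" for r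
  proof (cases "r \<le> c")
    case True
    have "k' r * (1 + r) - k r = r / c + r * r / (2 * c)"
      using r True c by (simp add: k_def k'_def power2_eq_square field_simps)
    also have "\<dots> \<le> 1 + c * c / (2 * c)" using r True c by (intro add_mono divide_right_mono mult_mono) auto
    finally show ?thesis using c by simp
  next
    case False
    then show ?thesis using r c by (simp add: k_def k'_def power2_eq_square field_simps)
  qed
  define Hb where "Hb z = F z + \<eta> * k (Q z / \<eta> - 1)" for z
  define DH where "DH z = DF z + (2 * k' (Q z / \<eta> - 1)) *\<^sub>R A z" for z
  have derivH: "(Hb has_derivative (\<lambda>w. DH z \<bullet> w)) (at z)" for z
  proof -
    have "((\<lambda>z. k (Q z / \<eta> - 1)) has_derivative (\<lambda>w. k' (Q z / \<eta> - 1) * (2 * (A z \<bullet> w) / \<eta>))) (at z)"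
      by (rule has_derivative_compose[OF _ has_field_derivative_imp_has_derivative[OF kd], unfolded o_def])
         (use \<eta> in \<open>auto intro!: derivative_eq_intros derivQ\<close>)
    from has_derivative_add[OF derivF has_derivative_mult_right[OF this, of \<eta>]]
    show ?thesis unfolding Hb_def DH_def using \<eta> by (simp add: inner_add_left mult_ac)
  qed
  have contQ: "continuous_on UNIV Q" unfolding Q_def by (intro continuous_intros)
  have contA: "continuous_on UNIV A" using linA linear_continuous_on by blast
  have contk': "continuous_on UNIV (\<lambda>z. k' (Q z / \<eta> - 1))"
    using \<eta> by (intro continuous_on_compose2[OF k'c] continuous_intros contQ) auto
  define Rm where "Rm z = DH z - 2 *\<^sub>R A z" for z
  have contRm: "continuous_on UNIV Rm" unfolding Rm_def DH_def by (intro continuous_intros contDF contk' contA)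
  define rad where "rad = max S (sqrt (\<eta> * (1 + c) / \<theta>))"
  have Rm0: "Rm z = 0" if z: "rad < norm z" for z
  proof -
    have "z \<notin> K" using z S(1)[of z] by (auto simp: rad_def)
    moreover have "c \<le> Q z / \<eta> - 1"
    proof -
      have "sqrt (\<eta> * (1 + c) / \<theta>) \<le> norm z" using z by (simp add: rad_def)
      then have "\<eta> * (1 + c) / \<theta> \<le> (norm z)\<^sup>2" by (rule sqrt_le_D)
      then have "\<eta> * (1 + c) \<le> \<theta> * (norm z)\<^sup>2" using \<theta> by (simp add: pos_divide_le_eq mult.commute)
      then have "\<eta> * (1 + c) \<le> Q z" using Qlow[of z] by linarith
      then show ?thesis using \<eta> by (simp add: field_simps)
    qed
    ultimately show ?thesis by (simp add: Rm_def DH_def DFK k1)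
  qed
  note ucRm = uniformly_continuous_on_compact_support[OF contRm Rm0]
  obtain M where M: "\<And>z. norm (Rm z) \<le> M" using ucRm(2) by blast
  have ucH: "uniformly_continuous_on UNIV DH"
  proof -
    have "uniformly_continuous_on UNIV (\<lambda>z. Rm z + 2 *\<^sub>R A z)"
      by (intro uniformly_continuous_on_add ucRm(1) bounded_linear.uniformly_continuous_on[OF linA] bounded_linear.uniformly_continuous_on[OF bounded_linear_scaleR_right] uniformly_continuous_on_id)
    then show ?thesis by (simp add: Rm_def)
  qed
  define C0 where "C0 = \<eta> * (1 + c / 2)"
  have growth: "Q z - C0 \<le> Hb z" for z
  proof -
    have "Q z - C0 = \<eta> * ((Q z / \<eta> - 1) - c / 2)" using \<eta> by (simp add: C0_def field_simps)
    also have "\<dots> \<le> \<eta> * k (Q z / \<eta> - 1)" using \<eta> klow by (intro mult_left_mono) auto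
    finally show ?thesis using F0[of z] by (simp add: Hb_def)
  qed
  have contF: "continuous_on UNIV F" by (rule has_derivative_continuous_on, rule derivF)
  obtain Fm where Fm: "\<And>z. F z \<le> Fm" "Fm > 0"
  proof -
    have "bounded (F ` K)" by (intro compact_imp_bounded compact_continuous_image continuous_on_subset[OF contF] K) auto
    then obtain b where b: "\<And>z. z \<in> K \<Longrightarrow> norm (F z) \<le> b" by (auto simp: bounded_iff)
    have "F z \<le> max m b" for z using b[of z] FK[of z] by (cases "z \<in> K") auto
    then show thesis using that[of "max m b"] m0 by auto
  qed
  \<comment> \<open>Within \<rho>0 of the centre \<open>Hb\<close> vanishes. Farther out its growth
    is at most quadratic, and |z| \<ge> \<rho>0 lets a fourth power dominate both the constant and
    the quadratic term.\<close>
  define C4 where "C4 = (Fm + 2 * c0 * (norm x0)\<^sup>2) / \<rho>0^4 + 2 * c0 / \<rho>0\<^sup>2"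
  have C4: "C4 > 0" using Fm c0p \<rho>0 by (auto simp: C4_def intro!: add_pos_pos add_pos_nonneg divide_pos_pos)
  have flat: "Hb ((x0, 0) + z) \<le> C4 * (norm z)^4" for z
  proof (cases "norm z < \<rho>0")
    case True
    have d: "dist ((x0, 0) + z) (x0, 0) < \<rho>0" using True by (simp add: dist_norm)
    have "Q ((x0, 0) + z) < \<eta>" by (rule QK[OF x0K[OF d]])
    then have "Q ((x0, 0) + z) / \<eta> - 1 \<le> 0" using \<eta> by simp
    then have "Hb ((x0, 0) + z) = 0" using zero[OF d] k0 by (simp add: Hb_def)
    then show ?thesis using C4 by simp
  next
    case False
    let ?y = "(x0, 0) + z"
    have "\<eta> * k (Q ?y / \<eta> - 1) \<le> \<eta> * (Q ?y / \<eta>)"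
    proof (intro mult_left_mono)
      have "0 \<le> Q ?y / \<eta>" using \<eta> Q0[of ?y] by simp
      then have "max 0 (Q ?y / \<eta> - 1) \<le> Q ?y / \<eta>" by simp
      then show "k (Q ?y / \<eta> - 1) \<le> Q ?y / \<eta>" using kup[of "Q ?y / \<eta> - 1"] by linarith
    qed (use \<eta> in simp)
    then have 1: "Hb ?y \<le> Fm + Q ?y" using Fm(1)[of ?y] \<eta> by (simp add: Hb_def)
    have "norm ?y \<le> norm x0 + norm z" using norm_triangle_ineq[of "(x0, 0::'a)" z] by (simp add: norm_Pair)
    then have "(norm ?y)\<^sup>2 \<le> (norm x0 + norm z)\<^sup>2" by (intro power_mono) auto
    also have "\<dots> \<le> 2 * (norm x0)\<^sup>2 + 2 * (norm z)\<^sup>2" using sum_squares_bound[of "norm x0" "norm z"] by (simp add: power2_sum)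
    finally have "c0 * (norm ?y)\<^sup>2 \<le> c0 * (2 * (norm x0)\<^sup>2 + 2 * (norm z)\<^sup>2)" using c0p by (intro mult_left_mono) auto
    then have 2: "Hb ?y \<le> (Fm + 2 * c0 * (norm x0)\<^sup>2) + 2 * c0 * (norm z)\<^sup>2" using 1 Qup[of ?y] by (simp add: algebra_simps)
    define s where "s = norm z / \<rho>0"
    have s: "1 \<le> s" using False \<rho>0 by (simp add: s_def)
    have zs: "norm z = s * \<rho>0" using \<rho>0 by (simp add: s_def)
    have "(Fm + 2 * c0 * (norm x0)\<^sup>2) * 1 \<le> (Fm + 2 * c0 * (norm x0)\<^sup>2) * s^4"
      using s Fm c0p by (intro mult_left_mono one_le_power) auto
    moreover have "2 * c0 * (norm z)\<^sup>2 * 1 \<le> 2 * c0 * (norm z)\<^sup>2 * s\<^sup>2"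
      using s c0p by (intro mult_left_mono one_le_power) auto
    moreover have "C4 * (norm z)^4 = (Fm + 2 * c0 * (norm x0)\<^sup>2) * s^4 + 2 * c0 * (norm z)\<^sup>2 * s\<^sup>2"
      unfolding C4_def zs using \<rho>0 by (simp add: power_mult_distrib field_simps power4_eq_xxxx power2_eq_square)
    ultimately show ?thesis using 2 by (simp only: mult_1_right)
  qed
  have evenH: "Hb (q, - p) = Hb (q, p)" for q p by (simp add: Hb_def evenF Q_def)
  have disc: "ham_disc Bs u x0 Hb DH c0 \<theta> M C0 C4 N" if "2 \<le> N" for N
  proof
    show "norm (DH z - 2 *\<^sub>R (\<Sum>v\<in>Bs. ((if v = u then c0 else \<theta>) * (fst z \<bullet> v)) *\<^sub>R v,
                  \<Sum>v\<in>Bs. ((if v = u then c0 else \<theta>) * (snd z \<bullet> v)) *\<^sub>R v)) \<le> M" for z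
      using M[of z] by (simp add: Rm_def A_def cf_def)
    show "(\<Sum>v\<in>Bs. (if v = u then c0 else \<theta>) * ((fst z \<bullet> v)\<^sup>2 + (snd z \<bullet> v)\<^sup>2)) - C0 \<le> Hb z" for z
      using growth[of z] by (simp add: Q_def cf_def)
    show "0 \<le> Hb z" for z using F0[of z] kpos \<eta> by (simp add: Hb_def)
  qed (use finB orth Bs derivH ucH c0 \<theta> flat C4 evenH that in auto)
  define Kb where "Kb = M / min \<theta> (min (c0 - pi) (1/2))"
  define \<beta> where "\<beta> = 1 / (8 * (card Bs * C4))"
  have \<beta>: "\<beta> > 0"
  proof -
    have "card Bs > 0" using finB Bs(1) card_gt_0_iff by blast
    then show ?thesis using C4 by (simp add: \<beta>_def)
  qed
  obtain Ca where Ca: "\<And>z. norm (A z) \<le> norm z * Ca" "Ca > 0" using bounded_linear.pos_bounded[OF linA] by blast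
  define Cg where "Cg = M + 2 * Ca"
  have M0: "0 \<le> M" using M[of 0] norm_ge_zero order_trans by blast
  have Cg: "norm (DH z) \<le> Cg * (1 + norm z)" for z
  proof -
    have "norm (DH z) \<le> norm (Rm z) + norm (2 *\<^sub>R A z)" using norm_triangle_ineq[of "Rm z" "2 *\<^sub>R A z"] by (simp add: Rm_def)
    also have "\<dots> \<le> M + 2 * (norm z * Ca)" using M[of z] Ca(1)[of z] by simp
    also have "\<dots> \<le> Cg * (1 + norm z)" using M0 Ca(2) by (simp add: Cg_def algebra_simps)
    finally show ?thesis .
  qed
  have "\<exists>z. euler_scheme DH z (n + 2) Cg Kb \<and> (\<exists>j<2*(n+2). \<beta> \<le> DH (z (int j)) \<bullet> z (int j) / 2 - Hb (z (int j)))" for n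
  proof -
    interpret ham_disc Bs u x0 Hb DH c0 \<theta> M C0 C4 "n + 2" by (rule disc) simp
    show ?thesis
    proof (rule discrete_solution)
    fix z :: "int \<Rightarrow> 'a \<times> 'a" assume z:
      "\<And>j. snd (z (j + 1)) - snd (z j) = (1 / (4 * real (n + 2))) *\<^sub>R (fst (DH (z j)) + fst (DH (fst (z j), snd (z (j + 1)))))"
      "\<And>j. fst (z (j - 1)) - fst (z j) = (1 / (4 * real (n + 2))) *\<^sub>R (snd (DH (z j)) + snd (DH (fst (z (j - 1)), snd (z j))))"
      "\<And>j. z (j + 2 * int (n + 2)) = z j"
      "\<And>j. z (- j) = (fst (z (j - 1)), - snd (z j))"
      "(\<Sum>j<2*(n + 2). (norm (z (int j)))\<^sup>2) \<le> 2 * real (n + 2) * (M / min \<theta> (min (c0 - pi) (1/2)))\<^sup>2"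
      "\<exists>j<2*(n + 2). 1 / (8 * (card Bs * C4)) \<le> DH (z (int j)) \<bullet> z (int j) / 2 - Hb (z (int j))"
    have "euler_scheme DH z (n + 2) Cg Kb"
      by unfold_locales (use z Cg M0 Ca(2) \<theta> c0 in \<open>auto simp: Kb_def Cg_def\<close>)
    then show ?thesis using z(6) by (auto simp: \<beta>_def)
    qed
  qed
  then obtain zs where zs: "\<And>n. euler_scheme DH (zs n) (n + 2) Cg Kb"
    "\<And>n. \<exists>j<2*(n+2). \<beta> \<le> DH (zs n (int j)) \<bullet> zs n (int j) / 2 - Hb (zs n (int j))" by metis
  have contDH: "continuous_on UNIV DH" using ucH by (rule uniformly_continuous_imp_continuous)
  have contHb: "continuous_on UNIV Hb" by (rule has_derivative_continuous_on, rule derivH)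
  have "\<exists>X. (\<forall>t. (X has_vector_derivative sympl (DH (X t))) (at t)) \<and> (\<forall>t. X (t + 1) = X t)
      \<and> (\<forall>t. X (- t) = (fst (X t), - snd (X t))) \<and> (\<exists>t. \<beta> \<le> DH (X t) \<bullet> X t / 2 - Hb (X t))"
    by (rule limit_orbit[OF zs(1) contDH contHb zs(2)]) blast
  then obtain X where X: "\<And>t. (X has_vector_derivative sympl (DH (X t))) (at t)" "\<And>t. X (t + 1) = X t"
    "\<And>t. X (- t) = (fst (X t), - snd (X t))" "\<exists>t. \<beta> \<le> DH (X t) \<bullet> X t / 2 - Hb (X t)"
    by blast
  have inner: "DH z = DF z" "Hb z = F z" if "Q z < \<eta>" for z
  proof -
    have "Q z / \<eta> - 1 \<le> 0" using that \<eta> by simp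
    then show "DH z = DF z" "Hb z = F z" using k0 by (simp_all add: DH_def Hb_def)
  qed
  \<comment> \<open>At these times the orbit lies in \<open>K\<close>, where the extension agrees
    with \<open>F\<close>. Connectedness of the line will extend this to all times.\<close>
  define T where "T = {t. DF (X t) \<noteq> 0}"
  have contX: "continuous_on UNIV X"
    using X(1) has_vector_derivative_continuous by (intro continuous_at_imp_continuous_on) blast
  have TK: "X t \<in> K" if "t \<in> T" for t using that DFK[of "X t"] by (auto simp: T_def)
  have contDX: "continuous_on UNIV (\<lambda>t. DF (X t))" by (rule continuous_on_compose2[OF contDF contX]) auto
  have "T \<noteq> {}"
  proof -
    obtain t where t: "\<beta> \<le> DH (X t) \<bullet> X t / 2 - Hb (X t)" using X(4) by blast
    define q where "q = Q (X t)"
    have "q < \<eta>"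
    proof (rule ccontr)
      assume "\<not> q < \<eta>"
      then have q: "\<eta> \<le> q" by simp
      then have nK: "X t \<notin> K" using QK[of "X t"] by (auto simp: q_def)
      define r where "r = q / \<eta> - 1"
      have r: "0 \<le> r" "q = \<eta> * (1 + r)" using q \<eta> by (auto simp: r_def)
      have "DH (X t) \<bullet> X t / 2 - Hb (X t) = \<eta> * (k' r * (1 + r) - k r) - m"
        using AQ[of "X t"] FK[OF nK] DFK[OF nK] by (simp add: DH_def Hb_def r_def[symmetric] q_def[symmetric] r(2)) (simp add: algebra_simps)
      also have "\<dots> \<le> \<eta> * (1 + c / 2) - m" using kk[OF r(1)] \<eta> by simp
      finally show False using t \<beta> c(2) by simp
    qed
    then have "\<beta> \<le> DF (X t) \<bullet> X t / 2 - F (X t)" using t inner[of "X t"] by (simp add: q_def)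
    then have "DF (X t) \<noteq> 0" using \<beta> F0[of "X t"] by auto
    then show ?thesis by (auto simp: T_def)
  qed
  moreover have "open T"
  proof -
    have "T = (\<lambda>t. DF (X t)) -` (- {0})" by (auto simp: T_def)
    then show ?thesis using contDX by (simp only:) (rule open_vimage[OF open_Compl[OF closed_singleton]])
  qed
  moreover have "closed T"
    unfolding closed_sequential_limits
  proof (intro allI impI)
    fix s t assume st: "(\<forall>n. s n \<in> T) \<and> s \<longlonglongrightarrow> t"
    have "(\<lambda>n. X (s n)) \<longlonglongrightarrow> X t" using st by (intro continuous_on_tendsto_compose[OF contX]) auto
    moreover have "X (s n) \<in> K" for n using TK st by auto
    ultimately have XK: "X t \<in> K" by (rule closed_sequentially[OF compact_imp_closed[OF K], rotated])
    \<comment> \<open>A limit of such times cannot be an equilibrium: the orbit would be constant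
      near it, against the nonzero gradients at nearby times.\<close>
    show "t \<in> T"
    proof (rule ccontr)
      assume "t \<notin> T"
      then have "DF (X t) = 0" by (simp add: T_def)
      then obtain L d where Ld: "d > 0" "\<And>y. dist y (X t) < d \<Longrightarrow> norm (DF y) \<le> L * dist y (X t)" using equil by blast
      have "open {t. Q (X t) < \<eta>}"
        by (intro open_Collect_less continuous_on_compose2[OF contQ contX] continuous_on_const) auto
      then obtain r0 where r0: "r0 > 0" "ball t r0 \<subseteq> {t. Q (X t) < \<eta>}"
        using QK[OF XK] open_contains_ball by (metis (mono_tags) mem_Collect_eq)
      have "\<exists>r>0. \<forall>s. \<bar>s - t\<bar> < r \<longrightarrow> X s = X t"
      proof (rule stationary_near_equilibrium[of r0 t X "\<lambda>y. sympl (DF y)" d L])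
        fix s assume "\<bar>s - t\<bar> < r0"
        then have "s \<in> ball t r0" by (simp add: dist_real_def abs_minus_commute)
        then have "Q (X s) < \<eta>" using r0(2) by blast
        then show "(X has_vector_derivative sympl (DF (X s))) (at s)" using X(1)[of s] inner by simp
      next
        fix y assume "dist y (X t) < d"
        then show "norm (sympl (DF y)) \<le> L * dist y (X t)" using Ld(2) by simp
      next
        show "r0 > 0" "d > 0" by (rule r0, rule Ld)
      qed
      then obtain r where r: "r > 0" "\<And>s. \<bar>s - t\<bar> < r \<Longrightarrow> X s = X t" by blast
      obtain n where "\<bar>s n - t\<bar> < r" using LIMSEQ_D[of s t r] st r(1) by auto
      then have "X (s n) = X t" by (rule r(2))
      moreover have "DF (X (s n)) \<noteq> 0" using st by (simp add: T_def)
      ultimately show False using \<open>DF (X t) = 0\<close> by simp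
    qed
  qed
  ultimately have "T = UNIV" using clopen by blast
  then have nz: "DF (X t) \<noteq> 0" and XK: "X t \<in> K" for t using TK by (auto simp: T_def)
  have "(X has_vector_derivative sympl (DF (X t))) (at t)" for t
    using X(1)[of t] inner(1)[OF QK[OF XK]] by simp
  then show ?thesis using X nz XK by blast
qed

subsection \<open>The upper bound for strips\<close>

text \<open>The cotangent lift of \<open>g\<close> with \<open>g' = sqrt (R\<^sup>2 - s\<^sup>2)\<close> carries the disc of radius \<open>R\<close> onto a
  rectangle of the same area \<open>pi R\<^sup>2\<close>, is symplectic and commutes with \<open>tau0\<close>.\<close>

locale cot_lift =
  fixes u :: "'a::euclidean_space" and c R :: real and g :: "real \<Rightarrow> real"
  assumes u: "norm u = 1" and R: "R > 0"
    and gd: "\<And>s. \<bar>s\<bar> < R \<Longrightarrow> (g has_real_derivative sqrt (R\<^sup>2 - s\<^sup>2)) (at s)"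
begin

text \<open>The half-height of the disc over s, that is g'. Dividing the component of
  \<open>p\<close> along \<open>u\<close> by it turns |p| < sg s into |p| < 1; components orthogonal
  to \<open>u\<close> are left alone.\<close>

definition "sg s = sqrt (R\<^sup>2 - s\<^sup>2)"
definition "Psi z = (fst z + (g (fst z \<bullet> u) + c - fst z \<bullet> u) *\<^sub>R u,
   snd z + (snd z \<bullet> u / sg (fst z \<bullet> u) - snd z \<bullet> u) *\<^sub>R u)"
definition "DPsi z w = (fst w + ((sg (fst z \<bullet> u) - 1) * (fst w \<bullet> u)) *\<^sub>R u,
   snd w + (snd w \<bullet> u / sg (fst z \<bullet> u) + (snd z \<bullet> u) * (fst z \<bullet> u) / (sg (fst z \<bullet> u))^3 * (fst w \<bullet> u) - snd w \<bullet> u) *\<^sub>R u)"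
definition "DPsiT z w = (fst w + ((sg (fst z \<bullet> u) - 1) * (fst w \<bullet> u) + (snd z \<bullet> u) * (fst z \<bullet> u) / (sg (fst z \<bullet> u))^3 * (snd w \<bullet> u)) *\<^sub>R u,
   snd w + ((1 / sg (fst z \<bullet> u) - 1) * (snd w \<bullet> u)) *\<^sub>R u)"

lemma uu: "u \<bullet> u = 1" using u by (simp add: norm_eq_1)

lemma sg_pos: "\<bar>s\<bar> < R \<Longrightarrow> 0 < sg s"
  using power_strict_mono[of "\<bar>s\<bar>" R 2] by (simp add: sg_def)

lemma sg_deriv: "\<bar>s\<bar> < R \<Longrightarrow> (sg has_real_derivative - s / sg s) (at s)"
proof -
  assume s: "\<bar>s\<bar> < R"
  have "R\<^sup>2 - s\<^sup>2 > 0" using power_strict_mono[of "\<bar>s\<bar>" R 2] s by simp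
  then show ?thesis unfolding sg_def by (auto intro!: derivative_eq_intros simp: field_simps)
qed

lemma Psi_deriv: "\<bar>fst z \<bullet> u\<bar> < R \<Longrightarrow> (Psi has_derivative DPsi z) (at z)"
proof -
  assume z: "\<bar>fst z \<bullet> u\<bar> < R"
  let ?s = "fst z \<bullet> u"
  have sp: "sg ?s > 0" using sg_pos[OF z] .
  have l: "((\<lambda>z. fst z \<bullet> u) has_derivative (\<lambda>w. fst w \<bullet> u)) (at z)"
    by (auto intro!: derivative_eq_intros)
  have g: "((\<lambda>z. g (fst z \<bullet> u)) has_derivative (\<lambda>w. (fst w \<bullet> u) * sg ?s)) (at z)"
    unfolding sg_def by (rule DERIV_compose_FDERIV[OF gd[OF z] l])
  have s: "((\<lambda>z. sg (fst z \<bullet> u)) has_derivative (\<lambda>w. (fst w \<bullet> u) * (- ?s / sg ?s))) (at z)"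
    by (rule DERIV_compose_FDERIV[OF sg_deriv[OF z] l])
  have d: "((\<lambda>z. snd z \<bullet> u / sg (fst z \<bullet> u)) has_derivative
      (\<lambda>w. snd w \<bullet> u / sg ?s + (snd z \<bullet> u) * ?s / (sg ?s)^3 * (fst w \<bullet> u))) (at z)"
    by (rule has_derivative_eq_rhs[OF has_derivative_divide'[OF _ s]])
       (use sp in \<open>auto intro!: derivative_eq_intros simp: field_simps power2_eq_square power3_eq_cube\<close>)
  have "(Psi has_derivative (\<lambda>w. (fst w + ((fst w \<bullet> u) * sg ?s + 0 - fst w \<bullet> u) *\<^sub>R u,
      snd w + ((snd w \<bullet> u / sg ?s + (snd z \<bullet> u) * ?s / (sg ?s)^3 * (fst w \<bullet> u)) - snd w \<bullet> u) *\<^sub>R u))) (at z)"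
    unfolding Psi_def
    by (intro has_derivative_Pair has_derivative_add has_derivative_scaleR_left has_derivative_diff g d l
        has_derivative_const has_derivative_fst has_derivative_snd has_derivative_ident has_derivative_inner_left)
  moreover have "DPsi z = (\<lambda>w. (fst w + ((fst w \<bullet> u) * sg ?s + 0 - fst w \<bullet> u) *\<^sub>R u,
      snd w + ((snd w \<bullet> u / sg ?s + (snd z \<bullet> u) * ?s / (sg ?s)^3 * (fst w \<bullet> u)) - snd w \<bullet> u) *\<^sub>R u))"
    by (rule ext) (simp add: DPsi_def algebra_simps)
  ultimately show ?thesis by simp
qed

lemma DPsiT_adjoint: "w \<bullet> DPsi z v = DPsiT z w \<bullet> v"
  by (simp add: DPsi_def DPsiT_def inner_prod_def inner_add_left inner_add_right inner_commute algebra_simps)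

text \<open>Symplecticity in the form D J D^T = J, which sends the Hamiltonian field of the
  pulled-back function to that of the original.\<close>

lemma DPsi_sympl: "\<bar>fst z \<bullet> u\<bar> < R \<Longrightarrow> DPsi z (sympl (DPsiT z w)) = sympl w"
proof -
  assume z: "\<bar>fst z \<bullet> u\<bar> < R"
  have sp: "sg (fst z \<bullet> u) > 0" using sg_pos[OF z] .
  define s where "s = sg (fst z \<bullet> u)"
  define k where "k = (snd z \<bullet> u) * (fst z \<bullet> u) / s^3"
  have s: "s > 0" using sp by (simp add: s_def)
  define a b where "a = fst w \<bullet> u" and "b = snd w \<bullet> u"
  define A B where "A = (s - 1) * a + k * b" and "B = (1 / s - 1) * b"
  have T: "DPsiT z w = (fst w + A *\<^sub>R u, snd w + B *\<^sub>R u)"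
    by (simp add: DPsiT_def A_def B_def k_def s_def a_def b_def)
  have au: "(fst w + A *\<^sub>R u) \<bullet> u = s * a + k * b" by (simp add: inner_add_left uu A_def a_def algebra_simps)
  have bu: "(snd w + B *\<^sub>R u) \<bullet> u = b / s" using s by (simp add: inner_add_left uu B_def b_def field_simps)
  have e1: "(s - 1) * (b / s) = - B" using s by (simp add: B_def field_simps)
  have e2: "(s * a + k * b) / s + k * (- (b / s)) - (s * a + k * b) = - A" using s by (simp add: A_def field_simps)
  have "DPsi z (sympl (DPsiT z w)) =
    (- (snd w + B *\<^sub>R u) + ((s - 1) * (- (b / s))) *\<^sub>R u,
     fst w + A *\<^sub>R u + ((s * a + k * b) / s + k * (- (b / s)) - (s * a + k * b)) *\<^sub>R u)"
    unfolding T sympl_def DPsi_def fst_conv snd_conv inner_minus_left au bu s_def[symmetric] k_def[symmetric] ..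
  also have "\<dots> = sympl w" unfolding e2 using e1 by (simp add: sympl_def)
  finally show ?thesis .
qed

lemma differentiable_fst_comp:
  assumes "h differentiable (at (fst z \<bullet> u))"
  shows "(\<lambda>z. h (fst z \<bullet> u)) differentiable (at (z :: 'a \<times> 'a))"
proof -
  have "(\<lambda>z::'a \<times> 'a. fst z \<bullet> u) differentiable (at z)"
    unfolding differentiable_def by (rule exI) (auto intro!: derivative_eq_intros)
  from differentiable_chain_at[OF this assms] show ?thesis by (simp add: o_def)
qed

lemma DPsiT_differentiable:
  assumes z: "\<bar>fst z \<bullet> u\<bar> < R" and A: "A differentiable (at z)"
  shows "(\<lambda>y. DPsiT y (A y)) differentiable (at z)"
proof -
  have sp: "sg (fst z \<bullet> u) > 0" using sg_pos[OF z] .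
  have d: "sg differentiable (at (fst z \<bullet> u))" using sg_deriv[OF z] real_differentiable_def by blast
  have d1: "(\<lambda>y. sg (fst y \<bullet> u)) differentiable (at z)" by (rule differentiable_fst_comp[OF d])
  have lin: "(\<lambda>y. fst y \<bullet> u) differentiable (at z)" "(\<lambda>y. snd y \<bullet> u) differentiable (at z)"
    unfolding differentiable_def by (rule exI, force intro!: derivative_eq_intros)+
  have fA: "(\<lambda>y. fst (A y)) differentiable (at z)" "(\<lambda>y. snd (A y)) differentiable (at z)"
    using A unfolding differentiable_def by (blast intro: has_derivative_fst has_derivative_snd)+
  have iA: "(\<lambda>y. r y \<bullet> u) differentiable (at z)" if "r differentiable (at z)" for r :: "'a \<times> 'a \<Rightarrow> 'a"
    using that unfolding differentiable_def by (blast intro: has_derivative_inner_left)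
  have pair: "(\<lambda>y. (f y, h y)) differentiable (at z)" if "f differentiable (at z)" "h differentiable (at z)" for f h :: "'a \<times> 'a \<Rightarrow> 'a"
    using that unfolding differentiable_def by (blast intro: has_derivative_Pair)
  have sc: "(\<lambda>y. r y *\<^sub>R u) differentiable (at z)" if "r differentiable (at z)" for r :: "'a \<times> 'a \<Rightarrow> real"
    using that unfolding differentiable_def by (blast intro: has_derivative_scaleR_left)
  show ?thesis unfolding DPsiT_def using sp
    by (intro pair differentiable_add sc fA differentiable_mult differentiable_diff differentiable_divide
        differentiable_power differentiable_const d1 lin iA fA) auto
qed

end

text \<open>An elementary antiderivative of the half-height. Its value at \<open>R\<close> is the
  area of a quarter disc, so the rectangle [-g R, g R] x [-1, 1] has the area of the disc.\<close>

lemma disc_profile: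
  fixes R :: real
  assumes R: "R > 0"
  obtains g where "\<And>s. \<bar>s\<bar> < R \<Longrightarrow> (g has_real_derivative sqrt (R\<^sup>2 - s\<^sup>2)) (at s)"
    "continuous_on {-R..R} g" "g R = pi * R\<^sup>2 / 4" "\<And>s. g (- s) = - g s"
proof -
  \<comment> \<open>The value 0 beyond the domain of arcsin keeps \<open>g\<close> odd on the whole
    line.\<close>
  define g where "g s = (s * sqrt (R\<^sup>2 - s\<^sup>2) + R\<^sup>2 * (if \<bar>s\<bar> \<le> R then arcsin (s / R) else 0)) / 2" for s
  show thesis
  proof
    fix s assume s: "\<bar>s\<bar> < R"
    define q where "q = sqrt (R\<^sup>2 - s\<^sup>2)"
    have pos: "R\<^sup>2 - s\<^sup>2 > 0" using power_strict_mono[of "\<bar>s\<bar>" R 2] s by simp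
    have q: "q > 0" "q\<^sup>2 = R\<^sup>2 - s\<^sup>2" using pos by (auto simp: q_def)
    have sR: "-1 < s / R" "s / R < 1" using s R by (auto simp: field_simps abs_less_iff)
    have asn: "((\<lambda>s. arcsin (s / R)) has_real_derivative inverse (sqrt (1 - (s / R)\<^sup>2)) * (1 / R)) (at s)"
      by (rule DERIV_chain2[where f = arcsin and g = "\<lambda>s. s / R", OF DERIV_arcsin[OF sR]])
        (use R in \<open>auto intro!: derivative_eq_intros\<close>)
    have "sqrt (1 - (s / R)\<^sup>2) = q / R"
    proof -
      have "1 - (s / R)\<^sup>2 = (R\<^sup>2 - s\<^sup>2) / R\<^sup>2" using R by (simp add: field_simps power_divide)
      then show ?thesis using R by (simp add: real_sqrt_divide q_def)
    qed
    then have asn': "((\<lambda>s. arcsin (s / R)) has_real_derivative 1 / q) (at s)" using asn R by simp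
    have sq: "((\<lambda>s. sqrt (R\<^sup>2 - s\<^sup>2)) has_real_derivative - s / q) (at s)"
      using pos unfolding q_def by (auto intro!: derivative_eq_intros simp: field_simps)
    have "((\<lambda>s. (s * sqrt (R\<^sup>2 - s\<^sup>2) + R\<^sup>2 * arcsin (s / R)) / 2) has_real_derivative
        (1 * q + (- s / q) * s + R\<^sup>2 * (1 / q)) / 2) (at s)"
      unfolding q_def by (intro DERIV_cdivide DERIV_add DERIV_mult DERIV_cmult DERIV_ident sq[unfolded q_def] asn'[unfolded q_def])
    also have "(1 * q + (- s / q) * s + R\<^sup>2 * (1 / q)) / 2 = q"
    proof -
      have "(1 * q + (- s / q) * s + R\<^sup>2 * (1 / q)) / 2 = (q\<^sup>2 + (R\<^sup>2 - s\<^sup>2)) / (2 * q)"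
        using q(1) by (simp add: field_simps power2_eq_square)
      also have "\<dots> = (q * q + q * q) / (2 * q)" unfolding q(2)[symmetric] by (simp add: power2_eq_square)
      also have "\<dots> = q" using q(1) by simp
      finally show ?thesis .
    qed
    finally show "(g has_real_derivative sqrt (R\<^sup>2 - s\<^sup>2)) (at s)"
      unfolding q_def by (rule has_field_derivative_transform_within[where d = "R - \<bar>s\<bar>"])
        (use s in \<open>auto simp: g_def dist_real_def\<close>)
  next
    have "continuous_on {-R..R} (\<lambda>s. (s * sqrt (R\<^sup>2 - s\<^sup>2) + R\<^sup>2 * arcsin (s / R)) / 2)"
      using R by (intro continuous_intros) (auto simp: field_simps)
    then show "continuous_on {-R..R} g"
      by (rule continuous_on_eq) (auto simp: g_def)
    show "g R = pi * R\<^sup>2 / 4" using R by (simp add: g_def)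
    show "g (- s) = - g s" for s
      using R arcsin_minus[of "s / R"] by (auto simp: g_def field_simps abs_le_iff)
  qed
qed

lemma smooth_onD:
  assumes "smooth_on U f"
  shows "f differentiable_on U" "smooth_on U (\<lambda>z. frechet_derivative f (at z) v)"
  using assms by (auto elim: smooth_on.cases)

lemma differentiable_imp_lipschitz_at:
  assumes "f differentiable (at z)"
  shows "\<exists>L d. d > 0 \<and> (\<forall>y. dist y z < d \<longrightarrow> norm (f y - f z) \<le> L * dist y z)"
proof -
  obtain f' where f': "(f has_derivative f') (at z)" using assms by (auto simp: differentiable_def)
  then obtain B where B: "\<And>x. norm (f' x) \<le> norm x * B"
    using bounded_linear.pos_bounded[OF has_derivative_bounded_linear[OF f']] by blast
  obtain d where d: "d > 0" "\<And>y. norm (y - z) < d \<Longrightarrow> norm (f y - f z - f' (y - z)) \<le> 1 * norm (y - z)"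
    using f' unfolding has_derivative_at_alt by (metis zero_less_one)
  have "norm (f y - f z) \<le> (1 + B) * dist y z" if "dist y z < d" for y
  proof -
    have "norm (f y - f z) \<le> norm (f y - f z - f' (y - z)) + norm (f' (y - z))"
      using norm_triangle_ineq[of "f y - f z - f' (y - z)" "f' (y - z)"] by simp
    also have "\<dots> \<le> 1 * norm (y - z) + norm (y - z) * B" using that by (intro add_mono d(2) B) (simp add: dist_norm)
    finally show ?thesis by (simp add: dist_norm algebra_simps)
  qed
  then show ?thesis using d(1) by blast
qed

text \<open>If m > 4a, the pull-back of \<open>H\<close> by the cotangent lift equals
  \<open>m\<close> off a compact part of a round cylinder of area 4a, where a symmetric orbit
  exists; its image is an orbit with T = 1 that admissibility forbids.\<close>

theorem HZ_admissible_strip_bound: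
  fixes U :: "'n::finite ps set" and u :: "real^'n" and a c m :: real
  assumes U: "open U" "\<And>z. z \<in> U \<Longrightarrow> tau0 z \<in> U" and u: "norm u = 1" and a: "a > 0"
    and strip: "\<And>z. z \<in> U \<Longrightarrow> \<bar>fst z \<bullet> u - c\<bar> < a \<and> \<bar>snd z \<bullet> u\<bar> < 1"
    and adm: "HZ_admissible U H m"
  shows "m \<le> 4 * a"
proof (rule ccontr)
  assume "\<not> m \<le> 4 * a"
  then have m: "4 * a < m" by simp
  \<comment> \<open>Equal areas: pi R^2 is the area of a rectangle with sides 2a and 2.\<close>
  define R where "R = sqrt (4 * a / pi)"
  have R: "R > 0" using a by (simp add: R_def)
  have R2: "pi * R\<^sup>2 = 4 * a" using a by (simp add: R_def)
  obtain g where g: "\<And>s. \<bar>s\<bar> < R \<Longrightarrow> (g has_real_derivative sqrt (R\<^sup>2 - s\<^sup>2)) (at s)"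
    "continuous_on {-R..R} g" "g R = pi * R\<^sup>2 / 4" "\<And>s. g (- s) = - g s" using disc_profile[OF R] by blast
  have gR: "g R = a" "g (- R) = - a" using g(3,4) R2 by auto
  interpret cot_lift u c R g by unfold_locales (use u R g in auto)
  have smooth: "smooth_on U H" and H0: "\<And>z. z \<in> U \<Longrightarrow> 0 \<le> H z"
    and Htau: "\<And>z. z \<in> U \<Longrightarrow> H (tau0 z) = H z"
    using adm U(2) by (auto simp: HZ_admissible_def)
  have "\<exists>V. open V \<and> V \<noteq> {} \<and> V \<subseteq> U \<and> V \<inter> Fix_tau0 \<noteq> {} \<and> (\<forall>z\<in>V. H z = 0)"
    using adm unfolding HZ_admissible_def by (elim conjE)
  then obtain V where V: "open V" "V \<subseteq> U" "V \<inter> Fix_tau0 \<noteq> {}" "\<And>z. z \<in> V \<Longrightarrow> H z = 0" by blast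
  have "\<exists>K. compact K \<and> K \<subseteq> U \<and> (\<forall>z\<in>U - K. H z = m)"
    using adm unfolding HZ_admissible_def by (elim conjE)
  then obtain K where K: "compact K" "K \<subseteq> U" "\<And>z. z \<in> U - K \<Longrightarrow> H z = m" by blast
  have "\<not> (\<exists>T x. 0 < T \<and> T \<le> 1 \<and> sym_periodic_orbit U H T x)"
    using adm unfolding HZ_admissible_def by (elim conjE)
  then have noorb: "\<not> sym_periodic_orbit U H 1 x" for x by (metis zero_less_one order_refl)
  define dH where "dH z = (\<Sum>b\<in>Basis. frechet_derivative H (at z) b *\<^sub>R b)" for z
  have dH: "(H has_derivative (\<lambda>w. dH z \<bullet> w)) (at z)" if z: "z \<in> U" for z
  proof -
    have "H differentiable (at z)" using smooth_onD(1)[OF smooth] differentiable_on_eq_differentiable_at[OF U(1)] z by blast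
    then have d: "(H has_derivative frechet_derivative H (at z)) (at z)" by (simp add: frechet_derivative_works)
    then have l: "linear (frechet_derivative H (at z))" using has_derivative_linear by blast
    have "frechet_derivative H (at z) w = dH z \<bullet> w" for w
    proof -
      have "frechet_derivative H (at z) w = frechet_derivative H (at z) (\<Sum>b\<in>Basis. (w \<bullet> b) *\<^sub>R b)" by (simp add: euclidean_representation)
      also have "\<dots> = (\<Sum>b\<in>Basis. (w \<bullet> b) * frechet_derivative H (at z) b)"
        by (simp add: linear_sum[OF l] linear_scale[OF l])
      also have "\<dots> = dH z \<bullet> w"
        unfolding dH_def inner_sum_left inner_scaleR_left by (simp add: mult.commute inner_commute)
      finally show ?thesis .
    qed
    then have "frechet_derivative H (at z) = (\<lambda>w. dH z \<bullet> w)" by blast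
    with d show ?thesis by simp
  qed
  have dHdiff: "dH differentiable (at z)" if z: "z \<in> U" for z
  proof -
    have fd: "(\<lambda>z. frechet_derivative H (at z) b) differentiable (at z)" for b
      using smooth_onD(1)[OF smooth_onD(2)[OF smooth]] differentiable_on_eq_differentiable_at[OF U(1)] z by blast
    have "(\<lambda>z. frechet_derivative H (at z) b *\<^sub>R b) differentiable (at z)" for b
    proof -
      obtain D where "((\<lambda>z. frechet_derivative H (at z) b) has_derivative D) (at z)"
        using fd[of b] by (auto simp: differentiable_def)
      from has_derivative_scaleR_left[OF this, of b] show ?thesis unfolding differentiable_def by blast
    qed
    then show ?thesis unfolding dH_def by (intro differentiable_sum) auto
  qed
  define W where "W = {z :: 'n ps. (fst z \<bullet> u)\<^sup>2 + (snd z \<bullet> u)\<^sup>2 < R\<^sup>2}"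
  have openW: "open W" unfolding W_def by (intro open_Collect_less continuous_intros)
  have WR: "\<bar>fst z \<bullet> u\<bar> < R" if "z \<in> W" for z
  proof -
    have "(fst z \<bullet> u)\<^sup>2 < R\<^sup>2" using that zero_le_power2[of "snd z \<bullet> u"] unfolding W_def mem_Collect_eq by linarith
    then show ?thesis using R abs_square_less_1 power2_less_imp_less[of "\<bar>fst z \<bullet> u\<bar>" R] by simp
  qed
  have contPsi: "continuous_on W Psi"
    using Psi_deriv[OF WR] has_derivative_continuous by (intro continuous_at_imp_continuous_on) blast
  define W' where "W' = W \<inter> Psi -` U"
  have openW': "open W'" unfolding W'_def by (intro continuous_open_preimage contPsi openW U(1))
  define K' where "K' = W \<inter> Psi -` K"
  have K'W': "K' \<subseteq> W'" using K(2) by (auto simp: K'_def W'_def)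
  define F where "F z = (if z \<in> W' then H (Psi z) else m)" for z
  define DF where "DF z = (if z \<in> W' then DPsiT z (dH (Psi z)) else 0)" for z
  have Psiu: "fst (Psi z) \<bullet> u = g (fst z \<bullet> u) + c" "snd (Psi z) \<bullet> u = snd z \<bullet> u / sg (fst z \<bullet> u)" for z
    by (simp_all add: Psi_def inner_add_left uu)
  have gmono: "g s \<le> g t" if "-R \<le> s" "s \<le> t" "t \<le> R" for s t
  proof (rule DERIV_nonneg_imp_increasing_open[OF that(2)])
    show "\<exists>y. (g has_real_derivative y) (at x) \<and> 0 \<le> y" if "s < x" "x < t" for x
      using g(1)[of x] that \<open>-R \<le> s\<close> \<open>t \<le> R\<close> by (intro exI[of _ "sqrt (R\<^sup>2 - x\<^sup>2)"]) (auto intro!: power_mono simp: abs_le_square_iff[symmetric])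
    show "continuous_on {s..t} g" by (rule continuous_on_subset[OF g(2)]) (use that in auto)
  qed
  \<comment> \<open>The lift degenerates at the boundary circle, so compactness of the preimage is
    not automatic. \<open>K\<close> lies in a strictly smaller rectangle, which confines its
    preimage to the set \<open>C\<close>, closed in the whole space and contained in
    \<open>W\<close>.\<close>
  have compK': "compact K'"
  proof (cases "K = {}")
    case True
    then show ?thesis by (simp add: K'_def)
  next
    case False
    obtain z1 where z1: "z1 \<in> K" "\<And>z. z \<in> K \<Longrightarrow> \<bar>fst z \<bullet> u - c\<bar> \<le> \<bar>fst z1 \<bullet> u - c\<bar>"
      using continuous_attains_sup[OF K(1) False, of "\<lambda>z. \<bar>fst z \<bullet> u - c\<bar>"] by (force intro!: continuous_intros)
    obtain z2 where z2: "z2 \<in> K" "\<And>z. z \<in> K \<Longrightarrow> \<bar>snd z \<bullet> u\<bar> \<le> \<bar>snd z2 \<bullet> u\<bar>"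
      using continuous_attains_sup[OF K(1) False, of "\<lambda>z. \<bar>snd z \<bullet> u\<bar>"] by (force intro!: continuous_intros)
    define b where "b = \<bar>snd z2 \<bullet> u\<bar>"
    define a1 where "a1 = \<bar>fst z1 \<bullet> u - c\<bar>"
    have b: "0 \<le> b" "b < 1" using strip[of z2] z2(1) K(2) by (auto simp: b_def)
    have a1: "a1 < a" using strip[of z1] z1(1) K(2) by (auto simp: a1_def)
    obtain r1 where r1: "0 \<le> r1" "r1 < R" "a1 < g r1"
    proof -
      have "\<exists>s\<ge>0. s \<le> R \<and> g s = max 0 ((a1 + a) / 2)"
      proof (rule IVT')
        have "g 0 = 0" using g(4)[of 0] by simp
        then show "g 0 \<le> max 0 ((a1 + a) / 2)" by simp
        show "max 0 ((a1 + a) / 2) \<le> g R" using a1 a gR by simp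
        show "continuous_on {0..R} g" by (rule continuous_on_subset[OF g(2)]) (use R in auto)
      qed (use R in simp)
      then obtain s where s: "0 \<le> s" "s \<le> R" "g s = max 0 ((a1 + a) / 2)" by blast
      have "g s < a" "a1 < g s" using s(3) a1 a by (auto simp: max_def)
      then show thesis using that[of s] s gR by (cases "s = R") auto
    qed
    define C where "C = {z :: 'n ps. \<bar>fst z \<bullet> u\<bar> \<le> r1 \<and> \<bar>snd z \<bullet> u\<bar> \<le> b * sg (fst z \<bullet> u)}"
    have closedC: "closed C" unfolding C_def sg_def
      by (intro closed_Collect_conj closed_Collect_le continuous_intros)
    have CW: "C \<subseteq> W"
    proof
      fix z assume z: "z \<in> C"
      then have s: "\<bar>fst z \<bullet> u\<bar> < R" using r1 by (auto simp: C_def)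
      have sp: "0 < sg (fst z \<bullet> u)" by (rule sg_pos[OF s])
      have "b * sg (fst z \<bullet> u) < 1 * sg (fst z \<bullet> u)" using b sp by (intro mult_strict_right_mono) auto
      then have "\<bar>snd z \<bullet> u\<bar> < sg (fst z \<bullet> u)" using z by (auto simp: C_def)
      then have "\<bar>snd z \<bullet> u\<bar>\<^sup>2 < (sg (fst z \<bullet> u))\<^sup>2" by (intro power_strict_mono) auto
      also have "(sg (fst z \<bullet> u))\<^sup>2 = R\<^sup>2 - (fst z \<bullet> u)\<^sup>2" using sp unfolding sg_def by simp
      finally show "z \<in> W" by (simp add: W_def)
    qed
    have K'C: "K' = C \<inter> Psi -` K"
    proof (intro equalityI subsetI)
      fix z assume z: "z \<in> K'"
      then have zW: "z \<in> W" and PK: "Psi z \<in> K" by (auto simp: K'_def)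
      let ?s = "fst z \<bullet> u"
      have s: "\<bar>?s\<bar> < R" by (rule WR[OF zW])
      have sp: "0 < sg ?s" by (rule sg_pos[OF s])
      have "\<bar>g ?s\<bar> \<le> a1" using z1(2)[OF PK] by (simp add: Psiu a1_def)
      then have gs: "\<bar>g ?s\<bar> < g r1" using r1 by simp
      have "\<bar>?s\<bar> \<le> r1"
      proof (rule ccontr)
        assume "\<not> \<bar>?s\<bar> \<le> r1"
        then have "g r1 \<le> g \<bar>?s\<bar>" using s r1 by (intro gmono) auto
        also have "g \<bar>?s\<bar> \<le> \<bar>g ?s\<bar>" using g(4)[of ?s] by (auto simp: abs_if)
        finally show False using gs by simp
      qed
      moreover have "\<bar>snd z \<bullet> u\<bar> \<le> b * sg ?s"
        using z2(2)[OF PK] sp by (simp add: Psiu b_def[symmetric] abs_divide pos_divide_le_eq)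
      ultimately show "z \<in> C \<inter> Psi -` K" using PK by (simp add: C_def)
    qed (use CW in \<open>auto simp: K'_def\<close>)
    have "closed K'" unfolding K'C
      by (intro continuous_closed_preimage continuous_on_subset[OF contPsi CW] closedC compact_imp_closed K(1))
    moreover have "bounded K'"
    proof -
      obtain B where B: "\<And>z. z \<in> K \<Longrightarrow> norm z \<le> B" using compact_imp_bounded[OF K(1)] unfolding bounded_iff by blast
      have "norm z \<le> 2 * B + (a + \<bar>c\<bar> + R) + (1 + R)" if z: "z \<in> K'" for z
      proof -
        have zW: "z \<in> W" and PK: "Psi z \<in> K" using z by (auto simp: K'_def)
        have s: "\<bar>fst z \<bullet> u\<bar> < R" by (rule WR[OF zW])
        have t: "\<bar>snd z \<bullet> u\<bar> < R"
        proof -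
          have "(snd z \<bullet> u)\<^sup>2 < R\<^sup>2" using zW zero_le_power2[of "fst z \<bullet> u"] unfolding W_def mem_Collect_eq by linarith
          then show ?thesis using R power2_less_imp_less[of "\<bar>snd z \<bullet> u\<bar>" R] by simp
        qed
        have gs: "\<bar>g (fst z \<bullet> u)\<bar> < a" "\<bar>snd z \<bullet> u / sg (fst z \<bullet> u)\<bar> < 1"
          using strip[of "Psi z"] PK K(2) by (auto simp: Psiu)
        have "norm (fst z) \<le> norm (fst (Psi z)) + \<bar>g (fst z \<bullet> u) + c - fst z \<bullet> u\<bar>"
          using norm_triangle_ineq4[of "fst (Psi z)" "(g (fst z \<bullet> u) + c - fst z \<bullet> u) *\<^sub>R u"] u by (simp add: Psi_def)
        moreover have "norm (snd z) \<le> norm (snd (Psi z)) + \<bar>snd z \<bullet> u / sg (fst z \<bullet> u) - snd z \<bullet> u\<bar>"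
          using norm_triangle_ineq4[of "snd (Psi z)" "(snd z \<bullet> u / sg (fst z \<bullet> u) - snd z \<bullet> u) *\<^sub>R u"] u by (simp add: Psi_def)
        moreover have "norm (fst (Psi z)) \<le> B" "norm (snd (Psi z)) \<le> B"
          using B[OF PK] norm_fst_snd_le[of "Psi z"] by auto
        ultimately show ?thesis using norm_pair_le[of z] s t gs by linarith
      qed
      then show ?thesis unfolding bounded_iff by blast
    qed
    ultimately show ?thesis by (simp add: compact_eq_bounded_closed)
  qed
  have closedK': "closed K'" using compK' by (rule compact_imp_closed)
  \<comment> \<open>Off \<open>K'\<close> both branches of \<open>F\<close> give \<open>m\<close>,
    so differentiability can be checked separately on the open sets \<open>W'\<close> and the
    complement of \<open>K'\<close>.\<close>
  have Fm: "F z = m" if "z \<notin> K'" for z using that K(3) by (auto simp: F_def W'_def K'_def)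
  have derivF_in: "(F has_derivative (\<lambda>w. DF z \<bullet> w)) (at z)" if z: "z \<in> W'" for z
  proof -
    have zW: "z \<in> W" and PU: "Psi z \<in> U" using z by (auto simp: W'_def)
    have "((\<lambda>z. H (Psi z)) has_derivative (\<lambda>w. dH (Psi z) \<bullet> DPsi z w)) (at z)"
      by (rule has_derivative_compose[OF Psi_deriv[OF WR[OF zW]] dH[OF PU]])
    then have "((\<lambda>z. H (Psi z)) has_derivative (\<lambda>w. DF z \<bullet> w)) (at z)"
      using z by (simp add: DPsiT_adjoint DF_def)
    then show ?thesis
      by (rule has_derivative_transform_within_open[OF _ openW' z]) (simp add: F_def)
  qed
  have DF0: "DF z = 0" if z: "z \<notin> K'" for z
  proof (cases "z \<in> W'")
    case True
    show ?thesis
      by (rule has_derivative_zero_on_open[OF _ _ _ derivF_in[OF True], of "- K'" m]) (use z Fm closedK' in auto)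
  qed (simp add: DF_def)
  have derivF: "(F has_derivative (\<lambda>w. DF z \<bullet> w)) (at z)" for z
  proof (cases "z \<in> W'")
    case False
    then have zK: "z \<in> - K'" using K'W' by auto
    have "((\<lambda>_. m) has_derivative (\<lambda>w. 0)) (at z)" by simp
    then have "(F has_derivative (\<lambda>w. 0)) (at z)"
      by (rule has_derivative_transform_within_open[OF _ _ zK]) (use closedK' Fm in auto)
    then show ?thesis using DF0 zK by simp
  qed (rule derivF_in)
  have DFdiff: "DF differentiable (at z)" for z
  proof (cases "z \<in> W'")
    case True
    then have zW: "z \<in> W" and PU: "Psi z \<in> U" by (auto simp: W'_def)
    have "Psi differentiable (at z)" using Psi_deriv[OF WR[OF zW]] by (auto simp: differentiable_def)
    from differentiable_chain_at[OF this dHdiff[OF PU]] have "(\<lambda>z. dH (Psi z)) differentiable (at z)" by (simp add: o_def)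
    from DPsiT_differentiable[OF WR[OF zW] this] obtain D where "((\<lambda>y. DPsiT y (dH (Psi y))) has_derivative D) (at z)"
      by (auto simp: differentiable_def)
    then have "(DF has_derivative D) (at z)"
      by (rule has_derivative_transform_within_open[OF _ openW' True]) (simp add: DF_def)
    then show ?thesis by (auto simp: differentiable_def)
  next
    case False
    then have zK: "z \<in> - K'" using K'W' by auto
    have "((\<lambda>_. 0) has_derivative (\<lambda>w. 0)) (at z)" by simp
    then have "(DF has_derivative (\<lambda>w. 0)) (at z)"
      by (rule has_derivative_transform_within_open[OF _ _ zK]) (use closedK' DF0 in auto)
    then show ?thesis by (auto simp: differentiable_def)
  qed
  have contDF: "continuous_on UNIV DF"
    using DFdiff differentiable_imp_continuous_within by (intro continuous_at_imp_continuous_on) blast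
  have m0: "0 < m" using m a by linarith
  have F0: "0 \<le> F z" for z using H0 m0 by (auto simp: F_def W'_def)
  have Psi_even: "Psi (q, - p) = tau0 (Psi (q, p))" for q p
    by (simp add: Psi_def tau0_def algebra_simps)
  have tt: "tau0 (tau0 z) = z" for z :: "'n ps" by (simp add: tau0_def)
  have Wev: "(q, - p) \<in> W' \<longleftrightarrow> (q, p) \<in> W'" for q p
    using U(2)[of "Psi (q,p)"] U(2)[of "tau0 (Psi (q,p))"] by (auto simp: W'_def W_def Psi_even tt)
  have evenF: "F (q, - p) = F (q, p)" for q p
  proof (cases "(q, p) \<in> W'")
    case True
    then have "Psi (q, p) \<in> U" by (simp add: W'_def)
    then show ?thesis using Htau[of "Psi (q,p)"] True by (simp add: F_def Wev Psi_even)
  qed (simp add: F_def Wev)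
  obtain z0 where z0: "z0 \<in> V" "z0 \<in> Fix_tau0" using V(3) by blast
  have z0p: "snd z0 = 0"
  proof -
    have "- snd z0 = snd z0" using z0(2) by (auto simp: Fix_tau0_def tau0_def prod_eq_iff)
    then show ?thesis by (simp add: vec_eq_iff)
  qed
  have "\<bar>fst z0 \<bullet> u - c\<bar> < a" using strip z0 V(2) by blast
  then have "\<exists>s. -R \<le> s \<and> s \<le> R \<and> g s = fst z0 \<bullet> u - c"
    using gR R by (intro IVT' g(2)) auto
  then obtain s where s: "-R \<le> s" "s \<le> R" "g s = fst z0 \<bullet> u - c" by blast
  have sR: "\<bar>s\<bar> < R" using s \<open>\<bar>fst z0 \<bullet> u - c\<bar> < a\<close> gR by (cases "s = R \<or> s = - R") (auto simp: abs_less_iff)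
  \<comment> \<open>The centre for the linking argument: the preimage of a point of \<open>V\<close>
    fixed by the involution.\<close>
  define x0 where "x0 = fst z0 + (s - fst z0 \<bullet> u) *\<^sub>R u"
  have x0u: "x0 \<bullet> u = s" by (simp add: x0_def inner_add_left uu)
  have Px0: "Psi (x0, 0) = z0"
    using s(3) z0p by (simp add: Psi_def x0u prod_eq_iff) (simp add: x0_def scaleR_add_left[symmetric])
  have x0W: "(x0, 0) \<in> W \<inter> Psi -` V"
    using sR z0 Px0 abs_square_less_1 power_strict_mono[of "\<bar>s\<bar>" R 2] by (simp add: W_def x0u)
  have "open (W \<inter> Psi -` V)" by (intro continuous_open_preimage contPsi openW V(1))
  then obtain \<rho>0 where \<rho>0: "\<rho>0 > 0" "ball (x0, 0) \<rho>0 \<subseteq> W \<inter> Psi -` V"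
    using x0W open_contains_ball by blast
  have zero: "F z = 0" if "dist z (x0, 0) < \<rho>0" for z
  proof -
    have "z \<in> W \<inter> Psi -` V" using \<rho>0(2) that by (auto simp: dist_commute)
    then show ?thesis using V(2,4) by (auto simp: F_def W'_def)
  qed
  \<comment> \<open>Second derivatives of \<open>H\<close> enter here: the gradient is
    differentiable, hence Lipschitz at each single point.\<close>
  have equil: "\<exists>L d. d > 0 \<and> (\<forall>y. dist y z < d \<longrightarrow> norm (DF y) \<le> L * dist y z)" if "DF z = 0" for z
    using differentiable_imp_lipschitz_at[OF DFdiff[of z]] that by simp
  have KR: "(fst z \<bullet> u)\<^sup>2 + (snd z \<bullet> u)\<^sup>2 < R\<^sup>2" if "z \<in> K'" for z using that by (auto simp: K'_def W_def)
  have mR: "pi * R\<^sup>2 < m" using m R2 by simp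
  obtain X where X: "\<forall>t. (X has_vector_derivative sympl (DF (X t))) (at t)" "\<forall>t. X (t + 1) = X t"
    "\<forall>t. X (- t) = (fst (X t), - snd (X t))" "\<forall>t. X t \<in> K'" "\<forall>t. DF (X t) \<noteq> 0"
    using symmetric_orbit_exists[OF u R mR derivF contDF evenF F0 compK' Fm KR \<rho>0(1) zero equil] by blast
  define y where "y t = Psi (X t)" for t
  have XW: "X t \<in> W'" "X t \<in> W" "Psi (X t) \<in> U" for t using X(4) K'W' by (auto simp: W'_def)
  have yd: "(y has_vector_derivative sympl (dH (y t))) (at t)" for t
  proof -
    have "(y has_vector_derivative DPsi (X t) (sympl (DF (X t)))) (at t)"
      unfolding y_def using vector_derivative_diff_chain_within[OF X(1)[rule_format, of t], of Psi "DPsi (X t)"] Psi_deriv[OF WR[OF XW(2)]]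
      by (simp add: o_def has_derivative_at_withinI)
    moreover have "DPsi (X t) (sympl (DF (X t))) = sympl (dH (y t))"
      using XW(1) DPsi_sympl[OF WR[OF XW(2)]] by (simp add: DF_def y_def)
    ultimately show ?thesis by simp
  qed
  have "sym_periodic_orbit U H 1 y"
    unfolding sym_periodic_orbit_def ham_orbit_def
  proof (intro conjI allI)
    fix t
    show "y differentiable (at t)" using yd[of t] by (auto simp: differentiable_def has_vector_derivative_def)
    fix v
    have "frechet_derivative H (at (y t)) = (\<lambda>w. dH (y t) \<bullet> w)"
      using frechet_derivative_at[OF dH[of "y t"]] XW(3) by (simp add: y_def)
    then show "omega0 (vector_derivative y (at t)) v = - frechet_derivative H (at (y t)) v"
      using vector_derivative_at[OF yd[of t]] by (simp add: omega0_def sympl_def inner_prod_def)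
  next
    fix t show "y t \<in> U" using XW(3) by (simp add: y_def)
    show "y (t + 1) = y t" using X(2) by (simp add: y_def)
    have r: "y (- t) = tau0 (y t)" for t
      using X(3) Psi_even[of "fst (X t)" "snd (X t)"] by (simp add: y_def)
    then show "y (- t) = tau0 (y t)" .
    show "y (1 - t) = y (- t)" using X(2)[rule_format, of "- t"] by (simp add: y_def)
  next
    \<comment> \<open>A constant orbit would rest at a critical point of \<open>H\<close>, but the
      gradient of \<open>F\<close> vanishes nowhere along \<open>X\<close>.\<close>
    show "\<exists>s t. y s \<noteq> y t"
    proof (rule ccontr)
      assume "\<not> ?thesis"
      then have "y = (\<lambda>_. y 0)" by auto
      then have "(y has_vector_derivative 0) (at 0)" by (metis has_vector_derivative_const)
      then have "sympl (dH (y 0)) = 0" using vector_derivative_unique_at[OF yd[of 0]] by blast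
      then have "dH (y 0) = 0" using norm_sympl[of "dH (y 0)"] by simp
      then have "DF (X 0) = 0" using XW(1)[of 0] by (simp add: DF_def y_def DPsiT_def zero_prod_def)
      then show False using X(5) by blast
    qed
  qed
  then show False using noorb by blast
qed

subsection \<open>Closure properties of smooth functions\<close>

lemma frechet_eqI: "(f has_derivative D) (at x) \<Longrightarrow> frechet_derivative f (at x) v = D v"
  using frechet_derivative_at by metis

lemma frechet_worksI: "f differentiable (at x) \<Longrightarrow> (f has_derivative frechet_derivative f (at x)) (at x)"
  by (simp add: frechet_derivative_works)

text \<open>The functions generated from smooth ones by sums, products and composition with smooth real
  functions; being closed under directional derivatives, the class is contained in \<open>smooth_on U\<close>.\<close>

inductive smooth_gen :: "'a::real_normed_vector set \<Rightarrow> ('a \<Rightarrow> real) \<Rightarrow> bool" for U where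
  base: "smooth_on U f \<Longrightarrow> smooth_gen U f"
| add: "smooth_gen U f \<Longrightarrow> smooth_gen U g \<Longrightarrow> smooth_gen U (\<lambda>x. f x + g x)"
| mult: "smooth_gen U f \<Longrightarrow> smooth_gen U g \<Longrightarrow> smooth_gen U (\<lambda>x. f x * g x)"
| comp: "smooth_gen U f \<Longrightarrow> smooth_on V h \<Longrightarrow> open V \<Longrightarrow> (\<And>x. x \<in> U \<Longrightarrow> f x \<in> V) \<Longrightarrow> smooth_gen U (\<lambda>x. h (f x))"

text \<open>\<open>frechet_derivative\<close> is meaningful only where the function is
  differentiable, so a member of the class matches the derivative on \<open>U\<close> and not
  globally.\<close>

lemma smooth_gen_derivative:
  assumes "smooth_gen U f" and U: "open U"
  shows "(\<forall>x\<in>U. f differentiable (at x)) \<and> (\<forall>v. \<exists>f'. smooth_gen U f' \<and> (\<forall>x\<in>U. frechet_derivative f (at x) v = f' x))"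
  using assms(1)
proof induction
  case (base f)
  then show ?case using smooth_onD[OF base] differentiable_on_eq_differentiable_at[OF U] smooth_gen.base by blast
next
  case (add f g)
  have d: "\<And>x. x \<in> U \<Longrightarrow> f differentiable (at x)" "\<And>x. x \<in> U \<Longrightarrow> g differentiable (at x)" using add.IH by blast+
  show ?case
  proof (intro conjI ballI allI)
    fix v
    obtain f' g' where fg: "smooth_gen U f'" "\<forall>x\<in>U. frechet_derivative f (at x) v = f' x"
      "smooth_gen U g'" "\<forall>x\<in>U. frechet_derivative g (at x) v = g' x" using add.IH by blast
    have "frechet_derivative (\<lambda>x. f x + g x) (at x) v = f' x + g' x" if "x \<in> U" for x
      using fg that frechet_eqI[OF has_derivative_add[OF frechet_worksI[OF d(1)[OF that]] frechet_worksI[OF d(2)[OF that]]]]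
      by simp
    then show "\<exists>h. smooth_gen U h \<and> (\<forall>x\<in>U. frechet_derivative (\<lambda>x. f x + g x) (at x) v = h x)"
      using smooth_gen.add[OF fg(1,3)] by blast
  qed (use d in \<open>auto intro: differentiable_add\<close>)
next
  case (mult f g)
  have d: "\<And>x. x \<in> U \<Longrightarrow> f differentiable (at x)" "\<And>x. x \<in> U \<Longrightarrow> g differentiable (at x)" using mult.IH by blast+
  show ?case
  proof (intro conjI ballI allI)
    fix v
    obtain f' g' where fg: "smooth_gen U f'" "\<forall>x\<in>U. frechet_derivative f (at x) v = f' x"
      "smooth_gen U g'" "\<forall>x\<in>U. frechet_derivative g (at x) v = g' x" using mult.IH by blast
    have "frechet_derivative (\<lambda>x. f x * g x) (at x) v = f x * g' x + f' x * g x" if "x \<in> U" for x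
      using fg that frechet_eqI[OF has_derivative_mult[OF frechet_worksI[OF d(1)[OF that]] frechet_worksI[OF d(2)[OF that]]]]
      by simp
    then show "\<exists>h. smooth_gen U h \<and> (\<forall>x\<in>U. frechet_derivative (\<lambda>x. f x * g x) (at x) v = h x)"
      using smooth_gen.add[OF smooth_gen.mult[OF mult.hyps(1) fg(3)] smooth_gen.mult[OF fg(1) mult.hyps(2)]] by blast
  qed (use d in \<open>auto intro: differentiable_mult\<close>)
next
  case (comp f V h)
  have d: "\<And>x. x \<in> U \<Longrightarrow> f differentiable (at x)" using comp.IH by blast
  have dh: "\<And>y. y \<in> V \<Longrightarrow> h differentiable (at y)"
    using smooth_onD(1)[OF comp.hyps(2)] differentiable_on_eq_differentiable_at[OF comp.hyps(3)] by blast
  have sh: "smooth_on V (\<lambda>y. frechet_derivative h (at y) 1)" by (rule smooth_onD(2)[OF comp.hyps(2)])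
  show ?case
  proof (intro conjI ballI allI)
    fix x assume x: "x \<in> U"
    show "(\<lambda>x. h (f x)) differentiable (at x)"
      using differentiable_chain_at[OF d[OF x] dh[OF comp.hyps(4)[OF x]]] by (simp add: o_def)
  next
    fix v
    obtain f' where f': "smooth_gen U f'" "\<forall>x\<in>U. frechet_derivative f (at x) v = f' x" using comp.IH by blast
    have "frechet_derivative (\<lambda>x. h (f x)) (at x) v = frechet_derivative h (at (f x)) 1 * f' x" if x: "x \<in> U" for x
    proof -
      have hd: "(h has_derivative frechet_derivative h (at (f x))) (at (f x))"
        by (rule frechet_worksI[OF dh[OF comp.hyps(4)[OF x]]])
      have "frechet_derivative (\<lambda>x. h (f x)) (at x) v = frechet_derivative h (at (f x)) (frechet_derivative f (at x) v)"
        by (rule frechet_eqI[OF has_derivative_compose[OF frechet_worksI[OF d[OF x]] hd]])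
      also have "\<dots> = frechet_derivative h (at (f x)) (f' x *\<^sub>R 1)" using f'(2) x by simp
      also have "\<dots> = f' x *\<^sub>R frechet_derivative h (at (f x)) 1"
        by (rule linear_scale[OF has_derivative_linear[OF hd]])
      finally show ?thesis by simp
    qed
    then show "\<exists>g. smooth_gen U g \<and> (\<forall>x\<in>U. frechet_derivative (\<lambda>x. h (f x)) (at x) v = g x)"
      using smooth_gen.mult[OF smooth_gen.comp[OF comp.hyps(1) sh comp.hyps(3,4)] f'(1)] by blast
  qed
qed

text \<open>Coinduction with the invariant of agreeing on \<open>U\<close> with a generated
  function; this is stable under directional derivatives because they are local and \<open>U\<close>
  is open.\<close>

lemma smooth_on_cong_gen:
  assumes U: "open U" and f: "smooth_gen U f" and eq: "\<And>x. x \<in> U \<Longrightarrow> g x = f x"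
  shows "smooth_on U g"
proof -
  define P where "P g \<longleftrightarrow> (\<exists>f. smooth_gen U f \<and> (\<forall>x\<in>U. g x = f x))" for g :: "'a \<Rightarrow> real"
  have "P g" using f eq by (auto simp: P_def)
  then show ?thesis
  proof (coinduction arbitrary: g rule: smooth_on.coinduct)
    case smooth_on
    then obtain f where f: "smooth_gen U f" "\<forall>x\<in>U. g x = f x" by (auto simp: P_def)
    note d = smooth_gen_derivative[OF f(1) U]
    have gd: "(g has_derivative frechet_derivative f (at x)) (at x)" if x: "x \<in> U" for x
    proof (rule has_derivative_transform_within_open[OF _ U x])
      show "(f has_derivative frechet_derivative f (at x)) (at x)" using d x frechet_worksI by blast
    qed (use f in auto)
    have "P (\<lambda>z. frechet_derivative g (at z) v)" for v
    proof -
      obtain f' where f': "smooth_gen U f'" "\<forall>x\<in>U. frechet_derivative f (at x) v = f' x" using d by blast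
      then have "\<forall>x\<in>U. frechet_derivative g (at x) v = f' x" using frechet_eqI[OF gd] by simp
      then show ?thesis using f'(1) by (auto simp: P_def)
    qed
    moreover have "g differentiable_on U"
      unfolding differentiable_on_eq_differentiable_at[OF U] using gd by (auto simp: differentiable_def)
    ultimately show ?case by blast
  qed
qed

lemma smooth_on_cong: "open U \<Longrightarrow> smooth_on U f \<Longrightarrow> (\<And>x. x \<in> U \<Longrightarrow> g x = f x) \<Longrightarrow> smooth_on U g"
  using smooth_on_cong_gen smooth_gen.base by blast

lemma smooth_on_add: "open U \<Longrightarrow> smooth_on U f \<Longrightarrow> smooth_on U g \<Longrightarrow> smooth_on U (\<lambda>x. f x + g x)"
  and smooth_on_mult: "open U \<Longrightarrow> smooth_on U f \<Longrightarrow> smooth_on U g \<Longrightarrow> smooth_on U (\<lambda>x. f x * g x)"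
  by (rule smooth_on_cong_gen[OF _ smooth_gen.add[OF smooth_gen.base smooth_gen.base]]; simp)
     (rule smooth_on_cong_gen[OF _ smooth_gen.mult[OF smooth_gen.base smooth_gen.base]]; simp)

lemma smooth_on_compose: "open U \<Longrightarrow> smooth_on U f \<Longrightarrow> smooth_on V h \<Longrightarrow> open V \<Longrightarrow> (\<And>x. x \<in> U \<Longrightarrow> f x \<in> V) \<Longrightarrow> smooth_on U (\<lambda>x. h (f x))"
proof -
  assume a: "open U" "smooth_on U f" "smooth_on V h" "open V" "\<And>x. x \<in> U \<Longrightarrow> f x \<in> V"
  show ?thesis
    by (rule smooth_on_cong_gen[OF a(1) smooth_gen.comp[OF smooth_gen.base[OF a(2)] a(3,4,5)]]) simp_all
qed

lemma smooth_on_affine: "bounded_linear l \<Longrightarrow> smooth_on U (\<lambda>x. l x + c)"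
proof -
  assume l: "bounded_linear l"
  define P where "P f \<longleftrightarrow> (\<exists>l c. bounded_linear l \<and> f = (\<lambda>x. l x + c))" for f :: "'a \<Rightarrow> real"
  have "P (\<lambda>x. l x + c)" using l by (auto simp: P_def)
  then show ?thesis
  proof (coinduction arbitrary: l c rule: smooth_on.coinduct)
    case smooth_on
    then obtain l' c' where l': "bounded_linear l'" "(\<lambda>x. l x + c) = (\<lambda>x. l' x + c')" by (auto simp: P_def)
    have d: "((\<lambda>x. l x + c) has_derivative l') (at x)" for x
      unfolding l'(2) using bounded_linear_imp_has_derivative[OF l'(1)] by (auto intro!: derivative_eq_intros)
    have "\<exists>l0 c0. (\<lambda>z. frechet_derivative (\<lambda>x. l x + c) (at z) v) = (\<lambda>x. l0 x + c0) \<and> P (\<lambda>x. l0 x + c0)" for v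
    proof (intro exI conjI)
      show "(\<lambda>z. frechet_derivative (\<lambda>x. l x + c) (at z) v) = (\<lambda>x. (\<lambda>_. 0) x + l' v)" using frechet_eqI[OF d] by simp
      show "P (\<lambda>x. (\<lambda>_. 0) x + l' v)" unfolding P_def using bounded_linear_zero by blast
    qed
    moreover have "(\<lambda>x. l x + c) differentiable_on U"
      using d by (intro differentiable_at_imp_differentiable_on) (auto simp: differentiable_def)
    ultimately show ?case by blast
  qed
qed

lemma smooth_on_const: "smooth_on U (\<lambda>_. c)"
  using smooth_on_affine[OF bounded_linear_zero, of U c] by simp

lemma smooth_on_sum: "open U \<Longrightarrow> finite A \<Longrightarrow> (\<And>i. i \<in> A \<Longrightarrow> smooth_on U (f i)) \<Longrightarrow> smooth_on U (\<lambda>x. \<Sum>i\<in>A. f i x)"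
proof (rotate_tac 1, induction A rule: finite_induct)
  case (insert i A)
  then show ?case using smooth_on_add[of U "f i" "\<lambda>x. \<Sum>i\<in>A. f i x"] by simp
qed (simp add: smooth_on_const)

lemma smooth_on_linear: "bounded_linear l \<Longrightarrow> smooth_on U l"
  using smooth_on_affine[of l U 0] by simp

lemma smooth_on_power: "open U \<Longrightarrow> smooth_on U f \<Longrightarrow> smooth_on U (\<lambda>x. f x ^ n)"
proof (induction n)
  case (Suc n)
  then show ?case using smooth_on_mult[of U f "\<lambda>x. f x ^ n"] by simp
qed (simp add: smooth_on_const)

lemma smooth_on_subset: "smooth_on V f \<Longrightarrow> U \<subseteq> V \<Longrightarrow> smooth_on U f"
proof (coinduction arbitrary: f rule: smooth_on.coinduct)
  case smooth_on
  then show ?case using smooth_onD[OF \<open>smooth_on V f\<close>] differentiable_on_subset by blast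
qed

text \<open>The factor \<open>c\<close> lets a family such as all real powers be closed under
  differentiation without containing its scalar multiples.\<close>

lemma smooth_on_realI:
  fixes S :: "(real \<Rightarrow> real) set"
  assumes U: "open U" and S: "\<And>f. f \<in> S \<Longrightarrow> \<exists>f'\<in>S. \<exists>c. \<forall>x\<in>U. (f has_real_derivative c * f' x) (at x)"
    and f: "f \<in> S"
  shows "smooth_on U f"
proof -
  define P where "P g \<longleftrightarrow> (\<exists>f\<in>S. \<exists>c. \<forall>x\<in>U. g x = c * f x)" for g
  have "P f" using f by (auto simp: P_def intro!: bexI[of _ f] exI[of _ 1])
  then show ?thesis
  proof (coinduction arbitrary: f rule: smooth_on.coinduct)
    case smooth_on
    then obtain g c where g: "g \<in> S" "\<forall>x\<in>U. f x = c * g x" by (auto simp: P_def)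
    obtain g' c' where g': "g' \<in> S" "\<forall>x\<in>U. (g has_real_derivative c' * g' x) (at x)" using S[OF g(1)] by blast
    have fd: "(f has_derivative (\<lambda>v. (c * (c' * g' x)) * v)) (at x)" if x: "x \<in> U" for x
    proof -
      have "((\<lambda>x. c * g x) has_real_derivative c * (c' * g' x)) (at x)" using g'(2) x by (intro DERIV_cmult) auto
      then have "((\<lambda>x. c * g x) has_derivative (\<lambda>v. (c * (c' * g' x)) * v)) (at x)" by (simp add: has_field_derivative_def)
      then show ?thesis by (rule has_derivative_transform_within_open[OF _ U x]) (use g in auto)
    qed
    have "P (\<lambda>z. frechet_derivative f (at z) v)" for v
      unfolding P_def using frechet_eqI[OF fd] g'(1) by (intro bexI[of _ g'] exI[of _ "c * c' * v"]) auto
    moreover have "f differentiable_on U"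
      unfolding differentiable_on_eq_differentiable_at[OF U] using fd by (auto simp: differentiable_def)
    ultimately show ?case by blast
  qed
qed

lemma smooth_on_powr: "smooth_on {0<..} (\<lambda>x::real. x powr r)"
proof (rule smooth_on_realI[where S = "range (\<lambda>r x. x powr r)"])
  fix f :: "real \<Rightarrow> real" assume "f \<in> range (\<lambda>r x. x powr r)"
  then obtain r where r: "f = (\<lambda>x. x powr r)" by auto
  show "\<exists>f'\<in>range (\<lambda>r x. x powr r). \<exists>c. \<forall>x\<in>{0<..}. (f has_real_derivative c * f' x) (at x)"
    by (rule bexI[of _ "\<lambda>x. x powr (r - 1)"], rule exI[of _ r]) (auto simp: r intro!: has_real_derivative_powr)
qed auto

section \<open>Flat functions, smooth steps and ramps on the line\<close>

lemma smooth_on_antiderivative: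
  assumes "open U" "smooth_on U f" "\<And>x. x \<in> U \<Longrightarrow> (F has_real_derivative f x) (at x)"
  shows "smooth_on U F"
proof (rule smooth_on.intros)
  have d: "(F has_derivative (\<lambda>v. f x * v)) (at x)" if "x \<in> U" for x
    using assms(3)[OF that] by (simp add: has_field_derivative_def)
  show "F differentiable_on U"
    unfolding differentiable_on_eq_differentiable_at[OF assms(1)] using d by (auto simp: differentiable_def)
  show "smooth_on U (\<lambda>z. frechet_derivative F (at z) v)" for v
    by (rule smooth_on_cong[OF assms(1) smooth_on_mult[OF assms(1,2) smooth_on_const[of U v]]]) (rule frechet_eqI[OF d])
qed

text \<open>All derivatives of the flat function exp(-1/x) have this shape, so the family is closed
  under differentiation.\<close>

definition flat_exp :: "real poly \<Rightarrow> real \<Rightarrow> real" where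
  "flat_exp p x = (if 0 < x then poly p (1 / x) * exp (- (1 / x)) else 0)"

lemma poly_mult_exp_tendsto_0: "((\<lambda>y::real. poly p y * exp (- y)) \<longlongrightarrow> 0) at_top"
proof -
  have "((\<lambda>y. \<Sum>i\<le>degree p. coeff p i * (y ^ i / exp y)) \<longlongrightarrow> (\<Sum>i\<le>degree p. coeff p i * 0)) at_top"
    by (intro tendsto_sum tendsto_mult tendsto_const tendsto_power_div_exp_0)
  moreover have "(\<lambda>y. \<Sum>i\<le>degree p. coeff p i * (y ^ i / exp y)) = (\<lambda>y. poly p y * exp (- y))"
    by (rule ext) (simp add: poly_altdef sum_distrib_right exp_minus divide_inverse mult.assoc)
  ultimately show ?thesis by simp
qed

text \<open>For x > 0 the chain rule gives the factor (p - p')(1/x) / x^2. At 0 the quotient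
  \<open>flat_exp p h / h\<close> is again of the flat form, with polynomial
  \<open>pCons 0 p\<close>, and tends to 0.\<close>

lemma flat_exp_derivative: "(flat_exp p has_real_derivative flat_exp (monom 1 2 * (p - pderiv p)) x) (at x)"
proof -
  consider "x < 0" | "x = 0" | "x > 0" by linarith
  then show ?thesis
  proof cases
    case 1
    have "(flat_exp p has_real_derivative 0) (at x)"
      by (rule has_field_derivative_transform_within[of "\<lambda>_. 0" 0 x UNIV "- x"]) (use 1 in \<open>auto simp: flat_exp_def dist_real_def\<close>)
    then show ?thesis using 1 by (simp add: flat_exp_def)
  next
    case 2
    have "((\<lambda>h. flat_exp p h / h) \<longlongrightarrow> 0) (at_right 0)"
    proof -
      have "((\<lambda>h. poly (pCons 0 p) (inverse h) * exp (- inverse h)) \<longlongrightarrow> 0) (at_right 0)"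
        by (rule filterlim_compose[OF poly_mult_exp_tendsto_0 filterlim_inverse_at_top_right])
      moreover have "\<forall>\<^sub>F h in at_right 0. poly (pCons 0 p) (inverse h) * exp (- inverse h) = flat_exp p h / h"
        using eventually_at_right_less[of "0::real"] by eventually_elim (simp add: flat_exp_def divide_inverse)
      ultimately show ?thesis using tendsto_cong by fast
    qed
    moreover have "((\<lambda>h. flat_exp p h / h) \<longlongrightarrow> 0) (at_left 0)"
      by (rule tendsto_eventually) (use eventually_at_left[of "-1" "0::real"] in \<open>auto simp: flat_exp_def eventually_at_filter\<close>)
    ultimately have "((\<lambda>h. flat_exp p h / h) \<longlongrightarrow> 0) (at 0)" by (simp add: filterlim_at_split)
    then show ?thesis using 2 by (simp add: has_field_derivative_iff flat_exp_def)
  next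
    case 3
    have "((\<lambda>x. poly p (1 / x) * exp (- (1 / x))) has_real_derivative
       poly (pderiv p) (1 / x) * (- 1 / x\<^sup>2) * exp (- (1 / x)) + exp (- (1 / x)) * (1 / x\<^sup>2) * poly p (1 / x)) (at x)"
      using 3 by (auto intro!: derivative_eq_intros DERIV_chain2[OF poly_DERIV] simp: power2_eq_square)
    also have "poly (pderiv p) (1 / x) * (- 1 / x\<^sup>2) * exp (- (1 / x)) + exp (- (1 / x)) * (1 / x\<^sup>2) * poly p (1 / x)
       = flat_exp (monom 1 2 * (p - pderiv p)) x"
      using 3 by (simp add: flat_exp_def poly_monom power_divide algebra_simps)
    finally show ?thesis
      by (rule has_field_derivative_transform_within[where d = x]) (use 3 in \<open>auto simp: flat_exp_def dist_real_def\<close>)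
  qed
qed

lemma smooth_on_flat_exp: "smooth_on UNIV (flat_exp p)"
proof (rule smooth_on_realI[where S = "range flat_exp"])
  fix f assume "f \<in> range flat_exp"
  then obtain q where q: "f = flat_exp q" by auto
  show "\<exists>f'\<in>range flat_exp. \<exists>c. \<forall>x\<in>UNIV. (f has_real_derivative c * f' x) (at x)"
    by (rule bexI[of _ "flat_exp (monom 1 2 * (q - pderiv q))"], rule exI[of _ 1])
      (use flat_exp_derivative[of q] in \<open>auto simp: q\<close>)
qed auto

text \<open>Written with \<open>powr (- 1)\<close> instead of a quotient so that smoothness follows
  from closure under products and composition.\<close>

definition smooth_step :: "real \<Rightarrow> real" where
  "smooth_step x = flat_exp 1 x * (flat_exp 1 x + flat_exp 1 (1 - x)) powr (- 1)"

lemma smooth_step_pos: "0 < flat_exp 1 x + flat_exp 1 (1 - x)"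
  by (auto simp: flat_exp_def add_pos_pos)

lemma smooth_on_smooth_step: "smooth_on UNIV smooth_step"
proof -
  have l: "smooth_on UNIV (\<lambda>x::real. (- x) + 1)" by (rule smooth_on_affine[OF bounded_linear_minus[OF bounded_linear_ident]])
  have f: "smooth_on UNIV (\<lambda>x. flat_exp 1 (- x + 1))"
    by (rule smooth_on_compose[OF open_UNIV l smooth_on_flat_exp]) auto
  have s: "smooth_on UNIV (\<lambda>x. flat_exp 1 x + flat_exp 1 (- x + 1))"
    by (rule smooth_on_add[OF open_UNIV smooth_on_flat_exp f])
  have "smooth_on UNIV (\<lambda>x. (flat_exp 1 x + flat_exp 1 (- x + 1)) powr (- 1))"
    by (rule smooth_on_compose[OF open_UNIV s smooth_on_powr]) (use smooth_step_pos in auto)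
  from smooth_on_mult[OF open_UNIV smooth_on_flat_exp[of 1] this]
  show ?thesis by (rule smooth_on_cong[OF open_UNIV]) (simp add: smooth_step_def)
qed

lemma smooth_step_bounds: "0 \<le> smooth_step x" "smooth_step x \<le> 1" "x \<le> 0 \<Longrightarrow> smooth_step x = 0" "1 \<le> x \<Longrightarrow> smooth_step x = 1"
proof -
  have n: "0 \<le> flat_exp 1 y" for y by (simp add: flat_exp_def)
  have e: "smooth_step x = flat_exp 1 x / (flat_exp 1 x + flat_exp 1 (1 - x))"
    using smooth_step_pos[of x] by (simp add: smooth_step_def powr_minus_divide)
  show "0 \<le> smooth_step x" "smooth_step x \<le> 1" using n[of x] n[of "1 - x"] smooth_step_pos[of x] by (auto simp: e)
  show "smooth_step x = 0" if "x \<le> 0" using that by (simp add: e flat_exp_def)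
  show "smooth_step x = 1" if "1 \<le> x" using that by (simp add: e flat_exp_def)
qed

text \<open>The slope is \<open>M\<close> times a rising and a falling step: zero outside [d, 1 - d]
  and full on [2d, 1 - 2d]. This forces a rise of at least M (1 - 4d) without ever exceeding slope
  \<open>M\<close>.\<close>

lemma smooth_ramp:
  fixes M d :: real
  assumes M: "0 < M" and d: "0 < d" "d < 1 / 4"
  obtains f f' m where "smooth_on {0<..} f" "\<And>s. 0 < s \<Longrightarrow> (f has_real_derivative f' s) (at s)"
    "\<And>s. 0 \<le> f' s \<and> f' s \<le> M" "\<And>s. 0 < s \<Longrightarrow> 0 \<le> f s \<and> f s \<le> m" "\<And>s. 0 < s \<Longrightarrow> s \<le> d \<Longrightarrow> f s = 0"
    "\<And>s. 1 - d \<le> s \<Longrightarrow> f s = m" "M * (1 - 4 * d) \<le> m"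
proof -
  define f' where "f' s = M * (smooth_step (1 / d * s + - 1) * smooth_step (- (1 / d) * s + (1 - d) / d))" for s
  have sf': "smooth_on UNIV f'"
  proof -
    have "smooth_on UNIV (\<lambda>s::real. 1 / d * s + - 1)" "smooth_on UNIV (\<lambda>s::real. - (1 / d) * s + (1 - d) / d)"
      by (rule smooth_on_affine, intro bounded_linear_intros)+
    from this[THEN smooth_on_compose[OF open_UNIV _ smooth_on_smooth_step open_UNIV UNIV_I]]
    show ?thesis unfolding f'_def by (intro smooth_on_mult smooth_on_const open_UNIV)
  qed
  have b: "0 \<le> f' s \<and> f' s \<le> M" for s
    using M smooth_step_bounds(1,2) by (auto simp: f'_def intro!: mult_le_one mult_left_le)
  have lo: "f' s = 0" if "s \<le> d" for s
    using that d smooth_step_bounds(3)[of "1 / d * s + - 1"] by (simp add: f'_def)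
  have hi: "f' s = 0" if "1 - d \<le> s" for s
    using that d smooth_step_bounds(3)[of "- (1 / d) * s + (1 - d) / d"] by (simp add: f'_def divide_simps)
  have mid: "f' s = M" if "2 * d \<le> s" "s \<le> 1 - 2 * d" for s
    using that d smooth_step_bounds(4)[of "1 / d * s + - 1"] smooth_step_bounds(4)[of "- (1 / d) * s + (1 - d) / d"]
    by (simp add: f'_def divide_simps)
  have cf': "continuous_on A f'" for A
    using smooth_onD(1)[OF sf'] differentiable_imp_continuous_on continuous_on_subset by blast
  define f where "f s = integral {0..s} f'" for s
  have der: "(f has_real_derivative f' s) (at s)" if s: "0 < s" for s
  proof -
    have "(f has_real_derivative f' s) (at s within {0..s+1})"
      unfolding f_def by (rule integral_has_real_derivative[OF cf']) (use s in auto)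
    then show ?thesis using s at_within_Icc_at[of 0 s "s + 1"] by simp
  qed
  have inc: "f s \<le> f t" if "0 < s" "s \<le> t" for s t
    by (rule DERIV_nonneg_imp_nondecreasing[OF that(2)]) (use der b that in \<open>meson less_le_trans\<close>)
  have f0: "f s = 0" if "s \<le> d" for s
  proof -
    have "integral {0..s} f' = integral {0..s} (\<lambda>_. 0)" by (rule integral_cong) (use that lo in auto)
    then show ?thesis by (simp add: f_def)
  qed
  have f1: "f s = f (1 - d)" if "1 - d \<le> s" for s
  proof (cases "s = 1 - d")
    case False
    then have lt: "1 - d < s" using that by simp
    have "\<exists>z. 1 - d < z \<and> z < s \<and> f s - f (1 - d) = (s - (1 - d)) * f' z"
      by (rule MVT2[OF lt]) (use der d in auto)
    then obtain z where "1 - d < z" "f s - f (1 - d) = (s - (1 - d)) * f' z" by blast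
    then show ?thesis using hi[of z] by simp
  qed simp
  have slope: "M * (1 - 4 * d) \<le> f (1 - d)"
  proof -
    have lt: "2 * d < 1 - 2 * d" using d by simp
    have "\<exists>z. 2 * d < z \<and> z < 1 - 2 * d \<and> f (1 - 2 * d) - f (2 * d) = ((1 - 2 * d) - 2 * d) * f' z"
      by (rule MVT2[OF lt]) (use der d in auto)
    then obtain z where z: "2 * d < z" "z < 1 - 2 * d" "f (1 - 2 * d) - f (2 * d) = ((1 - 2 * d) - 2 * d) * f' z" by blast
    have "f (1 - 2 * d) - f (2 * d) = M * (1 - 4 * d)" using z mid[of z] by simp
    moreover have "f (1 - 2 * d) \<le> f (1 - d)" using d by (intro inc) auto
    moreover have "f d \<le> f (2 * d)" using d by (intro inc) auto
    ultimately show ?thesis using f0[of d] by simp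
  qed
  have rng: "0 \<le> f s \<and> f s \<le> f (1 - d)" if s: "0 < s" for s
  proof
    show "0 \<le> f s"
    proof (cases "s \<le> d")
      case False
      then show ?thesis using inc[of d s] f0[of d] d by simp
    qed (simp add: f0)
    show "f s \<le> f (1 - d)" using inc[of s "1 - d"] f1[of s] s by (cases "s \<le> 1 - d") auto
  qed
  have "smooth_on {0<..} f"
    by (rule smooth_on_antiderivative[OF _ smooth_on_subset[OF sf']]) (use der in auto)
  then show thesis using that[of f f' "f (1 - d)"] der b rng f0 f1 slope by blast
qed

subsection \<open>The lower bound for cylinders\<close>

text \<open>On \<open>Q\<^sup>n + P\<^sup>n = c\<^sup>n\<close> the two coordinates agree in size at \<open>\<kappa> c\<close>, and both move
  with speed at most \<open>\<nu> c\<^sup>n\<^sup>-\<^sup>1\<close>; a chord from \<open>P = 0\<close> to \<open>P = 0\<close> must cross \<open>Q = 0\<close>.\<close>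

lemma planar_chord_time:
  fixes Q P :: "real \<Rightarrow> real" and n :: nat
  assumes n: "even n" "2 \<le> n" and \<nu>: "0 < \<nu>" and h: "0 < h"
    and Q': "\<And>t. (Q has_real_derivative - \<nu> * P t ^ (n - 1)) (at t)"
    and P': "\<And>t. (P has_real_derivative \<nu> * Q t ^ (n - 1)) (at t)"
    and P0: "P 0 = 0" "P h = 0" and \<kappa>: "0 < \<kappa>" "\<kappa> < 1" "\<kappa> ^ n = 1 / 2" and c: "0 < c" "Q 0 ^ n + P 0 ^ n = c ^ n"
  shows "4 * \<kappa> * c \<le> h * \<nu> * c ^ (n - 1)"
proof -
  have E: "Q t ^ n + P t ^ n = c ^ n" for t
  proof -
    have "((\<lambda>t. Q t ^ n + P t ^ n) has_real_derivative 0) (at t)" for t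
    proof -
      have "((\<lambda>t. Q t ^ n + P t ^ n) has_real_derivative
          of_nat n * (- \<nu> * P t ^ (n - 1) * Q t ^ (n - Suc 0)) + of_nat n * (\<nu> * Q t ^ (n - 1) * P t ^ (n - Suc 0))) (at t)"
        by (intro DERIV_add DERIV_power Q' P')
      then show ?thesis by (simp add: mult_ac)
    qed
    then have "Q t ^ n + P t ^ n = Q 0 ^ n + P 0 ^ n" using DERIV_isconst_all by blast
    then show ?thesis using c(2) by simp
  qed
  define V where "V = \<nu> * c ^ (n - 1)"
  have V: "V > 0" using \<nu> c by (simp add: V_def)
  have n0: "0 < n" using n by simp
  have pos: "0 \<le> Q t ^ n" "0 \<le> P t ^ n" for t using n(1) by (simp_all add: zero_le_even_power)
  have absn: "\<bar>x\<bar> ^ n = x ^ n" for x :: real using n(1) by (simp add: power_even_abs)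
  have bnd: "\<bar>Q t\<bar> \<le> c" "\<bar>P t\<bar> \<le> c" for t
  proof -
    have "\<bar>Q t\<bar> ^ n \<le> c ^ n" "\<bar>P t\<bar> ^ n \<le> c ^ n" using E[of t] pos[of t] unfolding absn by linarith+
    then show "\<bar>Q t\<bar> \<le> c" "\<bar>P t\<bar> \<le> c" using c(1) n0 by (auto intro: power_le_imp_le_base[of _ "n - 1"])
  qed
  have lip: "\<bar>F s - F t\<bar> \<le> V * \<bar>s - t\<bar>" if F: "\<And>t. (F has_real_derivative F' t) (at t)" "\<And>t. \<bar>F' t\<bar> \<le> V" for F F' :: "real \<Rightarrow> real" and s t
    using field_differentiable_bound[of UNIV F F' V s t] F by (simp add: real_norm_def)
  have spd: "\<bar>\<nu> * x ^ (n - 1)\<bar> \<le> V" if "\<bar>x\<bar> \<le> c" for x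
    using power_mono[OF that abs_ge_zero, of "n - 1"] \<nu> by (simp add: V_def abs_mult power_abs mult_left_mono)
  have lipP: "\<bar>P s - P t\<bar> \<le> V * \<bar>s - t\<bar>" for s t by (rule lip[OF P']) (rule spd[OF bnd(1)])
  have lipQ: "\<bar>Q s - Q t\<bar> \<le> V * \<bar>s - t\<bar>" for s t by (rule lip[OF Q']) (use spd[OF bnd(2)] in simp)
  have contP: "continuous_on S (\<lambda>t. \<bar>P t\<bar>)" for S
    using P' by (intro continuous_intros continuous_at_imp_continuous_on) (meson DERIV_isCont)
  \<comment> \<open>From a zero of \<open>P\<close> to one of \<open>Q\<close> the curve passes a
    point with |P| = |Q| = \<kappa> c. On one side of it \<open>P\<close> changes by \<kappa> c, on
    the other \<open>Q\<close> does, each at speed at most \<open>V\<close>.\<close>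
  have half: "2 * \<kappa> * c \<le> V * \<bar>z - p\<bar>" if p: "P p = 0" and z: "Q z = 0" for p z
  proof -
    have Pz: "\<bar>P z\<bar> = c"
    proof -
      have "\<bar>P z\<bar> ^ n = c ^ n" using E[of z] z n0 by (simp add: absn zero_power)
      then show ?thesis using c(1) n0 power_eq_imp_eq_base[of "\<bar>P z\<bar>" n c] by simp
    qed
    have kc: "0 \<le> \<kappa> * c" "\<kappa> * c \<le> c" using \<kappa> c(1) by (auto simp: mult_left_le_one_le)
    obtain t where t: "min p z \<le> t" "t \<le> max p z" "\<bar>P t\<bar> = \<kappa> * c"
    proof (cases "p \<le> z")
      case True
      have "\<exists>t\<ge>p. t \<le> z \<and> \<bar>P t\<bar> = \<kappa> * c"
        by (rule IVT') (use True p Pz kc contP in auto)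
      then show thesis using that True by auto
    next
      case False
      have "\<exists>t\<ge>z. t \<le> p \<and> \<bar>P t\<bar> = \<kappa> * c"
        by (rule IVT2') (use False p Pz kc contP in auto)
      then show thesis using that False by auto
    qed
    have "P t ^ n = c ^ n / 2" using absn[of "P t"] t(3) \<kappa>(3) by (simp add: power_mult_distrib)
    then have "Q t ^ n = c ^ n / 2" using E[of t] by linarith
    then have "\<bar>Q t\<bar> ^ n = (\<kappa> * c) ^ n" unfolding absn power_mult_distrib \<kappa>(3) by simp
    then have Qt: "\<bar>Q t\<bar> = \<kappa> * c" using kc(1) n0 power_eq_imp_eq_base[of "\<bar>Q t\<bar>" n "\<kappa> * c"] by simp
    have "\<kappa> * c \<le> V * \<bar>t - p\<bar>" using lipP[of t p] p t(3) by simp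
    moreover have "\<kappa> * c \<le> V * \<bar>t - z\<bar>" using lipQ[of t z] z Qt by simp
    ultimately have "2 * \<kappa> * c \<le> V * (\<bar>t - p\<bar> + \<bar>t - z\<bar>)" by (simp add: distrib_left)
    moreover have "\<bar>t - p\<bar> + \<bar>t - z\<bar> = \<bar>z - p\<bar>" using t by auto
    ultimately show ?thesis by simp
  qed
  \<comment> \<open>Rolle's theorem for \<open>P\<close>, whose derivative is a positive multiple of
    a power of \<open>Q\<close>.\<close>
  have "\<exists>z>0. z < h \<and> (\<nu> * Q z ^ (n - 1) = 0)"
    using MVT2[OF h, of P "\<lambda>t. \<nu> * Q t ^ (n - 1)"] P' P0 h by auto
  then obtain z where z: "0 < z" "z < h" "\<nu> * Q z ^ (n - 1) = 0" by blast
  then have Qz: "Q z = 0" using \<nu> by simp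
  have "2 * \<kappa> * c \<le> V * z" "2 * \<kappa> * c \<le> V * (h - z)"
    using half[OF P0(1) Qz] half[OF P0(2) Qz] z by (simp_all add: abs_minus_commute)
  then show ?thesis by (simp add: V_def algebra_simps)
qed

text \<open>The flow runs at a speed proportional to the slope of \<open>f\<close>. A slope of at
  most M < 4 a \<kappa> makes every symmetric half orbit last longer than 1/2, and since \<kappa>
  can be taken close to 1, the rise of \<open>f\<close> reaches any b < 4a.\<close>

theorem HZ_admissible_cylinder_exists:
  fixes U :: "'n::finite ps set" and u :: "real^'n" and a b :: real
  assumes u: "norm u = 1" and b: "0 < b" "b < 4 * a"
    and sub: "{z. \<bar>fst z \<bullet> u\<bar> < a \<and> \<bar>snd z \<bullet> u\<bar> < 1} \<subseteq> U"
  shows "\<exists>H m. b \<le> m \<and> HZ_admissible U H m"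
proof -
  have a: "0 < a" using b by simp
  have uu: "u \<bullet> u = 1" using u by (simp add: norm_eq_1)
  define M where "M = (b + 4 * a) / 2"
  have M: "0 < M" "b < M" "M < 4 * a" using b by (auto simp: M_def)
  have "(\<lambda>j. (1/2) powr (inverse (real (Suc j)) / 2)) \<longlonglongrightarrow> (1/2) powr (0 / 2)"
    by (intro tendsto_intros LIMSEQ_inverse_real_of_nat) auto
  moreover have "M / (4 * a) < (1/2) powr (0 / 2)" using M a by simp
  ultimately have "\<forall>\<^sub>F j in sequentially. M / (4 * a) < (1/2) powr (inverse (real (Suc j)) / 2)"
    by (rule order_tendstoD(1))
  then obtain j where j: "M / (4 * a) < (1/2) powr (inverse (real (Suc j)) / 2)"
    using eventually_happens'[OF sequentially_bot] by blast
  define k where "k = Suc j"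
  \<comment> \<open>(\<kappa>, \<kappa>) is the diagonal point of the curve x^(2k) + y^(2k) = 1; it
    tends to the corner (1, 1) of the square as k grows.\<close>
  define \<kappa> :: real where "\<kappa> = (1/2) powr (inverse (real k) / 2)"
  have k: "1 \<le> k" "0 < real k" by (auto simp: k_def)
  have \<kappa>: "0 < \<kappa>" "\<kappa> < 1" "\<kappa> ^ (2 * k) = 1 / 2" "M < 4 * a * \<kappa>"
  proof -
    show "0 < \<kappa>" by (simp add: \<kappa>_def)
    then have "\<kappa> ^ (2 * k) = \<kappa> powr real (2 * k)" by (rule powr_realpow[symmetric])
    also have "\<dots> = (1/2) powr (inverse (real k) / 2 * real (2 * k))" unfolding \<kappa>_def by (rule powr_powr)
    also have "inverse (real k) / 2 * real (2 * k) = 1" using k by simp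
    finally show kk: "\<kappa> ^ (2 * k) = 1 / 2" by simp
    show "\<kappa> < 1"
    proof (rule ccontr)
      assume "\<not> \<kappa> < 1"
      then have "1 \<le> \<kappa> ^ (2 * k)" by (intro one_le_power) simp
      then show False using kk by simp
    qed
    show "M < 4 * a * \<kappa>" using j a by (simp add: \<kappa>_def k_def pos_divide_less_eq mult.commute)
  qed
  define d where "d = min (1/8) ((1 - b / M) / 4)"
  have d: "0 < d" "d < 1 / 4" using M by (auto simp: d_def)
  have dM: "b \<le> M * (1 - 4 * d)"
  proof -
    have "d \<le> (1 - b / M) / 4" unfolding d_def by (rule min.cobounded2)
    then have "4 * d \<le> 1 - b / M" by simp
    then have "M * (b / M) \<le> M * (1 - 4 * d)" using M by (intro mult_left_mono) auto
    then show ?thesis using M by simp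
  qed
  obtain f f' m where f: "smooth_on {0<..} f" "\<And>s. 0 < s \<Longrightarrow> (f has_real_derivative f' s) (at s)"
    "\<And>s. 0 \<le> f' s \<and> f' s \<le> M" "\<And>s. 0 < s \<Longrightarrow> 0 \<le> f s \<and> f s \<le> m" "\<And>s. 0 < s \<Longrightarrow> s \<le> d \<Longrightarrow> f s = 0"
    "\<And>s. 1 - d \<le> s \<Longrightarrow> f s = m" "M * (1 - 4 * d) \<le> m"
    using smooth_ramp[OF M(1) d] by blast
  \<comment> \<open>The offset keeps \<open>X\<close> away from 0, where the root is not smooth.
    Being below \<open>d ^ k\<close>, it leaves a neighbourhood of the origin on which the composite
    with \<open>f\<close> vanishes.\<close>
  define \<delta> where "\<delta> = (d / 2) ^ k"
  have \<delta>: "0 < \<delta>" using d by (simp add: \<delta>_def)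
  define N where "N = M * (1 / k) * \<delta> powr (1 / k - 1)"
  have N0: "0 \<le> N" using M by (simp add: N_def)
  \<comment> \<open>The transversal quadratic term makes sublevel sets bounded. \<open>N\<close>
    bounds the factor \<mu> between the gradients of \<open>X\<close> and \<open>H\<close>, so this
    \<epsilon> keeps the transversal angular speed 2 \<epsilon> \<mu> below 2.\<close>
  define \<epsilon> where "\<epsilon> = 1 / (N + 1)"
  have \<epsilon>: "0 < \<epsilon>" "\<epsilon> * N < 1" using N0 by (auto simp: \<epsilon>_def)
  define X where "X z = (fst z \<bullet> u / a) ^ (2 * k) + (snd z \<bullet> u) ^ (2 * k)
     + \<epsilon> * (fst z \<bullet> fst z - (fst z \<bullet> u)\<^sup>2 + (snd z \<bullet> snd z - (snd z \<bullet> u)\<^sup>2)) + \<delta>" for z :: "'n ps"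
  have cs: "(y \<bullet> u)\<^sup>2 \<le> y \<bullet> y" for y using Cauchy_Schwarz_ineq[of y u] by (simp add: uu)
  have ev: "0 \<le> x ^ (2 * k)" for x :: real by simp
  have Xpl: "(fst z \<bullet> u / a) ^ (2 * k) + (snd z \<bullet> u) ^ (2 * k) + \<delta> \<le> X z" for z
    using cs[of "fst z"] cs[of "snd z"] \<epsilon> by (simp add: X_def)
  have X\<delta>: "\<delta> \<le> X z" for z using Xpl[of z] ev[of "fst z \<bullet> u / a"] ev[of "snd z \<bullet> u"] by linarith
  have X0: "0 < X z" for z using X\<delta>[of z] \<delta> by linarith
  define Y where "Y z = X z powr (1 / k)" for z
  have Y0: "0 < Y z" for z using X0[of z] by (simp add: Y_def)
  define H where "H z = f (Y z)" for z
  have smX: "smooth_on UNIV X"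
  proof -
    have lu: "smooth_on UNIV (\<lambda>z::'n ps. fst z \<bullet> v)" "smooth_on UNIV (\<lambda>z::'n ps. snd z \<bullet> v)" for v
      by (rule smooth_on_linear, intro bounded_linear_inner_left_comp bounded_linear_fst bounded_linear_snd)+
    have sq: "smooth_on UNIV (\<lambda>z::'n ps. \<Sum>b\<in>Basis. (fst z \<bullet> b) ^ 2)" "smooth_on UNIV (\<lambda>z::'n ps. \<Sum>b\<in>Basis. (snd z \<bullet> b) ^ 2)"
      by (intro smooth_on_sum smooth_on_power lu open_UNIV finite_Basis)+
    have "smooth_on UNIV (\<lambda>z::'n ps. (1 / a * (fst z \<bullet> u)) ^ (2 * k) + (snd z \<bullet> u) ^ (2 * k)
     + \<epsilon> * (((\<Sum>b\<in>Basis. (fst z \<bullet> b) ^ 2) + (- 1) * (fst z \<bullet> u) ^ 2) + ((\<Sum>b\<in>Basis. (snd z \<bullet> b) ^ 2) + (- 1) * (snd z \<bullet> u) ^ 2)) + \<delta>)"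
      by (intro smooth_on_add smooth_on_mult smooth_on_power smooth_on_const sq lu open_UNIV)
    then show ?thesis
      by (rule smooth_on_cong[OF open_UNIV]) (simp add: X_def euclidean_inner[of "fst _" "fst _"] euclidean_inner[of "snd _" "snd _"] power2_eq_square)
  qed
  have smY: "smooth_on UNIV Y" unfolding Y_def
    by (rule smooth_on_compose[OF open_UNIV smX smooth_on_powr]) (use X0 in auto)
  have smH: "smooth_on UNIV H" unfolding H_def
    by (rule smooth_on_compose[OF open_UNIV smY f(1)]) (use Y0 in auto)
  have contX: "continuous_on UNIV X"
    using smooth_onD(1)[OF smX] differentiable_imp_continuous_on by blast
  define gq where "gq z = (2 * k / a * (fst z \<bullet> u / a) ^ (2 * k - 1) - 2 * \<epsilon> * (fst z \<bullet> u)) *\<^sub>R u + (2 * \<epsilon>) *\<^sub>R fst z" for z :: "'n ps"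
  define gp where "gp z = (2 * k * (snd z \<bullet> u) ^ (2 * k - 1) - 2 * \<epsilon> * (snd z \<bullet> u)) *\<^sub>R u + (2 * \<epsilon>) *\<^sub>R snd z" for z :: "'n ps"
  have dX: "(X has_derivative (\<lambda>v. gq z \<bullet> fst v + gp z \<bullet> snd v)) (at z)" for z
    unfolding X_def gq_def gp_def using a
    by (auto intro!: derivative_eq_intros simp: inner_add_left inner_diff_left inner_commute algebra_simps diff_Suc_less)
  define \<mu> where "\<mu> z = f' (Y z) * (1 / k * X z powr (1 / k - 1))" for z
  have dH: "(H has_derivative (\<lambda>v. \<mu> z * (gq z \<bullet> fst v + gp z \<bullet> snd v))) (at z)" for z
  proof -
    have "((\<lambda>s. f (s powr (1 / k))) has_real_derivative f' (Y z) * (1 / k * X z powr (1 / k - 1))) (at (X z))"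
      unfolding Y_def by (rule DERIV_chain2[OF f(2) has_real_derivative_powr]) (use X0[of z] in auto)
    from DERIV_compose_FDERIV[OF this dX] show ?thesis
      unfolding H_def Y_def \<mu>_def by (simp add: mult.commute)
  qed
  have \<mu>N: "0 \<le> \<mu> z" "\<mu> z \<le> N" for z
  proof -
    show "0 \<le> \<mu> z" using f(3) by (simp add: \<mu>_def)
    have "X z powr (1 / k - 1) \<le> \<delta> powr (1 / k - 1)"
      using X\<delta>[of z] \<delta> k by (intro powr_mono2') auto
    then have "\<mu> z \<le> M * (1 / k * \<delta> powr (1 / k - 1))"
      unfolding \<mu>_def using f(3)[of "Y z"] M by (intro mult_mono) auto
    then show "\<mu> z \<le> N" by (simp add: N_def mult.assoc)
  qed
  have no_orbit: False if T: "0 < T" "T \<le> 1" and orb: "sym_periodic_orbit U H T x" for T x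
  proof -
    have xd: "x differentiable (at t)" and om: "omega0 (vector_derivative x (at t)) v = - frechet_derivative H (at (x t)) v" for t v
      using orb unfolding sym_periodic_orbit_def ham_orbit_def by blast+
    have sym: "x (T - t) = x (- t)" "x (- t) = tau0 (x t)" for t using orb unfolding sym_periodic_orbit_def by blast+
    have nonconst: "\<exists>s t. x s \<noteq> x t" using orb unfolding sym_periodic_orbit_def by blast
    have fr: "frechet_derivative H (at z) v = \<mu> z * (gq z \<bullet> fst v + gp z \<bullet> snd v)" for z v
      by (rule frechet_eqI[OF dH])
    have vd: "vector_derivative x (at t) = (- (\<mu> (x t) *\<^sub>R gp (x t)), \<mu> (x t) *\<^sub>R gq (x t))" for t
    proof -
      let ?w = "vector_derivative x (at t)"
      have "fst ?w \<bullet> v = - (\<mu> (x t) *\<^sub>R gp (x t)) \<bullet> v" for v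
        using om[of t "(0, v)"] by (simp add: omega0_def fr)
      moreover have "snd ?w \<bullet> v = (\<mu> (x t) *\<^sub>R gq (x t)) \<bullet> v" for v
        using om[of t "(v, 0)"] by (simp add: omega0_def fr)
      ultimately show ?thesis by (metis prod.collapse vector_eq_rdot)
    qed
    have xv: "(x has_vector_derivative (- (\<mu> (x t) *\<^sub>R gp (x t)), \<mu> (x t) *\<^sub>R gq (x t))) (at t)" for t
      using xd[of t] vd[of t] vector_derivative_works by metis
    have Xc: "X (x t) = X (x 0)" for t
    proof -
      have "\<forall>t. ((\<lambda>t. X (x t)) has_real_derivative 0) (at t)"
      proof
        fix t
        have "((\<lambda>t. X (x t)) has_derivative (\<lambda>h. gq (x t) \<bullet> fst (h *\<^sub>R (- (\<mu> (x t) *\<^sub>R gp (x t)), \<mu> (x t) *\<^sub>R gq (x t)))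
            + gp (x t) \<bullet> snd (h *\<^sub>R (- (\<mu> (x t) *\<^sub>R gp (x t)), \<mu> (x t) *\<^sub>R gq (x t))))) (at t)"
          by (rule has_derivative_compose[OF xv[unfolded has_vector_derivative_def] dX])
        then show "((\<lambda>t. X (x t)) has_real_derivative 0) (at t)"
          by (simp add: has_field_derivative_def inner_commute lambda_zero)
      qed
      from DERIV_isconst_all[OF this] show "X (x t) = X (x 0)" by blast
    qed
    define \<mu>0 where "\<mu>0 = \<mu> (x 0)"
    have \<mu>c: "\<mu> (x t) = \<mu>0" for t using Xc[of t] by (simp add: \<mu>0_def \<mu>_def Y_def)
    have dq: "((\<lambda>t. fst (x t) \<bullet> v) has_real_derivative - \<mu>0 * (gp (x t) \<bullet> v)) (at t)"
      and dp: "((\<lambda>t. snd (x t) \<bullet> v) has_real_derivative \<mu>0 * (gq (x t) \<bullet> v)) (at t)" for t v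
    proof -
      have D: "(x has_derivative (\<lambda>h. h *\<^sub>R (- (\<mu>0 *\<^sub>R gp (x t)), \<mu>0 *\<^sub>R gq (x t)))) (at t)"
        using xv[of t] by (simp add: has_vector_derivative_def \<mu>c)
      show "((\<lambda>t. fst (x t) \<bullet> v) has_real_derivative - \<mu>0 * (gp (x t) \<bullet> v)) (at t)"
        unfolding has_field_derivative_def
        by (rule has_derivative_eq_rhs[OF has_derivative_inner_left[OF has_derivative_fst[OF D]]]) (auto simp: mult_ac)
      show "((\<lambda>t. snd (x t) \<bullet> v) has_real_derivative \<mu>0 * (gq (x t) \<bullet> v)) (at t)"
        unfolding has_field_derivative_def
        by (rule has_derivative_eq_rhs[OF has_derivative_inner_left[OF has_derivative_snd[OF D]]]) (auto simp: mult_ac)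
    qed
    have half0: "y = 0" if "- y = y" for y :: "real^'n" using that by (simp add: vec_eq_iff)
    \<comment> \<open>The symmetry fixes the points at times 0 and T/2, so both lie in p = 0; this
      confronts the chord estimate with half a period, at most 1/2.\<close>
    have p0: "snd (x 0) = 0" "snd (x (T / 2)) = 0"
    proof -
      have "snd (x 0) = - snd (x 0)" using sym(2)[of 0] by (metis minus_zero snd_conv tau0_def)
      then show "snd (x 0) = 0" using half0 by metis
      have "x (T / 2) = tau0 (x (T / 2))" using sym[of "T / 2"] by simp
      then have "snd (x (T / 2)) = - snd (x (T / 2))" by (metis snd_conv tau0_def)
      then show "snd (x (T / 2)) = 0" using half0 by metis
    qed
    have h: "0 < T / 2" "T / 2 \<le> 1 / 2" using T by auto
    show False
    proof (cases "\<mu>0 = 0")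
      case True
      have "fst (x t) = fst (x 0)" "snd (x t) = snd (x 0)" for t
      proof -
        have "fst (x t) \<bullet> v = fst (x 0) \<bullet> v" "snd (x t) \<bullet> v = snd (x 0) \<bullet> v" for v
          using DERIV_isconst_all[of "\<lambda>t. fst (x t) \<bullet> v" t 0] DERIV_isconst_all[of "\<lambda>t. snd (x t) \<bullet> v" t 0] dq[of v] dp[of v] True by simp_all
        then show "fst (x t) = fst (x 0)" "snd (x t) = snd (x 0)" by (metis vector_eq_rdot)+
      qed
      then show False using nonconst by (metis prod.collapse)
    next
      case False
      then have \<mu>0: "0 < \<mu>0" "\<mu>0 \<le> N" using \<mu>N[of "x 0"] by (auto simp: \<mu>0_def)
      \<comment> \<open>Components orthogonal to \<open>u\<close> rotate uniformly with angular
        speed below 2. The chord estimate with n = 2 and \<kappa> = 1 / sqrt 2 rules out a half turn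
        within time 1/2.\<close>
      have perp: "fst (x t) \<bullet> v = 0 \<and> snd (x t) \<bullet> v = 0" if v: "u \<bullet> v = 0" for v t
      proof (rule ccontr)
        assume nz: "\<not> ?thesis"
        define \<nu> where "\<nu> = 2 * \<epsilon> * \<mu>0"
        have \<nu>: "0 < \<nu>" "\<nu> < 2"
        proof -
          show "0 < \<nu>" using \<epsilon> \<mu>0 by (simp add: \<nu>_def)
          have "\<epsilon> * \<mu>0 \<le> \<epsilon> * N" using \<epsilon> \<mu>0 by (intro mult_left_mono) auto
          then have "\<epsilon> * \<mu>0 < 1" using \<epsilon>(2) by linarith
          then show "\<nu> < 2" by (simp add: \<nu>_def)
        qed
        define Q P where "Q = (\<lambda>t. fst (x t) \<bullet> v)" and "P = (\<lambda>t. snd (x t) \<bullet> v)"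
        have Q': "(Q has_real_derivative - \<nu> * P t ^ (2 - 1)) (at t)" for t
          using dq[of v t] v by (simp add: Q_def P_def gp_def \<nu>_def inner_add_left mult_ac)
        have P': "(P has_real_derivative \<nu> * Q t ^ (2 - 1)) (at t)" for t
          using dp[of v t] v by (simp add: Q_def P_def gq_def \<nu>_def inner_add_left mult_ac)
        have con: "Q t ^ 2 + P t ^ 2 = Q 0 ^ 2 + P 0 ^ 2" for t
        proof -
          have "\<forall>t. ((\<lambda>t. Q t ^ 2 + P t ^ 2) has_real_derivative 0) (at t)"
            using Q' P' by (auto intro!: derivative_eq_intros)
          from DERIV_isconst_all[OF this] show ?thesis by blast
        qed
        define c where "c = sqrt (Q 0 ^ 2 + P 0 ^ 2)"
        have c: "0 < c" "Q 0 ^ 2 + P 0 ^ 2 = c ^ 2"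
        proof -
          have "0 < Q t ^ 2 + P t ^ 2" using nz by (auto simp: Q_def P_def sum_power2_gt_zero_iff)
          then have "0 < Q 0 ^ 2 + P 0 ^ 2" using con[of t] by linarith
          then show "0 < c" by (simp only: c_def real_sqrt_gt_0_iff)
          show "Q 0 ^ 2 + P 0 ^ 2 = c ^ 2" by (simp add: c_def)
        qed
        have "4 * (1 / sqrt 2) * c \<le> T / 2 * \<nu> * c ^ (2 - 1)"
          by (rule planar_chord_time[OF _ _ \<nu>(1) h(1) Q' P']) (use p0 c in \<open>auto simp: P_def power_divide\<close>)
        then have "(4 * (1 / sqrt 2)) * c \<le> (T / 2 * \<nu>) * c" by simp
        then have "4 * (1 / sqrt 2) \<le> T / 2 * \<nu>" by (rule mult_right_le_imp_le) (rule c(1))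
        also have "\<dots> \<le> 1 / 2 * 2" using h \<nu> by (intro mult_mono) auto
        finally have "4 \<le> sqrt 2" by (simp add: field_simps)
        then show False using sqrt2_less_2 by simp
      qed
      define Q P where "Q = (\<lambda>t. fst (x t) \<bullet> u / a)" and "P = (\<lambda>t. snd (x t) \<bullet> u)"
      define \<nu> where "\<nu> = 2 * k * \<mu>0 / a"
      have \<nu>: "0 < \<nu>" using \<mu>0 k a by (simp add: \<nu>_def)
      have Q': "(Q has_real_derivative - \<nu> * P t ^ (2 * k - 1)) (at t)" for t
        using DERIV_cdivide[OF dq[of u t], of a] by (simp add: Q_def P_def gp_def \<nu>_def inner_add_left inner_diff_left uu mult_ac)
      have P': "(P has_real_derivative \<nu> * Q t ^ (2 * k - 1)) (at t)" for t
        using dp[of u t] by (simp add: Q_def P_def gq_def \<nu>_def inner_add_left inner_diff_left uu mult_ac)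
      have planar: "Q 0 ^ (2 * k) + P 0 ^ (2 * k) = 0"
      proof (rule ccontr)
        assume ne: "Q 0 ^ (2 * k) + P 0 ^ (2 * k) \<noteq> 0"
        define C where "C = Q 0 ^ (2 * k) + P 0 ^ (2 * k)"
        have C: "0 < C" using ne ev[of "Q 0"] ev[of "P 0"] unfolding C_def by linarith
        define c where "c = C powr (1 / (2 * k))"
        have c: "0 < c" "c ^ (2 * k) = C"
        proof -
          show "0 < c" using C by (simp add: c_def)
          then have "c ^ (2 * k) = c powr real (2 * k)" by (rule powr_realpow[symmetric])
          also have "\<dots> = C powr (1 / (2 * k) * real (2 * k))" unfolding c_def by (rule powr_powr)
          also have "1 / (2 * k) * real (2 * k) = 1" using k by simp
          finally show "c ^ (2 * k) = C" using C by simp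
        qed
        have "4 * \<kappa> * c \<le> T / 2 * \<nu> * c ^ (2 * k - 1)"
          by (rule planar_chord_time[OF _ _ \<nu> h(1) Q' P']) (use p0 c k \<kappa> in \<open>auto simp: P_def C_def\<close>)
        also have "c ^ (2 * k - 1) = c ^ (2 * k - 2) * c"
        proof -
          have "2 * k - 1 = Suc (2 * k - 2)" using k by simp
          then show ?thesis by simp
        qed
        finally have "(4 * \<kappa>) * c \<le> (T / 2 * \<nu> * c ^ (2 * k - 2)) * c" by (simp add: mult.assoc)
        then have "4 * \<kappa> \<le> T / 2 * (\<nu> * c ^ (2 * k - 2))" using c(1) by simp
        also have "\<dots> \<le> 1 / 2 * (\<nu> * c ^ (2 * k - 2))" using h \<nu> c by (intro mult_right_mono) auto
        finally have "4 * a * \<kappa> \<le> a / 2 * (\<nu> * c ^ (2 * k - 2))" using a by (simp add: mult_left_mono)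
        \<comment> \<open>The factor 2k in \<nu> cancels against the 1/k from the root. What
          multiplies the slope of \<open>f\<close> is at most one, because \<open>X\<close> is at
          least c^(2k) and the exponent 1/k - 1 is nonpositive.\<close>
        also have "\<dots> = f' (Y (x 0)) * (X (x 0) powr (1 / k - 1) * c ^ (2 * k - 2))"
          using a k by (simp add: \<nu>_def \<mu>0_def \<mu>_def)
        also have "\<dots> \<le> M * 1"
        proof (intro mult_mono)
          have "c ^ (2 * k) \<le> X (x 0)" using Xpl[of "x 0"] \<delta> c(2) by (simp add: C_def Q_def P_def)
          then have "X (x 0) powr (1 / k - 1) \<le> (c ^ (2 * k)) powr (1 / k - 1)"
            using c k by (intro powr_mono2') auto
          also have "(c ^ (2 * k)) powr (1 / k - 1) = c powr (real (2 * k) * (1 / k - 1))"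
            using c(1) by (simp add: powr_realpow[symmetric] powr_powr)
          also have "real (2 * k) * (1 / k - 1) = - real (2 * k - 2)" using k by (simp add: of_nat_diff right_diff_distrib)
          finally have "X (x 0) powr (1 / k - 1) * c ^ (2 * k - 2) \<le> c powr (- real (2 * k - 2)) * c ^ (2 * k - 2)"
            using c(1) by (intro mult_right_mono) auto
          also have "\<dots> = 1" using c(1) by (simp add: powr_minus powr_realpow)
          finally show "X (x 0) powr (1 / k - 1) * c ^ (2 * k - 2) \<le> 1" .
        qed (use f(3)[of "Y (x 0)"] M c in auto)
        finally show False using \<kappa>(4) by simp
      qed
      have QP: "Q t = 0 \<and> P t = 0" for t
      proof -
        have "Q t ^ (2 * k) + P t ^ (2 * k) = Q 0 ^ (2 * k) + P 0 ^ (2 * k)"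
        proof -
          have "\<forall>t. ((\<lambda>t. Q t ^ (2 * k) + P t ^ (2 * k)) has_real_derivative 0) (at t)"
          proof
            fix t
            have "((\<lambda>t. Q t ^ (2 * k) + P t ^ (2 * k)) has_real_derivative
              of_nat (2 * k) * (- \<nu> * P t ^ (2 * k - 1) * Q t ^ (2 * k - Suc 0)) + of_nat (2 * k) * (\<nu> * Q t ^ (2 * k - 1) * P t ^ (2 * k - Suc 0))) (at t)"
              by (intro DERIV_add DERIV_power Q' P')
            then show "((\<lambda>t. Q t ^ (2 * k) + P t ^ (2 * k)) has_real_derivative 0) (at t)" by (simp add: mult_ac)
          qed
          from DERIV_isconst_all[OF this] show ?thesis by blast
        qed
        then have "Q t ^ (2 * k) = 0" "P t ^ (2 * k) = 0" using planar ev[of "Q t"] ev[of "P t"] by linarith+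
        then show ?thesis by simp
      qed
      \<comment> \<open>With the planar and the transversal parts excluded, the orbit would rest at
        the origin.\<close>
      have "x t = 0" for t
      proof -
        have "fst (x t) \<bullet> v = 0 \<and> snd (x t) \<bullet> v = 0" for v
        proof -
          have "u \<bullet> (v - (u \<bullet> v) *\<^sub>R u) = 0" by (simp add: inner_diff_right uu)
          from perp[OF this, of t] QP[of t] show ?thesis using a by (simp add: Q_def P_def inner_diff_right)
        qed
        then have "fst (x t) = 0" "snd (x t) = 0" by (metis inner_eq_zero_iff)+
        then show ?thesis by (simp add: prod_eq_iff)
      qed
      then show False using nonconst by simp
    qed
  qed
  have XU: "z \<in> U" if "X z \<le> 1" for z
  proof -
    have "(fst z \<bullet> u / a) ^ (2 * k) < 1" "(snd z \<bullet> u) ^ (2 * k) < 1"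
      using Xpl[of z] that \<delta> ev[of "fst z \<bullet> u / a"] ev[of "snd z \<bullet> u"] by linarith+
    moreover have "\<bar>y\<bar> < 1" if "y ^ (2 * k) < 1" for y :: real
    proof (rule ccontr)
      assume "\<not> \<bar>y\<bar> < 1"
      then have "1 \<le> \<bar>y\<bar> ^ (2 * k)" by (intro one_le_power) simp
      then show False using that power_even_abs[of "2 * k" y] by simp
    qed
    ultimately have "\<bar>fst z \<bullet> u / a\<bar> < 1" "\<bar>snd z \<bullet> u\<bar> < 1" by blast+
    then have "\<bar>fst z \<bullet> u\<bar> < a \<and> \<bar>snd z \<bullet> u\<bar> < 1" using a by (simp add: abs_divide)
    then show ?thesis using sub by blast
  qed
  have "compact {z. X z \<le> 1}"
    unfolding compact_eq_bounded_closed
  proof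
    show "closed {z. X z \<le> 1}" by (intro closed_Collect_le contX continuous_intros)
    have "norm z \<le> sqrt (a\<^sup>2 + 1 / \<epsilon>) + sqrt (1 + 1 / \<epsilon>)" if z: "X z \<le> 1" for z
    proof -
      have A: "(fst z \<bullet> u / a) ^ (2 * k) \<le> 1" "(snd z \<bullet> u) ^ (2 * k) \<le> 1"
        using Xpl[of z] z \<delta> ev[of "fst z \<bullet> u / a"] ev[of "snd z \<bullet> u"] by linarith+
      have le1: "y\<^sup>2 \<le> 1" if "y ^ (2 * k) \<le> 1" for y :: real
        using that k one_less_power[of "y\<^sup>2" k] by (simp only: power_mult) linarith
      have qa: "(fst z \<bullet> u)\<^sup>2 \<le> a\<^sup>2" using le1[OF A(1)] a by (simp add: power_divide)
      have "\<epsilon> * (fst z \<bullet> fst z - (fst z \<bullet> u)\<^sup>2 + (snd z \<bullet> snd z - (snd z \<bullet> u)\<^sup>2)) \<le> 1"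
        using z \<delta> ev[of "fst z \<bullet> u / a"] ev[of "snd z \<bullet> u"] unfolding X_def by linarith
      then have B: "fst z \<bullet> fst z - (fst z \<bullet> u)\<^sup>2 + (snd z \<bullet> snd z - (snd z \<bullet> u)\<^sup>2) \<le> 1 / \<epsilon>"
        using \<epsilon> by (simp add: pos_le_divide_eq mult.commute)
      have "(norm (fst z))\<^sup>2 \<le> a\<^sup>2 + 1 / \<epsilon>" using B qa cs[of "snd z"] unfolding power2_norm_eq_inner by linarith
      moreover have "(norm (snd z))\<^sup>2 \<le> 1 + 1 / \<epsilon>" using B le1[OF A(2)] cs[of "fst z"] unfolding power2_norm_eq_inner by linarith
      ultimately show ?thesis using norm_pair_le[of z] by (smt (verit) real_le_rsqrt)
    qed
    then show "bounded {z. X z \<le> 1}" unfolding bounded_iff by blast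
  qed
  moreover have "H z = m" if "\<not> X z \<le> 1" for z
  proof -
    have "1 \<le> Y z" using that k unfolding Y_def by (intro ge_one_powr_ge_zero) auto
    then show ?thesis unfolding H_def using d by (intro f(6)) simp
  qed
  ultimately have K: "\<exists>K. compact K \<and> K \<subseteq> U \<and> (\<forall>z\<in>U - K. H z = m)"
    using XU by (intro exI[of _ "{z. X z \<le> 1}"]) auto
  have V: "\<exists>V. open V \<and> V \<noteq> {} \<and> V \<subseteq> U \<and> V \<inter> Fix_tau0 \<noteq> {} \<and> (\<forall>z\<in>V. H z = 0)"
  proof (intro exI[of _ "{z. X z < d ^ k}"] conjI ballI)
    show "open {z. X z < d ^ k}" by (intro open_Collect_less contX continuous_intros)
    have "\<delta> < d ^ k" unfolding \<delta>_def using d k by (intro power_strict_mono) auto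
    moreover have "X 0 = \<delta>" using k by (simp add: X_def)
    ultimately have z: "0 \<in> {z. X z < d ^ k}" by simp
    then show "{z. X z < d ^ k} \<noteq> {}" by blast
    have "(0 :: 'n ps) \<in> Fix_tau0" by (simp add: Fix_tau0_def tau0_def zero_prod_def)
    then show "{z. X z < d ^ k} \<inter> Fix_tau0 \<noteq> {}" using z by blast
    have dk: "d ^ k \<le> 1" using d by (intro power_le_one) auto
    show "{z. X z < d ^ k} \<subseteq> U" using XU dk by fastforce
    fix z assume z: "z \<in> {z. X z < d ^ k}"
    have "Y z \<le> (d ^ k) powr (1 / k)" unfolding Y_def using z X0[of z] k by (intro powr_mono2) auto
    also have "\<dots> = d" using d k by (simp add: powr_realpow[symmetric] powr_powr)
    finally show "H z = 0" unfolding H_def using f(5) Y0 by blast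
  qed
  have "HZ_admissible U H m"
    unfolding HZ_admissible_def
  proof (intro conjI K V)
    show "smooth_on U H" by (rule smooth_on_subset[OF smH]) simp
    show "\<forall>z\<in>U. tau0 z \<in> U \<longrightarrow> H (tau0 z) = H z" by (simp add: H_def Y_def X_def tau0_def)
    show "\<forall>z\<in>U. 0 \<le> H z \<and> H z \<le> m" using f(4)[OF Y0] by (simp add: H_def)
    show "\<not> (\<exists>T x. 0 < T \<and> T \<le> 1 \<and> sym_periodic_orbit U H T x)" using no_orbit by blast
  qed
  then show ?thesis using dM f(7) by (intro exI conjI) (rule order_trans)
qed

subsection \<open>Capacities of strips\<close>

text \<open>An interior point can be moved a little along \<open>v\<close> both ways, which shifts
  \<open>l\<close> by equal amounts up and down; equality in the bound is thus impossible.\<close>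

lemma interior_strip:
  fixes S :: "'a::euclidean_space set"
  assumes l: "bounded_linear l" and v: "l v = (1::real)" and S: "\<And>z. z \<in> S \<Longrightarrow> \<bar>l z - c\<bar> \<le> b" and z: "z \<in> interior S"
  shows "\<bar>l z - c\<bar> < b"
proof -
  interpret bounded_linear l by fact
  obtain r where r: "r > 0" "ball z r \<subseteq> S" using z by (auto simp: mem_interior)
  define t where "t = r / (2 * (norm v + 1))"
  have t: "t > 0" using r by (simp add: t_def add_nonneg_pos)
  have "t * norm v \<le> t * (norm v + 1)" using t by simp
  also have "\<dots> = r / 2" by (simp add: t_def divide_simps) (smt (verit) norm_ge_zero)
  finally have "z + t *\<^sub>R v \<in> S" "z - t *\<^sub>R v \<in> S"
    using r t by (auto intro!: subsetD[OF r(2)] simp: dist_norm)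
  from S[OF this(1)] S[OF this(2)] show ?thesis using t v by (simp add: add scale diff abs_le_iff abs_less_iff)
qed

text \<open>Serves two sets: the cylinder, with a coordinate axis and c = 0, and the product of the
  body with the ball, with a width direction and the offset of the middle hyperplane.\<close>

lemma c_EHZ_tau0_strip_le:
  fixes S :: "'n::finite ps set"
  assumes u: "norm u = 1" and a: "a > 0" and S: "\<And>z. z \<in> S \<Longrightarrow> \<bar>fst z \<bullet> u - c\<bar> \<le> a \<and> \<bar>snd z \<bullet> u\<bar> \<le> 1"
    and tau: "\<And>z. z \<in> S \<Longrightarrow> tau0 z \<in> S"
  shows "c_EHZ_tau0 S \<le> ereal (4 * a)"
proof -
  have uu: "u \<bullet> u = 1" using u by (simp add: norm_eq_1)
  have strip: "\<bar>fst z \<bullet> u - c\<bar> < a \<and> \<bar>snd z \<bullet> u\<bar> < 1" if z: "z \<in> interior S" for z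
  proof
    show "\<bar>fst z \<bullet> u - c\<bar> < a"
      by (rule interior_strip[where l = "\<lambda>z. fst z \<bullet> u" and v = "(u, 0)", OF _ _ _ z])
         (use S uu in \<open>auto intro: bounded_linear_inner_left_comp bounded_linear_fst\<close>)
    have "\<bar>snd z \<bullet> u - 0\<bar> < 1"
      by (rule interior_strip[where l = "\<lambda>z. snd z \<bullet> u" and v = "(0, u)", OF _ _ _ z])
         (use S uu in \<open>auto intro: bounded_linear_inner_left_comp bounded_linear_snd\<close>)
    then show "\<bar>snd z \<bullet> u\<bar> < 1" by simp
  qed
  have itau: "tau0 z \<in> interior S" if z: "z \<in> interior S" for z
  proof (rule interiorI)
    have "continuous_on UNIV (tau0 :: 'n ps \<Rightarrow> 'n ps)" unfolding tau0_def by (intro continuous_intros)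
    then show "open (tau0 -` interior S :: 'n ps set)" by (rule open_vimage[OF open_interior])
    have tt: "tau0 (tau0 y) = y" for y :: "'n ps" by (simp add: tau0_def)
    show "tau0 z \<in> tau0 -` interior S" using z by (simp add: tt)
    show "tau0 -` interior S \<subseteq> S"
    proof
      fix y assume "y \<in> tau0 -` interior S"
      then have "tau0 y \<in> S" using interior_subset by auto
      then show "y \<in> S" using tau[of "tau0 y"] by (simp add: tt)
    qed
  qed
  show ?thesis unfolding c_EHZ_tau0_def c_HZ_tau0_def
    by (rule Sup_least) (use HZ_admissible_strip_bound[OF open_interior itau u a strip] in force)
qed

lemma c_EHZ_tau0_Z_cyl:
  fixes \<Delta> :: "(real^'n::{finite,wellorder}) set"
  assumes w: "width \<Delta> > 0"
  shows "c_EHZ_tau0 (Z_cyl \<Delta>) = ereal (2 * width \<Delta>)"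
proof (rule antisym)
  define e :: "(real, 'n) vec" where "e = axis first_idx 1"
  have e: "norm e = 1" "x \<bullet> e = x $ first_idx" for x by (simp_all add: e_def inner_axis)
  have "c_EHZ_tau0 (Z_cyl \<Delta>) \<le> ereal (4 * (width \<Delta> / 2))"
    by (rule c_EHZ_tau0_strip_le[OF e(1), where c = 0]) (use w in \<open>auto simp: Z_cyl_def e(2) tau0_def\<close>)
  then show "c_EHZ_tau0 (Z_cyl \<Delta>) \<le> ereal (2 * width \<Delta>)" by simp
  have sub: "{z. \<bar>fst z \<bullet> e\<bar> < width \<Delta> / 2 \<and> \<bar>snd z \<bullet> e\<bar> < 1} \<subseteq> interior (Z_cyl \<Delta>)"
  proof (rule interior_maximal)
    show "open {z. \<bar>fst z \<bullet> e\<bar> < width \<Delta> / 2 \<and> \<bar>snd z \<bullet> e\<bar> < 1}"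
      by (intro open_Collect_conj open_Collect_less continuous_intros)
  qed (auto simp: Z_cyl_def e(2))
  show "ereal (2 * width \<Delta>) \<le> c_EHZ_tau0 (Z_cyl \<Delta>)"
  proof (rule dense_le)
    fix y assume y: "y < ereal (2 * width \<Delta>)"
    \<comment> \<open>\<open>y\<close> may be negative or minus infinity, whereas the construction
      takes a positive \<open>b\<close>; hence the midpoint with \<open>max r 0\<close>.\<close>
    obtain b where b: "0 < b" "b < 4 * (width \<Delta> / 2)" "y \<le> ereal b"
    proof (cases y)
      case (real r)
      show thesis by (rule that[of "(max r 0 + 2 * width \<Delta>) / 2"]) (use y w real in auto)
    next
      case MInf
      show thesis by (rule that[of "width \<Delta>"]) (use w MInf in auto)
    qed (use y in auto)
    obtain H m where "b \<le> m" "HZ_admissible (interior (Z_cyl \<Delta>)) H m"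
      using HZ_admissible_cylinder_exists[OF e(1) b(1,2) sub] by blast
    then have "ereal m \<le> c_EHZ_tau0 (Z_cyl \<Delta>)"
      unfolding c_EHZ_tau0_def c_HZ_tau0_def by (intro Sup_upper) blast
    then show "y \<le> c_EHZ_tau0 (Z_cyl \<Delta>)" using b(3) \<open>b \<le> m\<close> by (meson ereal_less_eq(3) order_trans)
  qed
qed

text \<open>The body lies in a slab of thickness \<open>width \<Delta>\<close> orthogonal to
  \<open>u\<close>, and the unit ball in the slab of half-width 1. Their product is therefore
  subject to the same strip bound 4 (width / 2) that the cylinder attains.\<close>

theorem theorem1p36:
  fixes \<Delta> :: "(real, 'n::{finite,wellorder}) vec set" and u qbar :: "(real, 'n) vec"
  assumes "convex_body \<Delta>"
    and "u \<in> width_dirs \<Delta>"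
    and "qbar \<in> mid_hyperplane \<Delta> u"
  shows "zeta_tau0 \<Delta> \<le> c_EHZ_tau0 (Z_cyl \<Delta>)
    \<and> c_EHZ_tau0 (Z_cyl \<Delta>) = ereal (2 * width \<Delta>)"
proof -
  have comp: "compact \<Delta>" and int: "interior \<Delta> \<noteq> {}" using assms(1) by (auto simp: convex_body_def)
  have u: "norm u = 1" and w: "width \<Delta> = support_fn \<Delta> u + support_fn \<Delta> (- u)"
    using assms(2) by (auto simp: width_dirs_def)
  have sup: "x \<bullet> v \<le> support_fn \<Delta> v" if "x \<in> \<Delta>" for x v
  proof -
    have "compact ((\<lambda>x. x \<bullet> v) ` \<Delta>)" by (intro compact_continuous_image continuous_intros comp)
    then have "bdd_above ((\<lambda>x. x \<bullet> v) ` \<Delta>)"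
      by (rule bounded_imp_bdd_above[OF compact_imp_bounded])
    then show ?thesis unfolding support_fn_def using that by (intro cSup_upper) auto
  qed
  \<comment> \<open>The value of the inner product with \<open>u\<close> on
    \<open>mid_hyperplane \<Delta> u\<close>, about which the slab is symmetric.\<close>
  define c where "c = (support_fn \<Delta> u - support_fn \<Delta> (- u)) / 2"
  have strip: "\<bar>x \<bullet> u - c\<bar> \<le> width \<Delta> / 2" if "x \<in> \<Delta>" for x
    using sup[OF that, of u] sup[OF that, of "- u"] by (simp add: w c_def abs_le_iff field_simps)
  \<comment> \<open>An interior point lies strictly inside the slab, which forces the width to be
    positive.\<close>
  obtain x where x: "x \<in> interior \<Delta>" using int by blast
  have "\<bar>x \<bullet> u - c\<bar> < width \<Delta> / 2"
    by (rule interior_strip[where l = "\<lambda>x. x \<bullet> u" and v = u, OF _ _ strip x])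
       (use u in \<open>auto simp: norm_eq_1 intro: bounded_linear_inner_left\<close>)
  then have w0: "width \<Delta> > 0" by linarith
  have "zeta_tau0 \<Delta> \<le> ereal (4 * (width \<Delta> / 2))"
    unfolding zeta_tau0_def
  proof (rule c_EHZ_tau0_strip_le[OF u])
    fix z :: "'n ps" assume z: "z \<in> \<Delta> \<times> cball 0 1"
    have "\<bar>snd z \<bullet> u\<bar> \<le> norm (snd z) * norm u" by (rule Cauchy_Schwarz_ineq2)
    then show "\<bar>fst z \<bullet> u - c\<bar> \<le> width \<Delta> / 2 \<and> \<bar>snd z \<bullet> u\<bar> \<le> 1" using z strip u by (auto simp: mem_Times_iff)
  qed (use w0 in \<open>auto simp: tau0_def\<close>)
  then show ?thesis using c_EHZ_tau0_Z_cyl[OF w0] by simp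
qed

end
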